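(* Let $0<p,q,u,v\le\infty$. For $n\in\mathbb{N}$ and $k\in\mathbb N$ with $\log n\le k\le n$ put $\ell(k,n):=\frac{k}{\log(n/k+1)}$. Then the following asymptotics hold, where $\asymp$ means equivalence up to positive constants that are independent of $k$ and $n$ (they may depend on $p,q,u,v$), for all $n\in\mathbb{N}$ and all $k\in\mathbb{N}$ in the indicated range: (0) If $p\neq q$ and $p,q<\infty$, then $e_k(\mathrm{id}\colon \ell_{p,u}^n\to\ell_{q,v}^n)\asymp e_k(\mathrm{id}\colon \ell_{p}^n\to\ell_{q}^n)$ for $k\in\mathbb{N}$. (I) If $q<p=\infty$, then $e_k(\mathrm{id}\colon \ell_{\infty,u}^n\to \ell_{q,v}^n)\asymp 2^{-k/n}n^{1/q}(\log (n+1))^{-1/u}$ for $k\in\mathbb{N}$. (II) If $p<q=\infty$, then \[ e_k(\mathrm{id}\colon \ell_{p,u}^n\to \ell_{\infty,v}^n)\asymp \begin{cases} 1 & \text{if } k\le \log n,\\ \ell(k,n)^{-1/p}\,\big(\log(\ell(k,n)+1)\big)^{1/v} & \text{if } \log n\le k\le n,\\ 2^{-k/n}n^{-1/p}(\log (n+1))^{1/v} & \text{if } k\ge n. \end{cases} \] (III) Let $p=q<\infty$. (III.1) If $u\le v$, then $e_k(\mathrm{id}\colon \ell_{p,u}^n\to \ell_{p,v}^n)\asymp 2^{-k/n}$ for $k\in\mathbb{N}$. (III.2) If $u>v$, then \[ e_k(\mathrm{id}\colon \ell_{p,u}^n\to \ell_{p,v}^n)\asymp \begin{cases} \big(\log(n/k+1)\big)^{1/v-1/u}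 & \text{if } k\le n,\\ 2^{-k/n} & \text{if } k\ge n. \end{cases} \] (IV) Let $p=q=\infty$. (IV.1) If $u\ge v$, then $e_k(\mathrm{id}\colon \ell_{\infty,u}^n\to \ell_{\infty,v}^n)\asymp 2^{-k/n}(\log (n+1))^{1/v-1/u}$ for $k\in\mathbb{N}$. (IV.2) If $u<v$, then \[ e_k(\mathrm{id}\colon \ell_{\infty,u}^n\to \ell_{\infty,v}^n)\asymp \begin{cases} 1 & \text{if } k\le \log n,\\ \big(\log(\ell(k,n)+1)\big)^{1/v-1/u} & \text{if } \log n\le k\le n,\\ 2^{-k/n}(\log (n+1))^{1/v-1/u} & \text{if } k\ge n. \end{cases} \]
   Context: $\mathbb{N}=\{1,2,\dots\}$, $\log$ is the natural logarithm, and $1/\infty=0$. For $x\in\mathbb{R}^n$, $x_1^*\ge x_2^*\ge\dots\ge x_n^*\ge 0$ denotes the non-increasing rearrangement of $(|x_1|,\dots,|x_n|)$. For $0<p,u\le\infty$ the Lorentz quasi-norm of $x\in\mathbb{R}^n$ is $\|x\|_{p,u}:=\big(\sum_{i=1}^n (i^{1/p-1/u}x_i^* )^u\big)^{1/u}$ if $u<\infty$ and $\|x\|_{p,\infty}:=\max_{1\le i\le n} i^{1/p}x_i^*$. Write $\ell_{p,u}^n=(\mathbb{R}^n,\|\cdot\|_{p,u})$, and $\ell_p^n=\ell_{p,p}^n$ (the usual $\ell_p$ quasi-norm on $\mathbb{R}^n$). For a continuous linear map $T\colon X\to Y$ between quasi-Banach spaces with closed unit balls $B_X,B_Y$, the $k$-th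 (dyadic) entropy number is $e_k(T\colon X\to Y):=\inf\{\varepsilon>0 : \exists\, y_1,\dots,y_{2^{k-1}}\in Y,\ T(B_X)\subset\bigcup_{i=1}^{2^{k-1}}(y_i+\varepsilon B_Y)\}$, $k\in\mathbb{N}$. $\mathrm{id}$ denotes the identity map of $\mathbb{R}^n$. *)

theory Defs
  imports
    Complex_Main
    "HOL-Library.Extended_Nonnegative_Real"
    "Jordan_Normal_Form.Matrix"
begin

text \<open>
  The dimension \<open>n\<close> is quantified inside the asymptotic statements, so \<open>\<real>\<^sup>n\<close> is rendered as
  \<^term>\<open>carrier_vec n :: real vec set\<close>. Parameters in \<open>(0, \<infinity>]\<close> have type \<^typ>\<open>ennreal\<close>.
\<close>

text \<open>The real number \<open>1/p\<close>, where \<open>1/\<infinity> = 0\<close>.\<close>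

definition recip :: "ennreal \<Rightarrow> real" where
  "recip p = enn2real (1 / p)"

text \<open>\<open>rearr x i\<close> is \<open>x\<^sub>i\<^sup>*\<close> for \<open>1 \<le> i \<le> n\<close>; list positions are counted from 0.\<close>

definition rearr :: "real vec \<Rightarrow> nat \<Rightarrow> real" where
  "rearr x i = rev (sort (map abs (list_of_vec x))) ! (i - 1)"

definition lorentz_norm :: "ennreal \<Rightarrow> ennreal \<Rightarrow> real vec \<Rightarrow> real" where
  "lorentz_norm p u x =
    (if u = \<infinity> then Max ((\<lambda>i. real i powr recip p * rearr x i) ` {1..dim_vec x})
     else (\<Sum>i = 1..dim_vec x. (real i powr (recip p - recip u) * rearr x i) powr enn2real u)
            powr recip u)"

definition lorentz_ball :: "ennreal \<Rightarrow> ennreal \<Rightarrow> nat \<Rightarrow> real vec set" where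
  "lorentz_ball p u n = {x \<in> carrier_vec n. lorentz_norm p u x \<le> 1}"

text \<open>
  The \<open>k\<close>-th dyadic entropy number (\<open>k \<ge> 1\<close>) of a map \<open>T\<close> from a space with closed unit ball \<open>BX\<close>
  into a space with underlying set \<open>Y\<close> and closed unit ball \<open>BY\<close>. The points \<open>y i\<close> need not be
  distinct.
\<close>

definition entropy_number ::
  "(real vec \<Rightarrow> real vec) \<Rightarrow> real vec set \<Rightarrow> real vec set \<Rightarrow> real vec set \<Rightarrow> nat \<Rightarrow> real" where
  "entropy_number T BX Y BY k =
    Inf {\<epsilon>. \<epsilon> > 0 \<and>
      (\<exists>y :: nat \<Rightarrow> real vec. (\<forall>i\<in>{1..2 ^ (k - 1)}. y i \<in> Y) \<and>
        T ` BX \<subseteq> (\<Union>i\<in>{1..2 ^ (k - 1)}. (\<lambda>b. y i + \<epsilon> \<cdot>\<^sub>v b) ` BY))}"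

text \<open>\<open>e_id p u q v n k\<close> is \<open>e\<^sub>k(id: \<ell>\<^sub>p\<^sub>,\<^sub>u\<^sup>n \<rightarrow> \<ell>\<^sub>q\<^sub>,\<^sub>v\<^sup>n)\<close>.\<close>

definition e_id :: "ennreal \<Rightarrow> ennreal \<Rightarrow> ennreal \<Rightarrow> ennreal \<Rightarrow> nat \<Rightarrow> nat \<Rightarrow> real" where
  "e_id p u q v n k =
    entropy_number id (lorentz_ball p u n) (carrier_vec n) (lorentz_ball q v n) k"

definition ell :: "nat \<Rightarrow> nat \<Rightarrow> real" where
  "ell k n = real k / ln (real n / real k + 1)"

text \<open>
  Equivalence up to positive constants, uniformly over all \<open>n, k \<ge> 1\<close> in the range \<open>R\<close>.
\<close>

definition asymp_equal_on ::
  "(nat \<Rightarrow> nat \<Rightarrow> bool) \<Rightarrow> (nat \<Rightarrow> nat \<Rightarrow> real) \<Rightarrow> (nat \<Rightarrow> nat \<Rightarrow> real) \<Rightarrow> bool" where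
  "asymp_equal_on R f g \<longleftrightarrow>
    (\<exists>c C. 0 < c \<and> 0 < C \<and>
      (\<forall>n\<ge>1. \<forall>k\<ge>1. R n k \<longrightarrow> c * g n k \<le> f n k \<and> f n k \<le> C * g n k))"

end

theory Submission
  imports Defs
begin

text \<open>
  Let \<open>psi m\<close> be the quasi-norm of a vector of \<open>m\<close> ones, up to constants. A vector \<open>x\<close> of the source unit
  ball satisfies \<open>x\<^sup>*\<^sub>i \<le> C / psi i\<close>, so that \<open>(\<bar>x\<^sub>j\<bar> psi m)\<^sup>r\<close>, summed over the coordinates that exceed
  \<open>1 / psi m\<close>, is of order \<open>m\<close> for a small exponent \<open>r\<close>. Volumes are replaced by counting: exponential
  moments bound the number of integer points \<open>z\<close> with \<open>\<Sum> \<bar>z\<^sub>j\<bar>\<^sup>r \<le> S\<close>.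

  Upper bounds: round \<open>x\<close> coordinatewise towards zero on a grid of width \<open>\<delta>\<close>. There are few roundings by the
  counting bound, and the error is dominated by \<open>min(\<delta>, \<bar>x\<bar>)\<close>, whose target quasi-norm is computed without a
  triangle inequality. The width \<open>\<delta> = C / psi m\<close> with \<open>m\<close> of order \<open>k / log(n/k + 1)\<close> serves \<open>k \<le> n\<close>, smaller
  widths serve \<open>k \<ge> n\<close>.

  Lower bounds: by the pigeonhole principle it suffices to exhibit many points of the source ball such that each
  target ball contains few of them. The grid in a cube gives the volume rate; sparse vectors encoding words of
  length \<open>m\<close> give the rate \<open>psi\<^sub>Y m / psi\<^sub>X m\<close>; for \<open>p = q < \<infinity>\<close> and \<open>u > v\<close> the words are repeated periodically and
  damped by \<open>i powr (-1/p)\<close>, which produces the logarithm.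
\<close>

section \<open>Parameters and rearrangements\<close>

text \<open>The function \<open>psi\<close> grows at most polynomially, even where it is a power of
  a logarithm; hence a suitable small exponent \<open>r\<close> exists for every choice of the
  parameters. The obstacle to the upper bounds is the range of \<open>k\<close> well below
  \<open>n\<close>: an error known only to be at most \<open>\<delta>\<close> in each coordinate
  would cost \<open>\<delta> * psi\<^sub>Y n\<close> in the target, not
  \<open>\<delta> * psi\<^sub>Y m\<close>. Its domination by \<open>\<bar>x\<bar>\<close> hands the
  coordinates beyond the \<open>m\<close> largest to the norm of the source. For
  \<open>p = q < \<infinity>\<close> the quotient \<open>psi\<^sub>Y / psi\<^sub>X\<close> is 1 at
  every support size, so flat test vectors cannot produce the logarithm. The extremal profile is
  \<open>i powr (-1/p)\<close>, whose dyadic blocks all carry the same weight; words are repeated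
  because two of them must be far apart on all these blocks at once. Functions are compared at
  arguments at least \<open>1/2\<close>, since the support size \<open>k / log(n/k + 1)\<close> may
  drop below 1 in the middle range, but not below \<open>1/2\<close>.\<close>

lemma recip_ennreal: "0 < r \<Longrightarrow> recip (ennreal r) = 1 / r"
  unfolding recip_def by (simp add: divide_ennreal flip: ennreal_1)

lemma recip_top: "recip \<infinity> = 0"
  by (simp add: recip_def)

lemma recip_cases:
  assumes "0 < p"
  obtains "p = \<infinity>" "recip p = 0"
  | r where "0 < r" "p = ennreal r" "recip p = 1 / r" "p < \<infinity>" "recip p > 0" "enn2real p = 1 / recip p"
proof (cases p)
  case (real r)
  with assms have "0 < r" by (auto simp: ennreal_less_zero_iff)
  with real that(2) show ?thesis by (simp add: recip_ennreal)
next
  case top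
  then have "p = \<infinity>" by simp
  then show ?thesis using that(1) by (simp only: recip_top simp_thms)
qed

lemma recip_nonneg [simp]: "0 \<le> recip p"
  by (simp add: recip_def)

lemma recip_less_iff:
  assumes "0 < p" "0 < q"
  shows "recip q < recip p \<longleftrightarrow> p < q"
  using assms(1)
proof (cases p rule: recip_cases)
  case 1
  then show ?thesis by (simp add: not_less)
next
  case p: (2 r)
  show ?thesis
    using assms(2)
  proof (cases q rule: recip_cases)
    case 1
    then show ?thesis using p by simp
  next
    case q: (2 r')
    have "1 / r' < 1 / r \<longleftrightarrow> r < r'" using p(1) q(1) by (simp add: field_simps)
    moreover have "p < q \<longleftrightarrow> r < r'" unfolding p(2) q(2) using p(1) by (simp add: ennreal_less_iff)
    ultimately show ?thesis by (simp only: p(3) q(3))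
  qed
qed

lemma recip_eq_iff:
  assumes "0 < p" "0 < q"
  shows "recip p = recip q \<longleftrightarrow> p = q"
  using recip_less_iff[OF assms] recip_less_iff[OF assms(2,1)] by (metis less_irrefl linorder_less_linear)

lemma recip_pos_iff: "0 < p \<Longrightarrow> 0 < recip p \<longleftrightarrow> p < \<infinity>"
  using recip_less_iff[of p \<infinity>] by (simp only: recip_top) simp

text \<open>The parameters \<open>p, u\<close> enter through \<open>s = 1/p\<close> and \<open>a = 1/u\<close>, so that \<open>a = 0\<close> means \<open>u = \<infinity>\<close>.\<close>

definition lnorm :: "real \<Rightarrow> real \<Rightarrow> real vec \<Rightarrow> real" where
  "lnorm s a x =
    (if a = 0 then Max ((\<lambda>i. real i powr s * rearr x i) ` {1..dim_vec x})
     else (\<Sum>i = 1..dim_vec x. (real i powr (s - a) * rearr x i) powr (1 / a)) powr a)"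

lemma lorentz_norm_eq_lnorm:
  assumes "0 < u"
  shows "lorentz_norm p u x = lnorm (recip p) (recip u) x"
  using assms by (cases u rule: recip_cases) (auto simp: lorentz_norm_def lnorm_def)

definition lball :: "real \<Rightarrow> real \<Rightarrow> nat \<Rightarrow> real vec set" where
  "lball s a n = {x \<in> carrier_vec n. lnorm s a x \<le> 1}"

section \<open>Order statistics through the distribution function\<close>

lemma length_filter_ge_sorted_desc:
  fixes r :: "real list"
  assumes "sorted_wrt (\<ge>) r" "i < length r"
  shows "c \<le> r ! i \<longleftrightarrow> i < length (filter (\<lambda>y. c \<le> y) r)"
  using assms
proof (induction r arbitrary: i)
  case (Cons y r)
  show ?case
  proof (cases i)
    case 0
    show ?thesis
    proof (cases "c \<le> y")
      case False
      then have "filter (\<lambda>y. c \<le> y) r = []"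
        using Cons.prems by (fastforce simp: filter_empty_conv)
      then show ?thesis using False 0 by simp
    qed (simp add: 0)
  next
    case (Suc j)
    have IH: "c \<le> r ! j \<longleftrightarrow> j < length (filter (\<lambda>y. c \<le> y) r)"
      using Cons Suc by simp
    show ?thesis
    proof (cases "c \<le> y")
      case False
      then have "filter (\<lambda>y. c \<le> y) r = []"
        using Cons.prems by (fastforce simp: filter_empty_conv)
      then show ?thesis using False Suc IH by simp
    qed (use IH Suc in simp)
  qed
qed simp

text \<open>The entries of a non-increasing list that are at least \<open>c\<close> form an initial
  segment, so a threshold test at position \<open>i\<close> is a count. This trades the sorted list
  for the distribution function of \<open>x\<close>; apart from \<open>sum_rearr\<close>, the facts
  on \<open>rearr\<close> below rest on it.\<close>

lemma le_rearr_iff: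
  assumes "1 \<le> i" "i \<le> dim_vec x"
  shows "c \<le> rearr x i \<longleftrightarrow> i \<le> card {j. j < dim_vec x \<and> c \<le> \<bar>x $ j\<bar>}"
proof -
  let ?l = "map abs (list_of_vec x)" and ?r = "rev (sort (map abs (list_of_vec x)))"
  have len: "length ?r = dim_vec x" by simp
  have "c \<le> rearr x i \<longleftrightarrow> i - 1 < length (filter (\<lambda>y. c \<le> y) ?r)"
    unfolding rearr_def
    by (rule length_filter_ge_sorted_desc) (use assms in \<open>auto simp: sorted_wrt_rev\<close>)
  also have "length (filter (\<lambda>y. c \<le> y) ?r) = length (filter (\<lambda>y. c \<le> y) ?l)"
    by (metis mset_filter mset_rev mset_sort size_mset)
  also have "\<dots> = card {j. j < dim_vec x \<and> c \<le> \<bar>x $ j\<bar>}"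
    unfolding length_filter_conv_card by (intro arg_cong[of _ _ card]) (auto simp: list_of_vec_index)
  finally show ?thesis using assms by linarith
qed

lemma sum_rearr: "(\<Sum>i = 1..dim_vec x. g (rearr x i)) = (\<Sum>j<dim_vec x. g \<bar>x $ j\<bar>)" for g :: "real \<Rightarrow> real"
proof -
  let ?l = "map abs (list_of_vec x)" and ?r = "rev (sort (map abs (list_of_vec x)))"
  have "(\<Sum>i = 1..dim_vec x. g (rearr x i)) = (\<Sum>i<dim_vec x. g (?r ! i))"
    by (rule sum.reindex_bij_witness[of _ Suc "\<lambda>i. i - 1"]) (auto simp: rearr_def)
  also have "\<dots> = sum_list (map g ?r)"
    by (simp add: sum_list_sum_nth atLeast0LessThan)
  also have "\<dots> = sum_list (map g ?l)"
  proof -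
    have "mset (map g ?r) = mset (map g ?l)" by (simp only: mset_map mset_rev mset_sort)
    then show ?thesis by (simp only: flip: sum_mset_sum_list)
  qed
  also have "\<dots> = (\<Sum>j<dim_vec x. g \<bar>x $ j\<bar>)"
    by (simp add: sum_list_sum_nth atLeast0LessThan list_of_vec_index)
  finally show ?thesis .
qed

lemma rearr_nonneg: "1 \<le> i \<Longrightarrow> i \<le> dim_vec x \<Longrightarrow> 0 \<le> rearr x i"
  by (subst le_rearr_iff) auto

lemma rearr_le_rearr:
  assumes "dim_vec x = dim_vec y" "\<And>j. j < dim_vec y \<Longrightarrow> \<bar>x $ j\<bar> \<le> \<bar>y $ j\<bar>" "1 \<le> i" "i \<le> dim_vec y"
  shows "rearr x i \<le> rearr y i"
proof -
  have "i \<le> card {j. j < dim_vec y \<and> rearr x i \<le> \<bar>x $ j\<bar>}"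
    using le_rearr_iff[of i x "rearr x i"] assms by simp
  also have "\<dots> \<le> card {j. j < dim_vec y \<and> rearr x i \<le> \<bar>y $ j\<bar>}"
    by (rule card_mono) (auto intro: order_trans assms(2))
  finally show ?thesis using assms by (simp add: le_rearr_iff)
qed

lemma rearr_antimono:
  assumes "1 \<le> i" "i \<le> i'" "i' \<le> dim_vec x"
  shows "rearr x i' \<le> rearr x i"
  using le_rearr_iff[of i' x "rearr x i'"] assms by (simp add: le_rearr_iff)

text \<open>At least \<open>i\<close> coordinates are as large as the \<open>i\<close>-th largest
  one, so one of them has a position \<open>j \<ge> i - 1\<close> (positions start at 0), where the
  envelope \<open>g j\<close> is at most \<open>g (i - 1)\<close>. A vector with a decaying envelope
  is thus handled without sorting it.\<close>

lemma rearr_le_antimono_bound: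
  assumes "\<And>j. j < dim_vec x \<Longrightarrow> \<bar>x $ j\<bar> \<le> g j" "\<And>i j. i \<le> j \<Longrightarrow> g j \<le> g i" "1 \<le> i" "i \<le> dim_vec x"
  shows "rearr x i \<le> g (i - 1)"
proof -
  let ?A = "{j. j < dim_vec x \<and> rearr x i \<le> \<bar>x $ j\<bar>}"
  have c: "i \<le> card ?A" using le_rearr_iff[of i x "rearr x i"] assms by simp
  have "\<not> ?A \<subseteq> {..<i-1}"
  proof
    assume "?A \<subseteq> {..<i-1}"
    then have "card ?A \<le> i - 1" using card_mono[of "{..<i-1}" ?A] by simp
    with c assms show False by simp
  qed
  then obtain j where "j \<in> ?A" "j \<notin> {..<i-1}" by blast
  then have "j \<in> ?A" "i - 1 \<le> j" by simp_all
  then show ?thesis using assms(1)[of j] assms(2)[of "i-1" j] by auto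
qed

lemma rearr_le_bound:
  assumes "\<And>j. j < dim_vec x \<Longrightarrow> \<bar>x $ j\<bar> \<le> d" "1 \<le> i" "i \<le> dim_vec x"
  shows "rearr x i \<le> d"
  using rearr_le_antimono_bound[of x "\<lambda>_. d"] assms by simp

lemma rearr_eq_0_beyond_support:
  assumes "card {j. j < dim_vec x \<and> x $ j \<noteq> 0} < i" "i \<le> dim_vec x"
  shows "rearr x i = 0"
proof (rule ccontr)
  assume "rearr x i \<noteq> 0"
  then have p: "rearr x i > 0" using rearr_nonneg[of i x] assms by linarith
  have "i \<le> card {j. j < dim_vec x \<and> rearr x i \<le> \<bar>x $ j\<bar>}"
    using le_rearr_iff[of i x "rearr x i"] assms by simp
  also have "\<dots> \<le> card {j. j < dim_vec x \<and> x $ j \<noteq> 0}"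
    by (rule card_mono) (use p in auto)
  finally show False using assms by simp
qed

lemma rearr_smult:
  assumes "1 \<le> i" "i \<le> dim_vec x"
  shows "rearr (c \<cdot>\<^sub>v x) i = \<bar>c\<bar> * rearr x i"
proof (cases "c = 0")
  case True
  then have "{j. j < dim_vec x \<and> (c \<cdot>\<^sub>v x) $ j \<noteq> 0} = {}" by auto
  then have "card {j. j < dim_vec (c \<cdot>\<^sub>v x) \<and> (c \<cdot>\<^sub>v x) $ j \<noteq> 0} = 0" by (simp only: index_smult_vec card.empty)
  then have "card {j. j < dim_vec (c \<cdot>\<^sub>v x) \<and> (c \<cdot>\<^sub>v x) $ j \<noteq> 0} < i" using assms(1) by linarith
  then have "rearr (c \<cdot>\<^sub>v x) i = 0" by (rule rearr_eq_0_beyond_support) (simp add: assms(2))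
  then show ?thesis using True by simp
next
  case False
  \<comment> \<open>Two reals with the same lower bounds coincide. Thresholds are rescaled by
    \<open>\<bar>c\<bar>\<close>, which is why \<open>c = 0\<close> is split off.\<close>
  have "t \<le> rearr (c \<cdot>\<^sub>v x) i \<longleftrightarrow> t \<le> \<bar>c\<bar> * rearr x i" for t
  proof -
    have e: "t \<le> \<bar>c\<bar> * y \<longleftrightarrow> t / \<bar>c\<bar> \<le> y" for y
      using False by (simp add: pos_divide_le_eq mult.commute)
    have "{j. j < dim_vec x \<and> t \<le> \<bar>(c \<cdot>\<^sub>v x) $ j\<bar>} = {j. j < dim_vec x \<and> t / \<bar>c\<bar> \<le> \<bar>x $ j\<bar>}"
      by (auto simp: abs_mult e)
    then show ?thesis using assms by (simp add: le_rearr_iff e)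
  qed
  then show ?thesis by (meson order_antisym order_refl)
qed

section \<open>Quasi-norms as weighted power sums\<close>

abbreviation lterm :: "real \<Rightarrow> real \<Rightarrow> real vec \<Rightarrow> nat \<Rightarrow> real" where
  "lterm s a x i \<equiv> real i powr (s / a - 1) * rearr x i powr (1 / a)"

text \<open>For a finite second index \<open>1 / a\<close> the outer root is removed and
  \<open>(i powr (s - a)) powr (1 / a)\<close> becomes \<open>i powr (s / a - 1)\<close>. The
  resulting sums can be split over ranges of \<open>i\<close>, where the quasi-norm itself would
  need a quasi-triangle inequality.\<close>

lemma lnorm_le_iff:
  assumes "0 < a" "0 \<le> \<epsilon>"
  shows "lnorm s a x \<le> \<epsilon> \<longleftrightarrow>
    (\<Sum>i = 1..dim_vec x. lterm s a x i) \<le> \<epsilon> powr (1 / a)"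
proof -
  let ?S = "\<Sum>i = 1..dim_vec x. lterm s a x i"
  have S: "lnorm s a x = ?S powr a"
    unfolding lnorm_def using assms
    by (auto simp: powr_mult powr_powr rearr_nonneg diff_divide_distrib intro!: arg_cong[of _ _ "\<lambda>y. y powr a"] sum.cong)
  have S0: "0 \<le> ?S" by (intro sum_nonneg) auto
  show ?thesis
  proof
    assume "lnorm s a x \<le> \<epsilon>"
    then have "(?S powr a) powr (1 / a) \<le> \<epsilon> powr (1 / a)" using S assms by (intro powr_mono2) auto
    then show "?S \<le> \<epsilon> powr (1 / a)" using S0 assms by (simp add: powr_powr)
  next
    assume "?S \<le> \<epsilon> powr (1 / a)"
    then have "?S powr a \<le> (\<epsilon> powr (1 / a)) powr a" using S0 assms by (intro powr_mono2) auto
    then show "lnorm s a x \<le> \<epsilon>" using S assms by (simp add: powr_powr)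
  qed
qed

lemma lnorm_0_le_iff:
  assumes "1 \<le> dim_vec x"
  shows "lnorm s 0 x \<le> \<epsilon> \<longleftrightarrow> (\<forall>i. 1 \<le> i \<and> i \<le> dim_vec x \<longrightarrow> real i powr s * rearr x i \<le> \<epsilon>)"
proof -
  have "{1..dim_vec x} \<noteq> {}" using assms by simp
  then show ?thesis unfolding lnorm_def by (auto simp: Max_le_iff)
qed

lemma lnorm_smult:
  assumes "0 \<le> c" "1 \<le> dim_vec x" "0 \<le> a" "0 \<le> \<epsilon>" "lnorm s a x \<le> \<epsilon>"
  shows "lnorm s a (c \<cdot>\<^sub>v x) \<le> c * \<epsilon>"
proof (cases "a = 0")
  case True
  then show ?thesis using assms
    by (auto simp: lnorm_0_le_iff rearr_smult mult.left_commute intro: mult_left_mono)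
next
  case False
  then have a: "a > 0" using assms by simp
  have "(\<Sum>i = 1..dim_vec x. real i powr (s / a - 1) * rearr (c \<cdot>\<^sub>v x) i powr (1 / a))
     = c powr (1/a) * (\<Sum>i = 1..dim_vec x. lterm s a x i)"
    using assms by (auto simp: sum_distrib_left rearr_smult powr_mult rearr_nonneg intro!: sum.cong)
  also have "\<dots> \<le> c powr (1/a) * \<epsilon> powr (1/a)"
    using assms a by (intro mult_left_mono) (auto simp: lnorm_le_iff)
  finally show ?thesis using a assms by (subst lnorm_le_iff) (auto simp: powr_mult)
qed

section \<open>Entropy numbers\<close>

definition covers :: "real \<Rightarrow> real \<Rightarrow> real \<Rightarrow> real \<Rightarrow> nat \<Rightarrow> nat \<Rightarrow> real \<Rightarrow> bool" where
  "covers s a t b n k \<epsilon> \<longleftrightarrow> \<epsilon> > 0 \<and>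
      (\<exists>y :: nat \<Rightarrow> real vec. (\<forall>i\<in>{1..2 ^ (k - 1)}. y i \<in> carrier_vec n) \<and>
        lball s a n \<subseteq> (\<Union>i\<in>{1..2 ^ (k - 1)}. (\<lambda>z. y i + \<epsilon> \<cdot>\<^sub>v z) ` lball t b n))"

definition ent :: "real \<Rightarrow> real \<Rightarrow> real \<Rightarrow> real \<Rightarrow> nat \<Rightarrow> nat \<Rightarrow> real" where
  "ent s a t b n k = Inf {\<epsilon>. covers s a t b n k \<epsilon>}"

lemma e_id_eq_ent:
  assumes "0 < u" "0 < v"
  shows "e_id p u q v n k = ent (recip p) (recip u) (recip q) (recip v) n k"
  using assms unfolding e_id_def ent_def entropy_number_def covers_def lball_def lorentz_ball_def
  by (simp add: lorentz_norm_eq_lnorm)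

lemma ent_le: "covers s a t b n k \<epsilon> \<Longrightarrow> ent s a t b n k \<le> \<epsilon>"
  unfolding ent_def by (rule cInf_lower) (auto intro!: bdd_belowI[of _ 0] simp: covers_def)

text \<open>\<open>Inf\<close> over the reals says nothing about an empty set, so one admissible
  \<open>\<epsilon>0\<close> has to be supplied; \<open>ex_covers\<close> will provide it.\<close>

lemma ent_ge:
  assumes "covers s a t b n k \<epsilon>0" "\<And>\<epsilon>. covers s a t b n k \<epsilon> \<Longrightarrow> c \<le> \<epsilon>"
  shows "c \<le> ent s a t b n k"
  unfolding ent_def using assms by (intro cInf_greatest) auto

text \<open>Coverings are indexed by exactly \<open>2 ^ (k - 1)\<close> numbers, whereas
  constructions give a finite set of at most that many centres; spare indices receive the zero
  vector. Homogeneity turns an error of quasi-norm at most \<open>\<epsilon>\<close> into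
  \<open>\<epsilon>\<close> times an element of the target ball.\<close>

lemma coversI:
  assumes "0 < \<epsilon>" "1 \<le> n" "0 \<le> b" "finite Z" "card Z \<le> 2 ^ (k - 1)" "\<And>z. z \<in> Z \<Longrightarrow> f z \<in> carrier_vec n"
    "\<And>x. x \<in> lball s a n \<Longrightarrow> \<exists>z\<in>Z. lnorm t b (x - f z) \<le> \<epsilon>"
  shows "covers s a t b n k \<epsilon>"
proof -
  define N where "N = (2::nat) ^ (k - 1)"
  have N: "N \<ge> 1" by (simp add: N_def)
  obtain h where h: "bij_betw h {1..card Z} Z" using ex_bij_betw_nat_finite_1[OF assms(4)] by blast
  define y where "y = (\<lambda>i. if i \<in> {1..card Z} then f (h i) else 0\<^sub>v n)"
  have "y i \<in> carrier_vec n" for i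
    unfolding y_def using h assms(6) by (auto dest: bij_betwE)
  moreover have "lball s a n \<subseteq> (\<Union>i\<in>{1..N}. (\<lambda>z. y i + \<epsilon> \<cdot>\<^sub>v z) ` lball t b n)"
  proof
    fix x assume x: "x \<in> lball s a n"
    then have xc: "x \<in> carrier_vec n" by (simp add: lball_def)
    obtain z where z: "z \<in> Z" "lnorm t b (x - f z) \<le> \<epsilon>" using assms(7)[OF x] by blast
    obtain i where i: "i \<in> {1..card Z}" "h i = z" using h z unfolding bij_betw_def by force
    have fz: "f z \<in> carrier_vec n" using assms(6) z by simp
    have yi: "y i = f z" using i by (auto simp: y_def)
    let ?w = "(1 / \<epsilon>) \<cdot>\<^sub>v (x - f z)"
    have "lnorm t b ?w \<le> (1 / \<epsilon>) * \<epsilon>"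
      by (rule lnorm_smult) (use assms(1-3) z carrier_vecD[OF fz] in auto)
    then have "?w \<in> lball t b n" using assms xc fz by (auto simp: lball_def)
    moreover have "x = y i + \<epsilon> \<cdot>\<^sub>v ?w" using xc fz assms yi by (intro eq_vecI) auto
    moreover have "i \<in> {1..N}" using i assms(5) by (auto simp: N_def)
    ultimately show "x \<in> (\<Union>i\<in>{1..N}. (\<lambda>z. y i + \<epsilon> \<cdot>\<^sub>v z) ` lball t b n)" by blast
  qed
  ultimately show ?thesis using assms(1) unfolding covers_def N_def by blast
qed

lemma covers_if_lnorm_le:
  assumes "0 < \<epsilon>" "1 \<le> n" "0 \<le> b" "\<And>x. x \<in> lball s a n \<Longrightarrow> lnorm t b x \<le> \<epsilon>"
  shows "covers s a t b n k \<epsilon>"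
proof (rule coversI[of \<epsilon> n b "{()}" k "\<lambda>_. 0\<^sub>v n"])
  fix x assume x: "x \<in> lball s a n"
  then have "x - 0\<^sub>v n = x" by (auto simp: lball_def)
  then show "\<exists>z\<in>{()}. lnorm t b (x - 0\<^sub>v n) \<le> \<epsilon>" using assms(4) x by simp
qed (use assms in auto)

abbreviation ball_mates ::
  "real \<Rightarrow> real \<Rightarrow> nat \<Rightarrow> real \<Rightarrow> ('a \<Rightarrow> real vec) \<Rightarrow> 'a set \<Rightarrow> 'a \<Rightarrow> 'a set" where
  "ball_mates t b n \<epsilon> X P f \<equiv>
    {g \<in> P. \<exists>w\<in>lball t b n. \<exists>w'\<in>lball t b n. X f - X g = \<epsilon> \<cdot>\<^sub>v (w - w')}"

text \<open>Pigeonhole: two points of \<open>P\<close> in the same covering ball differ by \<open>\<epsilon>\<close> times a difference of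
  two elements of the target unit ball.\<close>

lemma covers_card_le:
  assumes "covers s a t b n k \<epsilon>" "finite P" "X ` P \<subseteq> lball s a n"
    "\<And>f. f \<in> P \<Longrightarrow> real (card {g \<in> P. \<exists>w\<in>lball t b n. \<exists>w'\<in>lball t b n. X f - X g = \<epsilon> \<cdot>\<^sub>v (w - w')}) \<le> M"
    "0 \<le> M"
  shows "real (card P) \<le> 2 ^ (k - 1) * M"
proof -
  define N where "N = (2::nat) ^ (k - 1)"
  obtain y where y: "\<And>i. i \<in> {1..N} \<Longrightarrow> y i \<in> carrier_vec n"
    "lball s a n \<subseteq> (\<Union>i\<in>{1..N}. (\<lambda>z. y i + \<epsilon> \<cdot>\<^sub>v z) ` lball t b n)"
    using assms(1) unfolding covers_def N_def by blast
  define Q where "Q i = {f \<in> P. X f \<in> (\<lambda>z. y i + \<epsilon> \<cdot>\<^sub>v z) ` lball t b n}" for i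
  have "P \<subseteq> (\<Union>i\<in>{1..N}. Q i)"
  proof
    fix f assume f: "f \<in> P"
    then have "X f \<in> (\<Union>i\<in>{1..N}. (\<lambda>z. y i + \<epsilon> \<cdot>\<^sub>v z) ` lball t b n)"
      using assms(3) y(2) by blast
    then obtain i where "i \<in> {1..N}" "X f \<in> (\<lambda>z. y i + \<epsilon> \<cdot>\<^sub>v z) ` lball t b n" by (rule UN_E)
    then show "f \<in> (\<Union>i\<in>{1..N}. Q i)" using f unfolding Q_def by blast
  qed
  then have "card P \<le> card (\<Union>i\<in>{1..N}. Q i)"
    using assms(2) by (intro card_mono) (auto simp: Q_def)
  also have "\<dots> \<le> (\<Sum>i\<in>{1..N}. card (Q i))" by (rule card_UN_le) simp
  finally have "real (card P) \<le> (\<Sum>i\<in>{1..N}. real (card (Q i)))" 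
    by (metis of_nat_le_iff of_nat_sum)
  also have "\<dots> \<le> (\<Sum>i\<in>{1..N}. M)"
  proof (rule sum_mono)
    fix i assume i: "i \<in> {1..N}"
    show "real (card (Q i)) \<le> M"
    proof (cases "Q i = {}")
      case True
      then show ?thesis using assms(5) by simp
    next
      case False
      then obtain f w where f: "f \<in> P" "w \<in> lball t b n" "X f = y i + \<epsilon> \<cdot>\<^sub>v w" unfolding Q_def by blast
      \<comment> \<open>The difference of two ball elements is never measured in the target
        quasi-norm: the pair \<open>w\<close>, \<open>w'\<close> itself is passed on to the counting
        arguments.\<close>
      have "Q i \<subseteq> {g \<in> P. \<exists>w\<in>lball t b n. \<exists>w'\<in>lball t b n. X f - X g = \<epsilon> \<cdot>\<^sub>v (w - w')}"
      proof
        fix g assume "g \<in> Q i"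
        then obtain w' where g: "g \<in> P" "w' \<in> lball t b n" "X g = y i + \<epsilon> \<cdot>\<^sub>v w'" unfolding Q_def by blast
        have "X f - X g = \<epsilon> \<cdot>\<^sub>v (w - w')"
          using f g y(1)[OF i] unfolding f(3) g(3) 
          by (intro eq_vecI) (auto simp: lball_def algebra_simps)
        then show "g \<in> {g \<in> P. \<exists>w\<in>lball t b n. \<exists>w'\<in>lball t b n. X f - X g = \<epsilon> \<cdot>\<^sub>v (w - w')}"
          using f g by blast
      qed
      then have "real (card (Q i)) \<le> real (card {g \<in> P. \<exists>w\<in>lball t b n. \<exists>w'\<in>lball t b n. X f - X g = \<epsilon> \<cdot>\<^sub>v (w - w')})"
        using assms(2) by (intro of_nat_mono card_mono) auto
      also have "\<dots> \<le> M" by (rule assms(4)[OF f(1)])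
      finally show ?thesis .
    qed
  qed
  also have "\<dots> = 2 ^ (k - 1) * M" by (simp add: N_def)
  finally show ?thesis .
qed

section \<open>Power sums and the fundamental function\<close>

lemma powr_succ_diff:
  fixes y \<delta> :: real
  assumes "0 < y"
  obtains \<xi> where "y < \<xi>" "\<xi> < y + 1" "(y + 1) powr \<delta> - y powr \<delta> = \<delta> * \<xi> powr (\<delta> - 1)"
proof -
  have "\<exists>z>y. z < y + 1 \<and> (y + 1) powr \<delta> - y powr \<delta> = (y + 1 - y) * (\<delta> * z powr (\<delta> - 1))"
    by (rule MVT2) (use assms in \<open>auto intro!: derivative_eq_intros simp: field_simps powr_diff\<close>)
  then show ?thesis using that by auto
qed

text \<open>By the mean value theorem one increment of \<open>x powr \<gamma> / \<gamma>\<close> is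
  a value of \<open>x powr (\<gamma> - 1)\<close> between \<open>m\<close> and \<open>m + 1\<close>;
  the sign of \<open>\<gamma> - 1\<close> decides on which side of the new summand it lies.\<close>

lemma sum_powr_le_telescope:
  fixes \<gamma> :: real
  assumes "0 < \<gamma>" "\<gamma> \<le> 1"
  shows "(\<Sum>i = 1..m. real i powr (\<gamma> - 1)) \<le> real m powr \<gamma> / \<gamma>"
proof (induction m)
  case (Suc m)
  have "real (Suc m) powr (\<gamma> - 1) \<le> (real (Suc m) powr \<gamma> - real m powr \<gamma>) / \<gamma>"
  proof (cases "m = 0")
    case True
    then show ?thesis using assms by simp
  next
    case False
    then obtain \<xi> where \<xi>: "real m < \<xi>" "\<xi> < real m + 1"
      "(real m + 1) powr \<gamma> - real m powr \<gamma> = \<gamma> * \<xi> powr (\<gamma> - 1)"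
      using powr_succ_diff[of "real m" \<gamma>] by auto
    have "real (Suc m) powr (\<gamma> - 1) \<le> \<xi> powr (\<gamma> - 1)"
      using \<xi> assms by (intro powr_mono2') auto
    then show ?thesis using \<xi> assms by (simp add: add.commute)
  qed
  then show ?case using Suc by (simp add: diff_divide_distrib)
qed simp

lemma sum_powr_ge_telescope:
  fixes \<gamma> :: real
  assumes "1 \<le> \<gamma>"
  shows "real m powr \<gamma> / \<gamma> \<le> (\<Sum>i = 1..m. real i powr (\<gamma> - 1))"
proof (induction m)
  case (Suc m)
  have "(real (Suc m) powr \<gamma> - real m powr \<gamma>) / \<gamma> \<le> real (Suc m) powr (\<gamma> - 1)"
  proof (cases "m = 0")
    case True
    then show ?thesis using assms by simp
  next
    case False
    then obtain \<xi> where \<xi>: "real m < \<xi>" "\<xi> < real m + 1"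
      "(real m + 1) powr \<gamma> - real m powr \<gamma> = \<gamma> * \<xi> powr (\<gamma> - 1)"
      using powr_succ_diff[of "real m" \<gamma>] by auto
    have "\<xi> powr (\<gamma> - 1) \<le> real (Suc m) powr (\<gamma> - 1)"
      using \<xi> assms by (intro powr_mono2) auto
    then show ?thesis using \<xi> assms by (simp add: add.commute)
  qed
  then show ?case using Suc by (simp add: diff_divide_distrib)
qed (use assms in simp)

lemma sum_powr_le:
  fixes \<gamma> :: real
  assumes "0 < \<gamma>"
  obtains C where "C > 0" "\<And>m::nat. (\<Sum>i = 1..m. real i powr (\<gamma> - 1)) \<le> C * real m powr \<gamma>"
proof (cases "\<gamma> \<le> 1")
  case True
  show ?thesis by (rule that[of "1 / \<gamma>"]) (use sum_powr_le_telescope[OF assms True] assms in auto)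
next
  case False
  show ?thesis
  proof (rule that[of 1])
    fix m :: nat
    have "(\<Sum>i = 1..m. real i powr (\<gamma> - 1)) \<le> (\<Sum>i = 1..m. real m powr (\<gamma> - 1))"
      using False by (intro sum_mono powr_mono2) auto
    also have "\<dots> = 1 * real m powr \<gamma>" by (cases "m = 0") (auto simp: powr_diff)
    finally show "(\<Sum>i = 1..m. real i powr (\<gamma> - 1)) \<le> 1 * real m powr \<gamma>" .
  qed simp
qed

lemma sum_powr_ge:
  fixes \<gamma> :: real
  assumes "0 < \<gamma>"
  obtains c where "c > 0" "\<And>m::nat. c * real m powr \<gamma> \<le> (\<Sum>i = 1..m. real i powr (\<gamma> - 1))"
proof (cases "1 \<le> \<gamma>")
  case True
  show ?thesis by (rule that[of "1 / \<gamma>"]) (use sum_powr_ge_telescope[OF True] assms in auto)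
next
  case False
  show ?thesis
  proof (rule that[of 1])
    fix m :: nat
    have "1 * real m powr \<gamma> = (\<Sum>i = 1..m. real m powr (\<gamma> - 1))"
      by (cases "m = 0") (auto simp: powr_diff)
    also have "\<dots> \<le> (\<Sum>i = 1..m. real i powr (\<gamma> - 1))"
      using False by (intro sum_mono powr_mono2') auto
    finally show "1 * real m powr \<gamma> \<le> (\<Sum>i = 1..m. real i powr (\<gamma> - 1))" .
  qed simp
qed

lemma sum_tail_powr_le:
  fixes \<gamma> :: real
  assumes "0 < \<gamma>" "1 \<le> m" "m \<le> n"
  shows "(\<Sum>i = Suc m..n. real i powr (- \<gamma> - 1)) \<le> real m powr (- \<gamma>) / \<gamma>"
proof -
  have "(\<Sum>i = Suc m..n. real i powr (- \<gamma> - 1)) \<le> (real m powr (- \<gamma>) - real n powr (- \<gamma>)) / \<gamma>"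
    using assms(3)
  proof (induction n rule: dec_induct)
    case (step n)
    then obtain \<xi> where \<xi>: "real n < \<xi>" "\<xi> < real n + 1"
      "(real n + 1) powr (- \<gamma>) - real n powr (- \<gamma>) = - \<gamma> * \<xi> powr (- \<gamma> - 1)"
      using powr_succ_diff[of "real n" "- \<gamma>"] assms by auto
    have "real (Suc n) powr (- \<gamma> - 1) \<le> \<xi> powr (- \<gamma> - 1)"
      using \<xi> assms by (intro powr_mono2') auto
    also have "\<dots> = (real n powr (- \<gamma>) - real (Suc n) powr (- \<gamma>)) / \<gamma>"
      using \<xi>(3) assms by (simp add: field_simps)
    finally show ?case using step by (simp add: diff_divide_distrib)
  qed simp
  also have "\<dots> \<le> real m powr (- \<gamma>) / \<gamma>" using assms by (intro divide_right_mono) auto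
  finally show ?thesis .
qed

lemma sum_tail_inverse_le:
  assumes "1 \<le> m" "m \<le> n"
  shows "(\<Sum>i = Suc m..n. real i powr (- 1)) \<le> ln (real n / real m)"
  using assms(2)
proof (induction n rule: dec_induct)
  case base
  then show ?case using assms by simp
next
  case (step n)
  have "1 / real (Suc n) \<le> ln (real (Suc n)) - ln (real n)"
  proof -
    have "ln (real n / real (Suc n)) \<le> real n / real (Suc n) - 1"
      using step assms by (intro ln_le_minus_one) auto
    moreover have "real n / real (Suc n) - 1 = - (1 / real (Suc n))" by (simp add: field_simps)
    moreover have "ln (real n / real (Suc n)) = ln (real n) - ln (real (Suc n))"
      using step assms by (simp add: ln_div)
    ultimately show ?thesis by linarith
  qed
  then show ?case using step assms by (simp add: ln_div powr_minus_divide)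
qed

text \<open>The factor 2 pays for \<open>ln (m + 1)\<close> in place of \<open>1 + ln m\<close>:
  \<open>1 / (m + 1) \<le> 2 / (m + 2) \<le> 2 * (ln (m + 2) - ln (m + 1))\<close>. The shifted
  logarithm is the one in \<open>psi\<close> and is positive from \<open>m = 1\<close> on.\<close>

lemma sum_inverse_le: "(\<Sum>i = 1..m. real i powr (- 1)) \<le> 2 * ln (real m + 1)"
proof (induction m)
  case (Suc m)
  define q where "q = 1 / real (Suc m)"
  have "ln (real (Suc m)) - ln (real (Suc m) + 1) = ln (real (Suc m) / (real (Suc m) + 1))"
    by (simp add: ln_div)
  also have "\<dots> \<le> real (Suc m) / (real (Suc m) + 1) - 1"
    by (intro ln_le_minus_one) auto
  also have "\<dots> \<le> - (q / 2)" by (simp add: q_def field_simps)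
  finally have "q \<le> 2 * (ln (real (Suc m) + 1) - ln (real (Suc m)))" by simp
  then show ?case using Suc by (simp add: q_def powr_minus_divide add.commute)
qed simp

lemma sum_inverse_ge: "ln (real m + 1) \<le> (\<Sum>i = 1..m. real i powr (- 1))"
proof (induction m)
  case (Suc m)
  have "ln ((real (Suc m) + 1) / real (Suc m)) \<le> (real (Suc m) + 1) / real (Suc m) - 1"
    by (intro ln_le_minus_one) auto
  then have "ln (real (Suc m) + 1) - ln (real (Suc m)) \<le> 1 / real (Suc m)"
    by (simp add: ln_div field_simps)
  then show ?case using Suc by (simp add: powr_minus_divide add.commute)
qed simp

text \<open>Up to constants, \<open>psi s a m\<close> is the quasi-norm of a vector of \<open>m\<close> ones.\<close>

definition psi :: "real \<Rightarrow> real \<Rightarrow> real \<Rightarrow> real" where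
  "psi s a x = (if s = 0 then ln (x + 1) powr a else x powr s)"

lemma psi_pos: "0 < x \<Longrightarrow> 0 < psi s a x"
  by (simp add: psi_def)

lemma psi_mono: "0 \<le> s \<Longrightarrow> 0 \<le> a \<Longrightarrow> 0 < x \<Longrightarrow> x \<le> y \<Longrightarrow> psi s a x \<le> psi s a y"
  unfolding psi_def by (auto intro!: powr_mono2)

text \<open>For \<open>s = 0 < a\<close> a logarithm has to be beaten by an arbitrarily small power:
  \<open>ln (y + 1) \<le> ln (x + 1) + ln (y / x)\<close> and
  \<open>ln z \<le> z powr \<alpha> / \<alpha>\<close>, with \<open>\<alpha> = s' / a\<close> so
  that the power \<open>a\<close> restores the exponent \<open>s'\<close>. The sum becomes a
  multiple of \<open>ln (x + 1)\<close> because \<open>x \<ge> 1 / 2\<close> keeps this factor at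
  least \<open>ln (3 / 2)\<close>.\<close>

lemma psi_ratio:
  assumes "0 \<le> s" "0 \<le> a" "s < s'"
  obtains c where "0 < c" "\<And>x y. 1 / 2 \<le> x \<Longrightarrow> x \<le> y \<Longrightarrow> c * (x / y) powr s' * psi s a y \<le> psi s a x"
proof (cases "s = 0 \<and> a \<noteq> 0")
  case False
  show ?thesis
  proof (rule that[of 1])
    fix x y :: real assume xy: "1 / 2 \<le> x" "x \<le> y"
    have "(x / y) powr s' * psi s a y \<le> (x / y) powr s * psi s a y"
      using xy assms by (intro mult_right_mono powr_mono') (auto intro: less_imp_le[OF psi_pos])
    also have "\<dots> = psi s a x" using False xy by (auto simp: psi_def powr_divide)
    finally show "1 * (x / y) powr s' * psi s a y \<le> psi s a x" by simp
  qed simp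
next
  case True
  then have a: "a > 0" and s: "s = 0" using assms by auto
  define \<alpha> where "\<alpha> = s' / a"
  have \<alpha>: "\<alpha> > 0" using a assms s by (simp add: \<alpha>_def)
  define l where "l = ln (3 / 2 :: real)"
  have l: "l > 0" by (simp add: l_def)
  define K where "K = 1 + 1 / (l * \<alpha>)"
  have K: "K > 0" using l \<alpha> by (simp add: K_def add_pos_pos)
  show ?thesis
  proof (rule that[of "K powr (- a)"])
    fix x y :: real assume xy: "1 / 2 \<le> x" "x \<le> y"
    have lx: "l \<le> ln (x + 1)" using xy unfolding l_def by (intro ln_mono) auto
    have yx: "1 \<le> (y / x) powr \<alpha>" using xy \<alpha> by (intro ge_one_powr_ge_zero) auto
    have "ln (y + 1) = ln (x + 1) + ln ((y + 1) / (x + 1))" using xy by (simp add: ln_div)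
    also have "ln ((y + 1) / (x + 1)) \<le> ln (y / x)" using xy by (intro ln_mono) (auto simp: field_simps)
    also have "\<dots> \<le> (y / x) powr \<alpha> / \<alpha>" using xy \<alpha> by (intro ln_powr_bound) auto
    also have "\<dots> = l * (1 / (l * \<alpha>)) * (y / x) powr \<alpha>" using l by simp
    also have "\<dots> \<le> ln (x + 1) * (1 / (l * \<alpha>)) * (y / x) powr \<alpha>"
      using lx l \<alpha> by (intro mult_right_mono) auto
    also have "ln (x + 1) + ln (x + 1) * (1 / (l * \<alpha>)) * (y / x) powr \<alpha>
        \<le> ln (x + 1) * (y / x) powr \<alpha> + ln (x + 1) * (1 / (l * \<alpha>)) * (y / x) powr \<alpha>"
      using yx lx l mult_left_mono[OF yx, of "ln (x+1)"] by simp
    also have "\<dots> = K * (y / x) powr \<alpha> * ln (x + 1)" by (simp add: K_def algebra_simps)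
    finally have "ln (y + 1) \<le> K * (y / x) powr \<alpha> * ln (x + 1)" by simp
    then have "psi s a y \<le> (K * (y / x) powr \<alpha> * ln (x + 1)) powr a"
      unfolding psi_def using s a xy by (auto intro!: powr_mono2)
    also have "\<dots> = K powr a * (y / x) powr s' * psi s a x"
      using K xy lx l a s by (simp add: powr_mult powr_powr psi_def \<alpha>_def)
    finally have "K powr (- a) * (x / y) powr s' * psi s a y
       \<le> K powr (- a) * (x / y) powr s' * (K powr a * (y / x) powr s' * psi s a x)"
      by (intro mult_left_mono) auto
    also have "\<dots> = (K powr (- a) * K powr a) * ((x / y) powr s' * (y / x) powr s') * psi s a x" by simp
    also have "(x / y) powr s' * (y / x) powr s' = 1" 
      using xy by (simp flip: powr_mult)
    also have "K powr (- a) * K powr a = 1" using K by (simp flip: powr_add)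
    finally show "K powr (- a) * (x / y) powr s' * psi s a y \<le> psi s a x" by simp
  qed (use K in auto)
qed

lemma sum_weight_ge:
  assumes "0 \<le> s" "0 < a"
  obtains c where "c > 0" "\<And>m::nat. 1 \<le> m \<Longrightarrow> c * psi s a m powr (1 / a) \<le> (\<Sum>i = 1..m. real i powr (s / a - 1))"
proof (cases "s = 0")
  case True
  show ?thesis
    by (rule that[of 1]) (use True assms sum_inverse_ge in \<open>auto simp: psi_def powr_powr\<close>)
next
  case False
  then have "s / a > 0" using assms by simp
  from sum_powr_ge[OF this] obtain c where "c > 0" "\<And>m::nat. c * real m powr (s / a) \<le> (\<Sum>i = 1..m. real i powr (s / a - 1))"
    by blast
  then show ?thesis using False by (intro that[of c]) (auto simp: psi_def powr_powr)
qed

lemma sum_weight_le: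
  assumes "0 \<le> s" "0 < a"
  obtains C where "C > 0" "\<And>m::nat. 1 \<le> m \<Longrightarrow> (\<Sum>i = 1..m. real i powr (s / a - 1)) \<le> C * psi s a m powr (1 / a)"
proof (cases "s = 0")
  case True
  show ?thesis
    by (rule that[of 2]) (use True assms sum_inverse_le in \<open>auto simp: psi_def powr_powr\<close>)
next
  case False
  then have "s / a > 0" using assms by simp
  from sum_powr_le[OF this] obtain C where "C > 0" "\<And>m::nat. (\<Sum>i = 1..m. real i powr (s / a - 1)) \<le> C * real m powr (s / a)"
    by blast
  then show ?thesis using False by (intro that[of C]) (auto simp: psi_def powr_powr)
qed

text \<open>Embedding into the weak-type space: the \<open>i\<close>-th largest entry is at most
  each of the \<open>i\<close> largest ones, so its product with the quasi-norm of \<open>i\<close>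
  ones is at most the quasi-norm of \<open>x\<close>. The counting of roundings uses the source ball
  only through this bound.\<close>

lemma rearr_le_psi:
  assumes "0 \<le> s" "0 \<le> a"
  obtains C where "C > 0" "\<And>n x i. x \<in> lball s a n \<Longrightarrow> 1 \<le> i \<Longrightarrow> i \<le> n \<Longrightarrow> rearr x i \<le> C / psi s a i"
proof (cases "a = 0")
  case True
  show ?thesis
  proof (rule that[of 1])
    fix n x i assume x: "x \<in> lball s a n" and i: "1 \<le> i" "i \<le> n"
    then have "real i powr s * rearr x i \<le> 1"
      using lnorm_0_le_iff[of x s 1] True by (auto simp: lball_def)
    moreover have "psi s a i = real i powr s" using True i by (auto simp: psi_def)
    ultimately show "rearr x i \<le> 1 / psi s a i" using i by (simp add: field_simps)
  qed simp
next
  case False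
  then have a: "a > 0" using assms by simp
  obtain c where c: "c > 0" "\<And>m::nat. 1 \<le> m \<Longrightarrow> c * psi s a m powr (1 / a) \<le> (\<Sum>i = 1..m. real i powr (s / a - 1))"
    using sum_weight_ge[OF assms(1) a] by blast
  show ?thesis
  proof (rule that[of "(1 / c) powr a"])
    fix n x i assume x: "x \<in> lball s a n" and i: "1 \<le> i" "i \<le> n"
    have n: "dim_vec x = n" using x by (auto simp: lball_def)
    have r: "0 \<le> rearr x i" using i n rearr_nonneg by simp
    have "c * psi s a i powr (1 / a) * rearr x i powr (1 / a) \<le> (\<Sum>j = 1..i. real j powr (s / a - 1)) * rearr x i powr (1 / a)"
      using c i by (intro mult_right_mono) auto
    also have "\<dots> = (\<Sum>j = 1..i. real j powr (s / a - 1) * rearr x i powr (1 / a))"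
      by (simp add: sum_distrib_right)
    also have "\<dots> \<le> (\<Sum>j = 1..i. real j powr (s / a - 1) * rearr x j powr (1 / a))"
      using a r n i by (intro sum_mono mult_left_mono powr_mono2) (auto intro: rearr_antimono)
    also have "\<dots> \<le> (\<Sum>j = 1..n. real j powr (s / a - 1) * rearr x j powr (1 / a))"
      using i by (intro sum_mono2) auto
    also have "\<dots> \<le> 1"
      using x lnorm_le_iff[OF a, of 1 s x] n by (auto simp: lball_def)
    finally have "(psi s a i * rearr x i) powr (1 / a) \<le> 1 / c"
      using c r i psi_pos[of i s a] by (simp add: powr_mult field_simps)
    then have "((psi s a i * rearr x i) powr (1 / a)) powr a \<le> (1 / c) powr a"
      using a by (intro powr_mono2) auto
    then have "psi s a i * rearr x i \<le> (1 / c) powr a"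
      using a r i psi_pos[of i s a] by (simp add: powr_powr)
    then show "rearr x i \<le> (1 / c) powr a / psi s a i"
      using i psi_pos[of i s a] by (simp add: field_simps)
  qed (use c in auto)
qed

text \<open>Among vectors with at most \<open>m\<close> nonzero entries, all of modulus at most
  \<open>d\<close>, the flat one is largest. The formulation in terms of \<open>rearr\<close> serves
  both sparse test points and rounding errors with full support \<open>m = n\<close>.\<close>

lemma lnorm_le_psi:
  assumes "0 \<le> s" "0 \<le> a"
  obtains C where "C > 0" "\<And>n m d x. x \<in> carrier_vec n \<Longrightarrow> 1 \<le> m \<Longrightarrow> m \<le> n \<Longrightarrow> 0 \<le> d \<Longrightarrow>
      (\<And>i. 1 \<le> i \<Longrightarrow> i \<le> m \<Longrightarrow> rearr x i \<le> d) \<Longrightarrow> (\<And>i. m < i \<Longrightarrow> i \<le> n \<Longrightarrow> rearr x i = 0) \<Longrightarrow>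
      lnorm s a x \<le> C * d * psi s a m"
proof (cases "a = 0")
  case True
  show ?thesis
  proof (rule that[of 1])
    fix n m d x
    assume x: "x \<in> carrier_vec n" and m: "1 \<le> m" "m \<le> n" and d: "0 \<le> (d::real)"
      and le: "\<And>i. 1 \<le> i \<Longrightarrow> i \<le> m \<Longrightarrow> rearr x i \<le> d"
      and z: "\<And>i. m < i \<Longrightarrow> i \<le> n \<Longrightarrow> rearr x i = 0"
    have psi: "psi s a m = real m powr s" using True m by (auto simp: psi_def)
    have "real i powr s * rearr x i \<le> d * real m powr s" if "1 \<le> i" "i \<le> n" for i
    proof (cases "i \<le> m")
      case True
      then have "real i powr s * rearr x i \<le> real m powr s * d"
        using that le[of i] assms x by (intro mult_mono powr_mono2) (auto intro: rearr_nonneg)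
      then show ?thesis by (simp add: mult.commute)
    qed (use z that d in auto)
    then show "lnorm s a x \<le> 1 * d * psi s a m"
      unfolding psi unfolding True using x m by (subst lnorm_0_le_iff) auto
  qed simp
next
  case False
  then have a: "a > 0" using assms by simp
  obtain C where C: "C > 0" "\<And>m::nat. 1 \<le> m \<Longrightarrow> (\<Sum>i = 1..m. real i powr (s / a - 1)) \<le> C * psi s a m powr (1 / a)"
    using sum_weight_le[OF assms(1) a] by blast
  show ?thesis
  proof (rule that[of "C powr a"])
    fix n m d x
    assume x: "x \<in> carrier_vec n" and m: "1 \<le> m" "m \<le> n" and d: "0 \<le> (d::real)"
      and le: "\<And>i. 1 \<le> i \<Longrightarrow> i \<le> m \<Longrightarrow> rearr x i \<le> d"
      and z: "\<And>i. m < i \<Longrightarrow> i \<le> n \<Longrightarrow> rearr x i = 0"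
    have n: "dim_vec x = n" using x by simp
    have "(\<Sum>i = 1..n. lterm s a x i)
        = (\<Sum>i = 1..m. lterm s a x i)"
      using m z by (intro sum.mono_neutral_right) auto
    also have "\<dots> \<le> (\<Sum>i = 1..m. real i powr (s / a - 1) * d powr (1 / a))"
      using a m n by (intro sum_mono mult_left_mono powr_mono2 le) (auto intro: rearr_nonneg)
    also have "\<dots> \<le> C * psi s a m powr (1 / a) * d powr (1 / a)"
      using C(2)[OF m(1)] by (simp flip: sum_distrib_right add: mult_right_mono)
    also have "\<dots> = (C powr a * d * psi s a m) powr (1 / a)"
      using C d a m psi_pos[of m s a] by (simp add: powr_mult powr_powr)
    finally show "lnorm s a x \<le> C powr a * d * psi s a m"
      using a n C d m psi_pos[of m s a] by (subst lnorm_le_iff) auto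
  qed (use C in auto)
qed

section \<open>Counting\<close>

text \<open>An exponential Chebyshev inequality in counting form: every element of \<open>S\<close>
  has product weight at least \<open>\<kappa>\<close>, and the total weight of all words factorises
  over the coordinates. An exponential \<open>h\<close> counts lattice points, a two-valued
  \<open>h\<close> counts Hamming balls.\<close>

lemma card_weighted_le:
  fixes h :: "nat \<Rightarrow> 'b \<Rightarrow> real"
  assumes "finite Y" "S \<subseteq> PiE {..<m} (\<lambda>_. Y)" "\<And>t y. 0 \<le> h t y" "\<And>f. f \<in> S \<Longrightarrow> \<kappa> \<le> (\<Prod>t<m. h t (f t))"
  shows "real (card S) * \<kappa> \<le> (\<Prod>t<m. \<Sum>y\<in>Y. h t y)"
proof -
  have fin: "finite (PiE {..<m} (\<lambda>_. Y))" using assms(1) by (intro finite_PiE) auto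
  have "real (card S) * \<kappa> = (\<Sum>f\<in>S. \<kappa>)" by simp
  also have "\<dots> \<le> (\<Sum>f\<in>S. \<Prod>t<m. h t (f t))" by (intro sum_mono assms(4))
  also have "\<dots> \<le> (\<Sum>f\<in>PiE {..<m} (\<lambda>_. Y). \<Prod>t<m. h t (f t))"
    using assms fin by (intro sum_mono2 prod_nonneg) auto
  also have "\<dots> = (\<Prod>t<m. \<Sum>y\<in>Y. h t y)"
    using assms(1) by (subst prod_sum_PiE) auto
  finally show ?thesis .
qed

text \<open>With \<open>r * N > 2\<close>, the inequality \<open>exp x \<ge> (1 + x / N) ^ N\<close>
  at \<open>x = t powr r\<close> gives growth of order \<open>t powr (r * N)\<close>, at least
  quadratic for \<open>t \<ge> 1\<close>. The inverse square is aimed at because it telescopes when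
  summed over the integers.\<close>

lemma exp_minus_powr_le:
  fixes r :: real
  assumes "0 < r"
  obtains K where "K > 0" "\<And>t. 0 \<le> t \<Longrightarrow> exp (- (t powr r)) \<le> K / (1 + t)\<^sup>2"
proof -
  obtain N :: nat where N: "2 / r < real N" using reals_Archimedean2 by blast
  have N0: "N > 0" using N assms by (metis divide_pos_pos gr0I less_asym of_nat_0 zero_less_numeral)
  define K :: real where "K = 4 * real N ^ N"
  have N1: "1 \<le> real N ^ N" using N0 by (intro one_le_power) auto
  show ?thesis
  proof (rule that[of K])
    show "K > 0" using N0 by (simp add: K_def)
    fix t :: real assume t: "0 \<le> t"
    have "(1 + t)\<^sup>2 \<le> K * exp (t powr r)"
    proof (cases "t \<le> 1")
      case True
      then have "(1 + t)\<^sup>2 \<le> 2\<^sup>2" using t by (intro power_mono) auto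
      moreover have "4 * 1 \<le> K * exp (t powr r)" unfolding K_def using N1 by (intro mult_mono) auto
      ultimately show ?thesis by simp
    next
      case False
      have "(1 + t powr r / real N) ^ N \<le> exp (t powr r)"
      proof (rule exp_ge_one_plus_x_over_n_power_n)
        show "- real N \<le> t powr r" using powr_ge_zero[of t r] by linarith
      qed (use N0 in simp)
      moreover have "(t powr r / real N) ^ N \<le> (1 + t powr r / real N) ^ N" by (intro power_mono) auto
      ultimately have e: "real N ^ N * (t powr r / real N) ^ N \<le> real N ^ N * exp (t powr r)"
        by (intro mult_left_mono) auto
      have "(1 + t)\<^sup>2 \<le> (2 * t)\<^sup>2" using False by (intro power_mono) auto
      also have "\<dots> = 4 * t powr 2" using False by (simp add: power_mult_distrib)
      also have "\<dots> \<le> 4 * t powr (r * real N)"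
        using False N assms by (intro mult_left_mono powr_mono) (auto simp: field_simps)
      also have "\<dots> = 4 * (t powr r) ^ N" using False by (simp add: powr_powr flip: powr_realpow)
      also have "\<dots> = 4 * (real N ^ N * (t powr r / real N) ^ N)" using N0 by (simp add: power_divide)
      also have "\<dots> \<le> 4 * (real N ^ N * exp (t powr r))" using e by simp
      finally show ?thesis by (simp add: K_def)
    qed
    then show "exp (- (t powr r)) \<le> K / (1 + t)\<^sup>2"
      using t by (simp add: exp_minus field_simps)
  qed
qed

lemma int_interval_Suc: "{- int (Suc M)..int (Suc M)} = insert (int (Suc M)) (insert (- int (Suc M)) {- int M..int M})"
  by auto

lemma sum_exp_minus_powr_le:
  fixes r :: real
  assumes "0 < r"
  obtains K where "K > 0"
    "\<And>\<rho> M. 1 \<le> \<rho> \<Longrightarrow> (\<Sum>z\<in>{- int M..int M}. exp (- ((\<bar>real_of_int z\<bar> / \<rho>) powr r))) \<le> K * \<rho>"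
proof -
  obtain K where K: "K > 0" "\<And>t. 0 \<le> t \<Longrightarrow> exp (- (t powr r)) \<le> K / (1 + t)\<^sup>2"
    using exp_minus_powr_le[OF assms] by blast
  show ?thesis
  proof (rule that[of "3 * K"])
    fix \<rho> :: real and M :: nat assume \<rho>: "1 \<le> \<rho>"
    \<comment> \<open>The inductive bound carries a telescoping sum:
      \<open>\<rho>\<^sup>2 / (\<rho> + j)\<^sup>2\<close> is at most \<open>\<rho>\<^sup>2 /
      (\<rho> + j - 1) - \<rho>\<^sup>2 / (\<rho> + j)\<close>, which adds up to
      \<open>\<rho> - \<rho>\<^sup>2 / (\<rho> + M)\<close> and is bounded by \<open>\<rho>\<close>
      whatever the cut-off \<open>M\<close>. The summand 1 stands for \<open>z = 0\<close>, the
      factor 2 for the two signs.\<close>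
    have "(\<Sum>z\<in>{- int M..int M}. exp (- ((\<bar>real_of_int z\<bar> / \<rho>) powr r)))
      \<le> K * (1 + 2 * (\<rho> - \<rho>\<^sup>2 / (\<rho> + real M)))"
    proof (induction M)
      case 0
      then show ?case using K(2)[of 0] \<rho> by (simp add: power2_eq_square)
    next
      case (Suc M)
      let ?j = "real M + 1"
      have "exp (- ((?j / \<rho>) powr r)) \<le> K / (1 + ?j / \<rho>)\<^sup>2"
        using \<rho> by (intro K(2)) auto
      also have "(1 + ?j / \<rho>)\<^sup>2 = (\<rho> + ?j)\<^sup>2 / \<rho>\<^sup>2" using \<rho> by (simp add: power2_eq_square field_simps)
      also have "K / ((\<rho> + ?j)\<^sup>2 / \<rho>\<^sup>2) = K * \<rho>\<^sup>2 * (1 / (\<rho> + ?j)\<^sup>2)" by simp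
      also have "\<dots> \<le> K * \<rho>\<^sup>2 * (1 / (\<rho> + real M) - 1 / (\<rho> + ?j))"
      proof (rule mult_left_mono)
        have "1 / (\<rho> + real M) - 1 / (\<rho> + ?j) = 1 / ((\<rho> + real M) * (\<rho> + ?j))"
          using \<rho> by (simp add: field_simps)
        moreover have "1 / (\<rho> + ?j)\<^sup>2 \<le> 1 / ((\<rho> + real M) * (\<rho> + ?j))"
          using \<rho> unfolding power2_eq_square by (intro divide_left_mono mult_right_mono mult_pos_pos) auto
        ultimately show "1 / (\<rho> + ?j)\<^sup>2 \<le> 1 / (\<rho> + real M) - 1 / (\<rho> + ?j)" by simp
      qed (use K in auto)
      finally have le: "exp (- ((?j / \<rho>) powr r)) \<le> K * (\<rho>\<^sup>2 / (\<rho> + real M) - \<rho>\<^sup>2 / (\<rho> + ?j))"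
        by (simp add: algebra_simps)
      have "(\<Sum>z\<in>{- int (Suc M)..int (Suc M)}. exp (- ((\<bar>real_of_int z\<bar> / \<rho>) powr r)))
        = 2 * exp (- ((?j / \<rho>) powr r)) + (\<Sum>z\<in>{- int M..int M}. exp (- ((\<bar>real_of_int z\<bar> / \<rho>) powr r)))"
        unfolding int_interval_Suc by (subst sum.insert, simp, simp, subst sum.insert) (auto simp: add.commute abs_if)
      also have "\<dots> \<le> 2 * (K * (\<rho>\<^sup>2 / (\<rho> + real M) - \<rho>\<^sup>2 / (\<rho> + ?j))) + K * (1 + 2 * (\<rho> - \<rho>\<^sup>2 / (\<rho> + real M)))"
        using le Suc by linarith
      also have "\<dots> = K * (1 + 2 * (\<rho> - \<rho>\<^sup>2 / (\<rho> + real (Suc M))))"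
        by (simp add: algebra_simps)
      finally show ?case .
    qed
    also have "\<dots> \<le> K * (1 + 2 * \<rho>)" using K \<rho> by (intro mult_left_mono) auto
    also have "\<dots> \<le> K * (3 * \<rho>)" using K \<rho> by (intro mult_left_mono) auto
    finally show "(\<Sum>z\<in>{- int M..int M}. exp (- ((\<bar>real_of_int z\<bar> / \<rho>) powr r))) \<le> 3 * K * \<rho>" by simp
  qed (use K in simp)
qed

text \<open>A nonzero integer has \<open>\<bar>z\<bar> powr r \<ge> 1\<close>, so a factor
  \<open>exp (1 - \<nu>)\<close> splits off every term except \<open>z = 0\<close>. That the excess
  over 1 decays in \<open>\<nu>\<close> is what keeps a product of \<open>n\<close> such sums
  exponential in the sparsity \<open>m\<close> only.\<close>

lemma sum_exp_minus_mult_powr_le: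
  fixes r :: real
  assumes "0 < r"
  obtains K where "K > 0"
    "\<And>\<nu> M. 1 \<le> \<nu> \<Longrightarrow> (\<Sum>z\<in>{- int M..int M}. exp (- \<nu> * \<bar>real_of_int z\<bar> powr r)) \<le> 1 + K * exp (- \<nu>)"
proof -
  obtain K where K: "K > 0" "\<And>\<rho> M. 1 \<le> \<rho> \<Longrightarrow> (\<Sum>z\<in>{- int M..int M}. exp (- ((\<bar>real_of_int z\<bar> / \<rho>) powr r))) \<le> K * \<rho>"
    using sum_exp_minus_powr_le[OF assms] by blast
  show ?thesis
  proof (rule that[of "exp 1 * K"])
    fix \<nu> :: real and M :: nat assume \<nu>: "1 \<le> \<nu>"
    have le: "exp (- \<nu> * \<bar>real_of_int z\<bar> powr r) \<le> exp (1 - \<nu>) * exp (- (\<bar>real_of_int z\<bar> powr r))" if "z \<noteq> 0" for z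
    proof -
      have "1 \<le> \<bar>real_of_int z\<bar> powr r" using that assms by (intro ge_one_powr_ge_zero) auto
      then have "0 \<le> (\<nu> - 1) * (\<bar>real_of_int z\<bar> powr r - 1)" using \<nu> by simp
      then have "- \<nu> * \<bar>real_of_int z\<bar> powr r \<le> (1 - \<nu>) + - (\<bar>real_of_int z\<bar> powr r)"
        by (simp add: algebra_simps)
      then show ?thesis unfolding exp_add[symmetric] by (simp only: exp_le_cancel_iff)
    qed
    have "(\<Sum>z\<in>{- int M..int M}. exp (- \<nu> * \<bar>real_of_int z\<bar> powr r))
       = 1 + (\<Sum>z\<in>{- int M..int M} - {0}. exp (- \<nu> * \<bar>real_of_int z\<bar> powr r))"
      by (subst sum.remove[of _ 0]) auto
    also have "(\<Sum>z\<in>{- int M..int M} - {0}. exp (- \<nu> * \<bar>real_of_int z\<bar> powr r))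
      \<le> (\<Sum>z\<in>{- int M..int M} - {0}. exp (1 - \<nu>) * exp (- (\<bar>real_of_int z\<bar> powr r)))"
      by (intro sum_mono le) auto
    also have "\<dots> \<le> exp (1 - \<nu>) * (\<Sum>z\<in>{- int M..int M}. exp (- (\<bar>real_of_int z\<bar> powr r)))"
      unfolding sum_distrib_left by (intro sum_mono2) auto
    also have "\<dots> \<le> exp (1 - \<nu>) * K" using K(2)[of 1 M] by (intro mult_left_mono) auto
    finally show "(\<Sum>z\<in>{- int M..int M}. exp (- \<nu> * \<bar>real_of_int z\<bar> powr r)) \<le> 1 + exp 1 * K * exp (- \<nu>)"
      by (simp add: exp_diff exp_minus field_simps)
  qed (use K in simp)
qed

text \<open>Integer points of an \<open>l_r\<close> ball of dimension \<open>n\<close>, as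
  extensional functions. The box of size \<open>M\<close> makes the set finite; the cardinality
  bounds are uniform in \<open>M\<close>.\<close>

definition lattice_pts :: "nat \<Rightarrow> nat \<Rightarrow> real \<Rightarrow> real \<Rightarrow> (nat \<Rightarrow> int) set" where
  "lattice_pts n M r S = {z \<in> PiE {..<n} (\<lambda>_. {- int M..int M}). (\<Sum>j<n. \<bar>real_of_int (z j)\<bar> powr r) \<le> S}"

lemma finite_lattice_pts: "finite (lattice_pts n M r S)"
  unfolding lattice_pts_def by (rule finite_subset[of _ "PiE {..<n} (\<lambda>_. {- int M..int M})"]) (auto intro: finite_PiE)

text \<open>The tilt \<open>\<nu> = 1 + ln (n / m)\<close> is chosen so that
  \<open>n * exp (- \<nu>) \<le> m\<close>: the \<open>n\<close> factors multiply to at most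
  \<open>exp (K * m)\<close>, and the constraint costs \<open>exp (\<nu> * B * m)\<close>. Note that
  \<open>exp (m * (1 + ln (n / m)))\<close> is \<open>(e n / m) ^ m\<close>, the usual bound for the
  number of \<open>m\<close>-element supports.\<close>

lemma card_lattice_pts_coarse:
  assumes "0 < r" "0 \<le> B"
  obtains A where "A > 0" "\<And>n m M. 1 \<le> m \<Longrightarrow> m \<le> n \<Longrightarrow>
     real (card (lattice_pts n M r (B * real m))) \<le> exp (A * (real m * (1 + ln (real n / real m))))"
proof -
  obtain K where K: "K > 0"
    "\<And>\<nu> M. 1 \<le> \<nu> \<Longrightarrow> (\<Sum>z\<in>{- int M..int M}. exp (- \<nu> * \<bar>real_of_int z\<bar> powr r)) \<le> 1 + K * exp (- \<nu>)"
    using sum_exp_minus_mult_powr_le[OF assms(1)] by blast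
  show ?thesis
  proof (rule that[of "B + K"])
    fix n m M :: nat assume mn: "1 \<le> m" "m \<le> n"
    define \<nu> where "\<nu> = 1 + ln (real n / real m)"
    have \<nu>: "1 \<le> \<nu>" using mn by (simp add: \<nu>_def)
    let ?S = "lattice_pts n M r (B * real m)"
    have "real (card ?S) * exp (- \<nu> * (B * real m)) \<le> (\<Prod>t<n. \<Sum>z\<in>{- int M..int M}. exp (- \<nu> * \<bar>real_of_int z\<bar> powr r))"
    proof (rule card_weighted_le)
      fix f assume "f \<in> ?S"
      then have "(\<Sum>j<n. \<bar>real_of_int (f j)\<bar> powr r) \<le> B * real m" by (simp add: lattice_pts_def)
      then have "- \<nu> * (B * real m) \<le> - \<nu> * (\<Sum>j<n. \<bar>real_of_int (f j)\<bar> powr r)" using \<nu> by simp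
      also have "\<dots> = (\<Sum>j<n. - \<nu> * \<bar>real_of_int (f j)\<bar> powr r)" by (simp add: sum_distrib_left)
      finally show "exp (- \<nu> * (B * real m)) \<le> (\<Prod>t<n. exp (- \<nu> * \<bar>real_of_int (f t)\<bar> powr r))"
        by (simp flip: exp_sum)
    qed (auto simp: lattice_pts_def)
    also have "\<dots> \<le> (\<Prod>t<n. 1 + K * exp (- \<nu>))" by (intro prod_mono conjI K(2) \<nu> sum_nonneg) auto
    also have "\<dots> \<le> (\<Prod>t<n. exp (K * exp (- \<nu>)))" using K by (intro prod_mono conjI exp_ge_add_one_self) (auto intro: add_nonneg_nonneg)
    also have "\<dots> = exp (real n * (K * exp (- \<nu>)))" by (simp flip: exp_of_nat_mult)
    also have "\<dots> \<le> exp (K * real m)"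
    proof -
      have "exp (- \<nu>) = exp (- 1) * (real m / real n)" using mn by (simp add: \<nu>_def exp_diff exp_minus field_simps)
      also have "\<dots> \<le> 1 * (real m / real n)" by (intro mult_right_mono) auto
      finally have "real n * (K * exp (- \<nu>)) \<le> real n * (K * (real m / real n))"
        using K by (intro mult_left_mono) auto
      then show ?thesis using mn by simp
    qed
    finally have "real (card ?S) \<le> exp (K * real m) * exp (\<nu> * (B * real m))"
      by (simp add: exp_minus field_simps)
    also have "\<dots> = exp (K * real m * 1 + B * real m * \<nu>)" by (simp add: exp_add ac_simps)
    also have "\<dots> \<le> exp (K * real m * \<nu> + B * real m * \<nu>)"
      using K \<nu> assms by (intro iffD2[OF exp_le_cancel_iff] add_mono mult_left_mono) auto
    also have "\<dots> = exp ((B + K) * (real m * \<nu>))" by (simp add: algebra_simps)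
    finally show "real (card ?S) \<le> exp ((B + K) * (real m * (1 + ln (real n / real m))))" by (simp add: \<nu>_def)
  qed (use assms K in simp)
qed

text \<open>The weight is rescaled by \<open>\<rho>\<close>, so each coordinate contributes at most
  \<open>K * \<rho>\<close> and the constraint costs \<open>exp (B * n)\<close>: a discrete volume
  bound, with \<open>\<rho> \<ge> 1\<close> keeping the lattice finer than the ball.\<close>

lemma card_lattice_pts_fine:
  assumes "0 < r" "0 \<le> B"
  obtains A where "A \<ge> 1" "\<And>n M \<rho>. 1 \<le> \<rho> \<Longrightarrow> real (card (lattice_pts n M r (B * real n * \<rho> powr r))) \<le> (A * \<rho>) ^ n"
proof -
  obtain K where K: "K > 0" "\<And>\<rho> M. 1 \<le> \<rho> \<Longrightarrow> (\<Sum>z\<in>{- int M..int M}. exp (- ((\<bar>real_of_int z\<bar> / \<rho>) powr r))) \<le> K * \<rho>"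
    using sum_exp_minus_powr_le[OF assms(1)] by blast
  define A where "A = max 1 (exp B * K)"
  show ?thesis
  proof (rule that[of A])
    fix n M :: nat and \<rho> :: real assume \<rho>: "1 \<le> \<rho>"
    let ?S = "lattice_pts n M r (B * real n * \<rho> powr r)"
    have "real (card ?S) * exp (- (real n * B)) \<le> (\<Prod>t<n. \<Sum>z\<in>{- int M..int M}. exp (- ((\<bar>real_of_int z\<bar> / \<rho>) powr r)))"
    proof (rule card_weighted_le)
      fix f assume "f \<in> ?S"
      then have "(\<Sum>j<n. \<bar>real_of_int (f j)\<bar> powr r) / \<rho> powr r \<le> real n * B"
        using \<rho> by (simp add: lattice_pts_def field_simps)
      then have "- (real n * B) \<le> (\<Sum>j<n. - ((\<bar>real_of_int (f j)\<bar> / \<rho>) powr r))"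
        using \<rho> by (simp add: powr_divide sum_negf sum_divide_distrib)
      then show "exp (- (real n * B)) \<le> (\<Prod>t<n. exp (- ((\<bar>real_of_int (f t)\<bar> / \<rho>) powr r)))"
        by (simp flip: exp_sum)
    qed (auto simp: lattice_pts_def)
    also have "\<dots> \<le> (\<Prod>t<n. K * \<rho>)" by (intro prod_mono conjI K(2) \<rho> sum_nonneg) auto
    finally have "real (card ?S) \<le> exp (real n * B) * (K * \<rho>) ^ n" by (simp add: exp_minus field_simps)
    also have "\<dots> = (exp B * K * \<rho>) ^ n" by (simp add: exp_of_nat_mult power_mult_distrib)
    also have "\<dots> \<le> (A * \<rho>) ^ n" using K \<rho> by (intro power_mono mult_right_mono) (auto simp: A_def)
    finally show "real (card ?S) \<le> (A * \<rho>) ^ n" .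
  qed (simp add: A_def)
qed

text \<open>The origin of \<open>r\<close>: the quotient is at most a multiple of
  \<open>(m / i) powr (s + 1)\<close>, and \<open>r = 1 / (2 * (s + 1))\<close> turns this into
  \<open>(m / i) powr (1 / 2)\<close>, whose sum over \<open>i \<le> m\<close> is at most
  \<open>2 * m\<close>. The degree \<open>s + 1\<close> stands for any degree above
  \<open>s\<close>.\<close>

lemma sum_psi_ratio_le:
  assumes "0 \<le> s" "0 \<le> a"
  obtains r B where "0 < r" "B > 0"
    "\<And>m. 1 \<le> m \<Longrightarrow> (\<Sum>i = 1..m. (psi s a (real m) / psi s a (real i)) powr r) \<le> B * real m"
proof -
  obtain c where c: "0 < c" "\<And>x y. 1 / 2 \<le> x \<Longrightarrow> x \<le> y \<Longrightarrow> c * (x / y) powr (s + 1) * psi s a y \<le> psi s a x"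
    using psi_ratio[of s a "s + 1"] assms by auto
  define r where "r = 1 / (2 * (s + 1))"
  have r: "r > 0" using assms by (simp add: r_def)
  show ?thesis
  proof (rule that[of r "2 * (1 / c) powr r"])
    fix m :: nat assume m: "1 \<le> m"
    have "(psi s a (real m) / psi s a (real i)) powr r \<le> (1 / c) powr r * (real m powr (1 / 2) * real i powr (1 / 2 - 1))"
      if i: "i \<in> {1..m}" for i
    proof -
      have "c * (real i / real m) powr (s + 1) * psi s a m \<le> psi s a i" using i c(2)[of i m] by simp
      then have "psi s a m / psi s a i \<le> (1 / c) * (real m / real i) powr (s + 1)"
        using i m c(1) psi_pos[of i s a] by (simp add: field_simps powr_divide)
      then have "(psi s a m / psi s a i) powr r \<le> ((1 / c) * (real m / real i) powr (s + 1)) powr r"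
        using i m psi_pos[of i s a] psi_pos[of m s a] r by (intro powr_mono2) auto
      also have "\<dots> = (1 / c) powr r * (real m / real i) powr ((s + 1) * r)"
        using c by (subst powr_mult) (auto simp: powr_powr)
      also have "(s + 1) * r = 1 / 2" using assms by (simp add: r_def)
      also have "(real m / real i) powr (1 / 2) = real m powr (1 / 2) * real i powr (1 / 2 - 1)"
        using i by (simp add: powr_divide powr_minus_divide)
      finally show ?thesis .
    qed
    then have "(\<Sum>i = 1..m. (psi s a (real m) / psi s a (real i)) powr r)
      \<le> (\<Sum>i = 1..m. (1 / c) powr r * (real m powr (1 / 2) * real i powr (1 / 2 - 1)))" by (rule sum_mono)
    also have "\<dots> = (1 / c) powr r * real m powr (1 / 2) * (\<Sum>i = 1..m. real i powr (1 / 2 - 1))"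
      by (simp only: sum_distrib_left mult.assoc)
    also have "\<dots> \<le> (1 / c) powr r * real m powr (1 / 2) * (real m powr (1 / 2) / (1 / 2))"
      using sum_powr_le_telescope[of "1 / 2" m] by (intro mult_left_mono) auto
    also have "\<dots> = 2 * (1 / c) powr r * real m" using m by (simp flip: powr_add)
    finally show "(\<Sum>i = 1..m. (psi s a (real m) / psi s a (real i)) powr r) \<le> 2 * (1 / c) powr r * real m" .
  qed (use r c in auto)
qed

section \<open>Upper bounds by quantisation\<close>

lemma abs_le_rearr_1:
  assumes "j < dim_vec x"
  shows "\<bar>x $ j\<bar> \<le> rearr x 1"
proof -
  have "j \<in> {i. i < dim_vec x \<and> \<bar>x $ j\<bar> \<le> \<bar>x $ i\<bar>}" using assms by simp
  then have "card {i. i < dim_vec x \<and> \<bar>x $ j\<bar> \<le> \<bar>x $ i\<bar>} \<noteq> 0" by (subst card_0_eq) auto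
  then have "1 \<le> card {i. i < dim_vec x \<and> \<bar>x $ j\<bar> \<le> \<bar>x $ i\<bar>}" by linarith
  then show ?thesis using assms le_rearr_iff[of 1 x "\<bar>x $ j\<bar>"] by linarith
qed

text \<open>The centres are the lattice points obtained by rounding the coordinates of \<open>x / \<delta>\<close> towards zero,
  so the error is dominated by both \<open>\<bar>x\<bar>\<close> and \<open>\<delta>\<close>.\<close>

lemma covers_quantise:
  assumes "0 < \<delta>" "0 < \<epsilon>" "1 \<le> n" "0 \<le> b" "card (lattice_pts n M r S) \<le> 2 ^ (k - 1)"
    and bd: "\<And>x. x \<in> lball s a n \<Longrightarrow> rearr x 1 \<le> \<delta> * real M"
    and S: "\<And>x. x \<in> lball s a n \<Longrightarrow> (\<Sum>i = 1..n. real_of_int \<lfloor>rearr x i / \<delta>\<rfloor> powr r) \<le> S"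
    and res: "\<And>x y. x \<in> lball s a n \<Longrightarrow> y \<in> carrier_vec n \<Longrightarrow> (\<And>j. j < n \<Longrightarrow> \<bar>y $ j\<bar> \<le> \<bar>x $ j\<bar>) \<Longrightarrow>
       (\<And>j. j < n \<Longrightarrow> \<bar>y $ j\<bar> \<le> \<delta>) \<Longrightarrow> lnorm t b y \<le> \<epsilon>"
  shows "covers s a t b n k \<epsilon>"
proof (rule coversI[where Z = "lattice_pts n M r S" and f = "\<lambda>z. vec n (\<lambda>j. \<delta> * real_of_int (z j))"])
  fix x assume x: "x \<in> lball s a n"
  then have n: "dim_vec x = n" by (auto simp: lball_def)
  define F where "F j = \<lfloor>\<bar>x $ j\<bar> / \<delta>\<rfloor>" for j
  have F0: "0 \<le> F j" for j using assms(1) by (simp add: F_def)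
  have FM: "F j \<le> int M" if "j < n" for j
  proof -
    have "\<bar>x $ j\<bar> \<le> \<delta> * real M" using abs_le_rearr_1[of j x] bd[OF x] that n by linarith
    then have "\<bar>x $ j\<bar> / \<delta> \<le> real M" using assms(1) by (simp add: pos_divide_le_eq mult.commute)
    then show ?thesis unfolding F_def by linarith
  qed
  \<comment> \<open>Rounding the modulus down and restoring the sign rounds towards zero;
    \<open>restrict\<close> makes \<open>z\<close> extensional, as \<open>lattice_pts\<close>
    demands.\<close>
  define z where "z = restrict (\<lambda>j. if 0 \<le> x $ j then F j else - F j) {..<n}"
  have absz: "\<bar>real_of_int (z j)\<bar> = real_of_int (F j)" if "j < n" for j
    using that F0[of j] by (simp add: z_def)
  have "(\<Sum>j<n. \<bar>real_of_int (z j)\<bar> powr r) = (\<Sum>j<n. real_of_int \<lfloor>\<bar>x $ j\<bar> / \<delta>\<rfloor> powr r)"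
    by (intro sum.cong) (auto simp: absz F_def)
  also have "\<dots> = (\<Sum>i = 1..n. real_of_int \<lfloor>rearr x i / \<delta>\<rfloor> powr r)"
    using sum_rearr[of "\<lambda>y. real_of_int \<lfloor>y / \<delta>\<rfloor> powr r" x] n by simp
  also have "\<dots> \<le> S" by (rule S[OF x])
  finally have zS: "(\<Sum>j<n. \<bar>real_of_int (z j)\<bar> powr r) \<le> S" .
  have z: "z \<in> lattice_pts n M r S"
    unfolding lattice_pts_def using zS
  proof (intro CollectI conjI PiE_I)
    fix j assume "j \<in> {..<n}"
    then show "z j \<in> {- int M..int M}" using FM[of j] F0[of j] by (simp add: z_def)
  qed (auto simp: z_def)
  have err: "\<bar>x $ j - \<delta> * real_of_int (z j)\<bar> = \<bar>x $ j\<bar> - \<delta> * real_of_int (F j)" 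
    "0 \<le> \<delta> * real_of_int (F j)" "\<bar>x $ j\<bar> - \<delta> * real_of_int (F j) \<le> \<delta>"
    if "j < n" for j
  proof -
    have "real_of_int (F j) \<le> \<bar>x $ j\<bar> / \<delta>" "\<bar>x $ j\<bar> / \<delta> < real_of_int (F j) + 1"
      unfolding F_def by linarith+
    then have f: "\<delta> * real_of_int (F j) \<le> \<bar>x $ j\<bar>" "\<bar>x $ j\<bar> < \<delta> * (real_of_int (F j) + 1)"
      using assms(1) by (simp_all add: field_simps)
    show "0 \<le> \<delta> * real_of_int (F j)" using F0[of j] assms(1) by simp
    show "\<bar>x $ j\<bar> - \<delta> * real_of_int (F j) \<le> \<delta>" using f by (simp add: algebra_simps)
    show "\<bar>x $ j - \<delta> * real_of_int (z j)\<bar> = \<bar>x $ j\<bar> - \<delta> * real_of_int (F j)"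
    proof (cases "0 \<le> x $ j")
      case True
      then have "z j = F j" using that by (simp add: z_def)
      then have "x $ j - \<delta> * real_of_int (z j) = \<bar>x $ j\<bar> - \<delta> * real_of_int (F j)" using True by simp
      then show ?thesis using f(1) by linarith
    next
      case False
      then have "z j = - F j" using that by (simp add: z_def)
      then have "x $ j - \<delta> * real_of_int (z j) = - (\<bar>x $ j\<bar> - \<delta> * real_of_int (F j))" using False by simp
      then show ?thesis using f(1) by linarith
    qed
  qed
  have "lnorm t b (x - vec n (\<lambda>j. \<delta> * real_of_int (z j))) \<le> \<epsilon>"
  proof (rule res[OF x])
    fix j assume j: "j < n"
    show "\<bar>(x - vec n (\<lambda>j. \<delta> * real_of_int (z j))) $ j\<bar> \<le> \<bar>x $ j\<bar>" using err[OF j] j by simp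
    show "\<bar>(x - vec n (\<lambda>j. \<delta> * real_of_int (z j))) $ j\<bar> \<le> \<delta>" using err[OF j] j by simp
  qed (auto simp: n carrier_vecI)
  then show "\<exists>z\<in>lattice_pts n M r S. lnorm t b (x - vec n (\<lambda>j. \<delta> * real_of_int (z j))) \<le> \<epsilon>" using z by blast
qed (use assms finite_lattice_pts in auto)

text \<open>The grid width is tied to the level \<open>1 / psi m\<close> of a flat unit vector with
  support \<open>m\<close>, so at most \<open>m\<close> coordinates round to nonzero values and the
  coarse count applies. Target space and error estimate stay open because two different estimates
  are inserted later, one with and one without a logarithm.\<close>

lemma covers_coarse:
  assumes "0 \<le> s" "0 \<le> a"
  obtains A \<delta> where "A > 0" "\<delta> > 0"
    "\<And>t b n m k \<epsilon>. 0 \<le> b \<Longrightarrow> 1 \<le> m \<Longrightarrow> m \<le> n \<Longrightarrow> A * (real m * (1 + ln (real n / real m))) \<le> real k \<Longrightarrow> 0 < \<epsilon> \<Longrightarrow>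
      (\<And>x y. x \<in> lball s a n \<Longrightarrow> y \<in> carrier_vec n \<Longrightarrow> (\<And>j. j < n \<Longrightarrow> \<bar>y $ j\<bar> \<le> \<bar>x $ j\<bar>) \<Longrightarrow>
         (\<And>j. j < n \<Longrightarrow> \<bar>y $ j\<bar> \<le> \<delta> / psi s a m) \<Longrightarrow> lnorm t b y \<le> \<epsilon>) \<Longrightarrow>
      covers s a t b n k \<epsilon>"
proof -
  obtain C where C: "C > 0" "\<And>n x i. x \<in> lball s a n \<Longrightarrow> 1 \<le> i \<Longrightarrow> i \<le> n \<Longrightarrow> rearr x i \<le> C / psi s a i"
    using rearr_le_psi[OF assms] by blast
  obtain r B where rB: "0 < r" "B > 0"
    "\<And>m. 1 \<le> m \<Longrightarrow> (\<Sum>i = 1..m. (psi s a (real m) / psi s a (real i)) powr r) \<le> B * real m"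
    using sum_psi_ratio_le[OF assms] by blast
  obtain A where A: "A > 0" "\<And>n m M. 1 \<le> m \<Longrightarrow> m \<le> n \<Longrightarrow>
     real (card (lattice_pts n M r (B * real m))) \<le> exp (A * (real m * (1 + ln (real n / real m))))"
    using card_lattice_pts_coarse[of r B] rB by auto
  \<comment> \<open>The summand 2 forces \<open>k \<ge> 2\<close>, hence
    \<open>k \<le> 2 * (k - 1)\<close>; the other summand then yields
    \<open>A * L \<le> (k - 1) * ln 2\<close>, the logarithm of the number of available
    centres.\<close>
  define A' where "A' = 2 + 2 * A / ln 2"
  have A': "A' > 0" using A by (simp add: A'_def add_pos_pos)
  show ?thesis
  proof (rule that[of A' "2 * C"])
    fix t b :: real and n m k :: nat and \<epsilon> :: real
    assume b: "0 \<le> b" and mn: "1 \<le> m" "m \<le> n" and k: "A' * (real m * (1 + ln (real n / real m))) \<le> real k" and \<epsilon>: "0 < \<epsilon>"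
      and res: "\<And>x y. x \<in> lball s a n \<Longrightarrow> y \<in> carrier_vec n \<Longrightarrow> (\<And>j. j < n \<Longrightarrow> \<bar>y $ j\<bar> \<le> \<bar>x $ j\<bar>) \<Longrightarrow>
         (\<And>j. j < n \<Longrightarrow> \<bar>y $ j\<bar> \<le> 2 * C / psi s a m) \<Longrightarrow> lnorm t b y \<le> \<epsilon>"
    define L where "L = real m * (1 + ln (real n / real m))"
    have L: "1 \<le> L"
    proof -
      have "1 * 1 \<le> real m * (1 + ln (real n / real m))" using mn by (intro mult_mono) auto
      then show ?thesis by (simp add: L_def)
    qed
    have kL: "2 * L \<le> real k" "2 * A / ln 2 * L \<le> real k"
    proof -
      have "A' * L \<le> real k" using k by (simp only: L_def)
      moreover have "A' * L = 2 * L + 2 * A / ln 2 * L" by (simp only: A'_def distrib_right)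
      moreover have "0 \<le> 2 * A / ln 2 * L" using A L by simp
      ultimately show "2 * L \<le> real k" "2 * A / ln 2 * L \<le> real k" using L by linarith+
    qed
    have k2: "k \<ge> 2" using kL(1) L by linarith
    then have "real k \<le> 2 * real (k - 1)" by linarith
    then have "2 * A / ln 2 * L \<le> 2 * real (k - 1)" using kL by linarith
    then have AL: "A * L \<le> real (k - 1) * ln 2" by (simp add: field_simps)
    \<comment> \<open>The factor 2 bounds the \<open>i\<close>-th largest entry by
      \<open>\<delta> / 2\<close> for \<open>i \<ge> m\<close>, so it rounds to zero even if
      \<open>psi\<close> does not grow beyond \<open>m\<close>.\<close>
    define \<delta> where "\<delta> = 2 * C / psi s a m"
    have pm: "psi s a m > 0" using mn by (simp add: psi_pos)
    have \<delta>: "\<delta> > 0" using C pm by (simp add: \<delta>_def)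
    obtain M :: nat where M: "C / psi s a 1 / \<delta> \<le> real M" using real_arch_simple by blast
    show "covers s a t b n k \<epsilon>"
    proof (rule covers_quantise[of \<delta> \<epsilon> n b M r "B * real m" k s a])
      have "real (card (lattice_pts n M r (B * real m))) \<le> exp (A * L)" using A(2)[OF mn] by (simp add: L_def)
      also have "\<dots> \<le> exp (real (k - 1) * ln 2)" using AL by simp
      also have "\<dots> = 2 ^ (k - 1)" by (simp add: exp_of_nat_mult)
      finally show "card (lattice_pts n M r (B * real m)) \<le> 2 ^ (k - 1)"
        by (metis of_nat_le_iff of_nat_numeral of_nat_power)
    next
      fix x assume x: "x \<in> lball s a n"
      have "rearr x 1 \<le> C / psi s a 1" using C(2)[OF x, of 1] mn by simp
      also have "\<dots> \<le> \<delta> * real M" using M unfolding pos_divide_le_eq[OF \<delta>] by (simp add: mult.commute)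
      finally show "rearr x 1 \<le> \<delta> * real M" .
      have n: "dim_vec x = n" using x by (auto simp: lball_def)
      have rle: "rearr x i / \<delta> \<le> (psi s a m / psi s a i) / 2" if "1 \<le> i" "i \<le> n" for i
      proof -
        have "rearr x i / \<delta> \<le> (C / psi s a i) / \<delta>" using C(2)[OF x that] \<delta> by (intro divide_right_mono) auto
        also have "\<dots> = (psi s a m / psi s a i) / 2" using C by (simp add: \<delta>_def)
        finally show ?thesis .
      qed
      have "(\<Sum>i = 1..n. real_of_int \<lfloor>rearr x i / \<delta>\<rfloor> powr r) = (\<Sum>i = 1..m. real_of_int \<lfloor>rearr x i / \<delta>\<rfloor> powr r)"
      proof (rule sum.mono_neutral_right)
        show "\<forall>i\<in>{1..n} - {1..m}. real_of_int \<lfloor>rearr x i / \<delta>\<rfloor> powr r = 0"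
        proof
          fix i assume "i \<in> {1..n} - {1..m}"
          then have i: "1 \<le> i" "m \<le> i" "i \<le> n" by auto
          have "psi s a m \<le> psi s a i" using i mn assms by (intro psi_mono) auto
          then have "psi s a m / psi s a i \<le> 1" using i psi_pos[of i s a] by (simp add: pos_divide_le_eq)
          moreover have "q / 2 < 1" if "q \<le> 1" for q :: real using that by simp
          ultimately have "rearr x i / \<delta> < 1" using rle[OF i(1,3)] le_less_trans by blast
          moreover have "0 \<le> rearr x i / \<delta>" using i n rearr_nonneg[of i x] \<delta> by simp
          ultimately have "\<lfloor>rearr x i / \<delta>\<rfloor> = 0" by linarith
          then show "real_of_int \<lfloor>rearr x i / \<delta>\<rfloor> powr r = 0" by simp
        qed
      qed (use mn in auto)
      also have "\<dots> \<le> (\<Sum>i = 1..m. (psi s a (real m) / psi s a (real i)) powr r)"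
      proof (rule sum_mono)
        fix i assume i: "i \<in> {1..m}"
        have p: "0 < psi s a m / psi s a i" using i pm psi_pos[of i s a] by simp
        have "real_of_int \<lfloor>rearr x i / \<delta>\<rfloor> \<le> rearr x i / \<delta>" by simp
        also have "\<dots> \<le> (psi s a m / psi s a i) / 2" using i mn by (intro rle) auto
        also have "\<dots> \<le> psi s a m / psi s a i" using p by simp
        finally have "real_of_int \<lfloor>rearr x i / \<delta>\<rfloor> \<le> psi s a m / psi s a i" .
        moreover have "0 \<le> real_of_int \<lfloor>rearr x i / \<delta>\<rfloor>" using i n mn rearr_nonneg[of i x] \<delta> by simp
        ultimately show "real_of_int \<lfloor>rearr x i / \<delta>\<rfloor> powr r \<le> (psi s a (real m) / psi s a (real i)) powr r"
          using rB by (intro powr_mono2) auto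
      qed
      also have "\<dots> \<le> B * real m" using rB(3) mn by simp
      finally show "(\<Sum>i = 1..n. real_of_int \<lfloor>rearr x i / \<delta>\<rfloor> powr r) \<le> B * real m" .
    next
      fix x y
      assume "x \<in> lball s a n" "y \<in> carrier_vec n" "\<And>j. j < n \<Longrightarrow> \<bar>y $ j\<bar> \<le> \<bar>x $ j\<bar>" "\<And>j. j < n \<Longrightarrow> \<bar>y $ j\<bar> \<le> \<delta>"
      then show "lnorm t b y \<le> \<epsilon>" unfolding \<delta>_def by (rule res)
    qed (use \<delta> \<epsilon> b mn in auto)
  qed (use A' C in auto)
qed

text \<open>Now all \<open>n\<close> coordinates may round to nonzero values, and the whole budget
  goes into refining the level \<open>1 / psi n\<close> by a factor \<open>\<rho>\<close> with
  \<open>(A0 * \<rho>) ^ n = 2 ^ (k - 1)\<close>. The error may have full support, hence the factor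
  \<open>psi t b n\<close>.\<close>

lemma ent_le_fine:
  assumes "0 \<le> s" "0 \<le> a" "0 \<le> t" "0 \<le> b"
  obtains A C where "A > 0" "C > 0"
    "\<And>n k. 1 \<le> n \<Longrightarrow> A * real n \<le> real k \<Longrightarrow>
       ent s a t b n k \<le> C * (2 powr (- (real k / real n)) * (psi t b n / psi s a n))"
proof -
  obtain C1 where C1: "C1 > 0" "\<And>n x i. x \<in> lball s a n \<Longrightarrow> 1 \<le> i \<Longrightarrow> i \<le> n \<Longrightarrow> rearr x i \<le> C1 / psi s a i"
    using rearr_le_psi[OF assms(1,2)] by blast
  obtain C2 where C2: "C2 > 0" "\<And>n m d x. x \<in> carrier_vec n \<Longrightarrow> 1 \<le> m \<Longrightarrow> m \<le> n \<Longrightarrow> 0 \<le> d \<Longrightarrow>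
      (\<And>i. 1 \<le> i \<Longrightarrow> i \<le> m \<Longrightarrow> rearr x i \<le> d) \<Longrightarrow> (\<And>i. m < i \<Longrightarrow> i \<le> n \<Longrightarrow> rearr x i = 0) \<Longrightarrow>
      lnorm t b x \<le> C2 * d * psi t b m"
    using lnorm_le_psi[OF assms(3,4)] by blast
  obtain r B where rB: "0 < r" "B > 0"
    "\<And>m. 1 \<le> m \<Longrightarrow> (\<Sum>i = 1..m. (psi s a (real m) / psi s a (real i)) powr r) \<le> B * real m"
    using sum_psi_ratio_le[OF assms(1,2)] by blast
  obtain A0 where A0: "A0 \<ge> 1" "\<And>n M \<rho>. 1 \<le> \<rho> \<Longrightarrow> real (card (lattice_pts n M r (B * real n * \<rho> powr r))) \<le> (A0 * \<rho>) ^ n"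
    using card_lattice_pts_fine[of r B] rB by auto
  \<comment> \<open>This gives \<open>2 powr ((k - 1) / n) \<ge> A0\<close>, that is
    \<open>\<rho> \<ge> 1\<close>; the summand 1 absorbs the passage from \<open>k\<close> to
    \<open>k - 1\<close>.\<close>
  define A where "A = 1 + ln A0 / ln 2"
  have A: "A > 0" using A0 by (simp add: A_def add_pos_nonneg)
  show ?thesis
  proof (rule that[of A "C2 * C1 * A0 * 2"])
    fix n k :: nat assume n: "1 \<le> n" and k: "A * real n \<le> real k"
    have k1: "k \<ge> 1"
    proof -
      have "0 < A * real n" using A n by simp
      then show ?thesis using k by linarith
    qed
    define \<rho> where "\<rho> = 2 powr (real (k - 1) / real n) / A0"
    have \<rho>: "1 \<le> \<rho>"
    proof -
      have "ln A0 / ln 2 * real n + real n \<le> real k" using k by (simp add: A_def algebra_simps)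
      then have "ln A0 / ln 2 * real n \<le> real (k - 1)" using n k1 by (simp add: of_nat_diff)
      then have "ln A0 / ln 2 \<le> real (k - 1) / real n" using n by (simp add: pos_le_divide_eq)
      then have "2 powr (ln A0 / ln 2) \<le> 2 powr (real (k - 1) / real n)" by simp
      moreover have "2 powr (ln A0 / ln 2) = A0" using A0 by (simp add: powr_def)
      ultimately show ?thesis using A0 by (simp add: \<rho>_def)
    qed
    define \<delta> where "\<delta> = C1 / (psi s a n * \<rho>)"
    have pn: "psi s a n > 0" "psi t b n > 0" using n by (simp_all add: psi_pos)
    have \<delta>: "\<delta> > 0" using C1 pn \<rho> by (simp add: \<delta>_def)
    obtain M :: nat where M: "C1 / psi s a 1 / \<delta> \<le> real M" using real_arch_simple by blast
    have "covers s a t b n k (C2 * \<delta> * psi t b n)"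
    proof (rule covers_quantise[of \<delta> _ n b M r "B * real n * \<rho> powr r" k s a])
      have "real (card (lattice_pts n M r (B * real n * \<rho> powr r))) \<le> (A0 * \<rho>) ^ n" by (rule A0(2)[OF \<rho>])
      also have "A0 * \<rho> = 2 powr (real (k - 1) / real n)" using A0 by (simp add: \<rho>_def)
      also have "\<dots> ^ n = 2 ^ (k - 1)" using n by (simp add: powr_powr flip: powr_realpow)
      finally show "card (lattice_pts n M r (B * real n * \<rho> powr r)) \<le> 2 ^ (k - 1)"
        by (metis of_nat_le_iff of_nat_numeral of_nat_power)
    next
      fix x assume x: "x \<in> lball s a n"
      have "rearr x 1 \<le> C1 / psi s a 1" using C1(2)[OF x, of 1] n by simp
      also have "\<dots> \<le> \<delta> * real M" using M unfolding pos_divide_le_eq[OF \<delta>] by (simp add: mult.commute)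
      finally show "rearr x 1 \<le> \<delta> * real M" .
      have dn: "dim_vec x = n" using x by (auto simp: lball_def)
      have "(\<Sum>i = 1..n. real_of_int \<lfloor>rearr x i / \<delta>\<rfloor> powr r) \<le> (\<Sum>i = 1..n. (psi s a (real n) / psi s a (real i)) powr r * \<rho> powr r)"
      proof (rule sum_mono)
        fix i assume i: "i \<in> {1..n}"
        have p: "0 < psi s a n / psi s a i" using i pn psi_pos[of i s a] by simp
        have "real_of_int \<lfloor>rearr x i / \<delta>\<rfloor> \<le> rearr x i / \<delta>" by simp
        also have "\<dots> \<le> (C1 / psi s a i) / \<delta>" using C1(2)[OF x] i \<delta> by (intro divide_right_mono) auto
        also have "\<dots> = (psi s a n / psi s a i) * \<rho>" using C1 by (simp add: \<delta>_def)
        finally have "real_of_int \<lfloor>rearr x i / \<delta>\<rfloor> \<le> (psi s a n / psi s a i) * \<rho>" .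
        moreover have "0 \<le> real_of_int \<lfloor>rearr x i / \<delta>\<rfloor>" using i dn n rearr_nonneg[of i x] \<delta> by simp
        ultimately have "real_of_int \<lfloor>rearr x i / \<delta>\<rfloor> powr r \<le> ((psi s a n / psi s a i) * \<rho>) powr r"
          using rB by (intro powr_mono2) auto
        also have "\<dots> = (psi s a n / psi s a i) powr r * \<rho> powr r" by (rule powr_mult)
        finally show "real_of_int \<lfloor>rearr x i / \<delta>\<rfloor> powr r \<le> (psi s a (real n) / psi s a (real i)) powr r * \<rho> powr r" .
      qed
      also have "\<dots> \<le> B * real n * \<rho> powr r"
        unfolding sum_distrib_right[symmetric] using rB(3) n by (intro mult_right_mono) auto
      finally show "(\<Sum>i = 1..n. real_of_int \<lfloor>rearr x i / \<delta>\<rfloor> powr r) \<le> B * real n * \<rho> powr r" .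
    next
      fix x y
      assume y: "y \<in> carrier_vec n" "\<And>j. j < n \<Longrightarrow> \<bar>y $ j\<bar> \<le> \<delta>"
      show "lnorm t b y \<le> C2 * \<delta> * psi t b n"
      proof (rule C2(2)[OF y(1) n order_refl])
        fix i assume "1 \<le> i" "i \<le> n"
        then show "rearr y i \<le> \<delta>" using y by (intro rearr_le_bound) auto
      qed (use \<delta> in auto)
    qed (use \<delta> n assms C2 pn in auto)
    then have "ent s a t b n k \<le> C2 * \<delta> * psi t b n" by (rule ent_le)
    also have "\<dots> = C2 * C1 * A0 * 2 powr (- (real (k - 1) / real n)) * (psi t b n / psi s a n)"
      using A0 by (simp add: \<delta>_def \<rho>_def powr_minus_divide ac_simps)
    also have "\<dots> \<le> C2 * C1 * A0 * (2 * 2 powr (- (real k / real n))) * (psi t b n / psi s a n)"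
    proof (intro mult_right_mono mult_left_mono)
      have "- (real (k - 1) / real n) \<le> 1 + - (real k / real n)"
        using n k1 by (simp add: of_nat_diff field_simps)
      then have "2 powr (- (real (k - 1) / real n)) \<le> 2 powr (1 + - (real k / real n))" by simp
      then show "2 powr (- (real (k - 1) / real n)) \<le> 2 * 2 powr (- (real k / real n))" by (simp only: powr_add) simp
    qed (use A0 C1 C2 pn in auto)
    finally show "ent s a t b n k \<le> C2 * C1 * A0 * 2 * (2 powr (- (real k / real n)) * (psi t b n / psi s a n))" by simp
  qed (use A A0 C1 C2 in auto)
qed

section \<open>Lower bounds by counting\<close>

lemma ex_covers:
  assumes "0 \<le> s" "0 \<le> a" "0 \<le> t" "0 \<le> b" "1 \<le> n"
  obtains \<epsilon> where "covers s a t b n k \<epsilon>"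
proof -
  obtain C1 where C1: "C1 > 0" "\<And>n x i. x \<in> lball s a n \<Longrightarrow> 1 \<le> i \<Longrightarrow> i \<le> n \<Longrightarrow> rearr x i \<le> C1 / psi s a i"
    using rearr_le_psi[OF assms(1,2)] by blast
  obtain C2 where C2: "C2 > 0" "\<And>n m d x. x \<in> carrier_vec n \<Longrightarrow> 1 \<le> m \<Longrightarrow> m \<le> n \<Longrightarrow> 0 \<le> d \<Longrightarrow>
      (\<And>i. 1 \<le> i \<Longrightarrow> i \<le> m \<Longrightarrow> rearr x i \<le> d) \<Longrightarrow> (\<And>i. m < i \<Longrightarrow> i \<le> n \<Longrightarrow> rearr x i = 0) \<Longrightarrow>
      lnorm t b x \<le> C2 * d * psi t b m"
    using lnorm_le_psi[OF assms(3,4)] by blast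
  have p: "psi t b n > 0" "psi s a 1 > 0" using assms by (simp_all add: psi_pos)
  have "covers s a t b n k (C2 * (C1 / psi s a 1) * psi t b n)"
  proof (rule covers_if_lnorm_le)
    fix x assume x: "x \<in> lball s a n"
    then have xc: "x \<in> carrier_vec n" by (simp add: lball_def)
    show "lnorm t b x \<le> C2 * (C1 / psi s a 1) * psi t b n"
    proof (rule C2(2)[OF xc assms(5) order_refl])
      fix i assume i: "1 \<le> i" "i \<le> n"
      have "rearr x i \<le> rearr x 1" using i xc by (intro rearr_antimono) auto
      also have "\<dots> \<le> C1 / psi s a 1" using C1(2)[OF x, of 1] assms by simp
      finally show "rearr x i \<le> C1 / psi s a 1" .
    qed (use C1 p in auto)
  qed (use assms C1 C2 p in auto)
  then show ?thesis by (rule that)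
qed

lemma powr_abs_diff_le:
  fixes u v r :: real
  assumes "0 < r"
  shows "\<bar>u - v\<bar> powr r \<le> 2 powr r * (\<bar>u\<bar> powr r + \<bar>v\<bar> powr r)"
proof -
  have "\<bar>u - v\<bar> powr r \<le> (2 * max \<bar>u\<bar> \<bar>v\<bar>) powr r" using assms by (intro powr_mono2) auto
  also have "\<dots> = 2 powr r * max \<bar>u\<bar> \<bar>v\<bar> powr r" by (simp add: powr_mult)
  also have "max \<bar>u\<bar> \<bar>v\<bar> powr r \<le> \<bar>u\<bar> powr r + \<bar>v\<bar> powr r" by (simp add: max_def)
  finally show ?thesis by simp
qed

text \<open>A volume comparison on a grid: \<open>M ^ n\<close> points of a cube inside the source
  ball are shared out among \<open>2 ^ (k - 1)\<close> target balls, and the points in one ball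
  differ from a given one by integer points of an \<open>l_r\<close> ball, at most
  \<open>(A * \<rho>) ^ n\<close> of them. Since \<open>\<rho>\<close> is proportional to
  \<open>M\<close>, the factor \<open>M ^ n\<close> cancels and no limit in the grid is
  taken.\<close>

lemma ent_ge_volume:
  assumes "0 \<le> s" "0 \<le> a" "0 \<le> t" "0 \<le> b"
  obtains c where "c > 0"
    "\<And>n k. 1 \<le> n \<Longrightarrow> c * (2 powr (- (real k / real n)) * (psi t b n / psi s a n)) \<le> ent s a t b n k"
proof -
  obtain C1 where C1: "C1 > 0" "\<And>n x i. x \<in> lball t b n \<Longrightarrow> 1 \<le> i \<Longrightarrow> i \<le> n \<Longrightarrow> rearr x i \<le> C1 / psi t b i"
    using rearr_le_psi[OF assms(3,4)] by blast
  obtain C2 where C2: "C2 > 0" "\<And>n m d x. x \<in> carrier_vec n \<Longrightarrow> 1 \<le> m \<Longrightarrow> m \<le> n \<Longrightarrow> 0 \<le> d \<Longrightarrow>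
      (\<And>i. 1 \<le> i \<Longrightarrow> i \<le> m \<Longrightarrow> rearr x i \<le> d) \<Longrightarrow> (\<And>i. m < i \<Longrightarrow> i \<le> n \<Longrightarrow> rearr x i = 0) \<Longrightarrow>
      lnorm s a x \<le> C2 * d * psi s a m"
    using lnorm_le_psi[OF assms(1,2)] by blast
  obtain r B where rB: "0 < r" "B > 0"
    "\<And>m. 1 \<le> m \<Longrightarrow> (\<Sum>i = 1..m. (psi t b (real m) / psi t b (real i)) powr r) \<le> B * real m"
    using sum_psi_ratio_le[OF assms(3,4)] by blast
  obtain A where A: "A \<ge> 1" "\<And>n M \<rho>. 1 \<le> \<rho> \<Longrightarrow> real (card (lattice_pts n M r ((2 * B) * real n * \<rho> powr r))) \<le> (A * \<rho>) ^ n"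
    using card_lattice_pts_fine[of r "2 * B"] rB by auto
  define c where "c = 1 / (2 * A * C1 * C2)"
  have c: "c > 0" using A C1 C2 by (simp add: c_def)
  show ?thesis
  proof (rule that[OF c])
    fix n k :: nat assume n: "1 \<le> n"
    have pn: "psi s a n > 0" "psi t b n > 0" using n by (simp_all add: psi_pos)
    obtain \<epsilon>0 where \<epsilon>0: "covers s a t b n k \<epsilon>0" using ex_covers[OF assms n] by blast
    show "c * (2 powr (- (real k / real n)) * (psi t b n / psi s a n)) \<le> ent s a t b n k"
    proof (rule ent_ge[OF \<epsilon>0])
      fix \<epsilon> assume cov: "covers s a t b n k \<epsilon>"
      then have \<epsilon>: "\<epsilon> > 0" by (simp add: covers_def)
      define \<kappa> where "\<kappa> = 1 / (C2 * psi s a n)"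
      have \<kappa>: "\<kappa> > 0" using C2 pn by (simp add: \<kappa>_def)
      \<comment> \<open>In units of the cube side \<open>\<kappa>\<close>, this is twice the level
        \<open>\<epsilon> * C1 / psi t b n\<close> of a flat vector in the scaled target ball; the 2
        pays for the difference of \<open>w\<close> and \<open>w'\<close>.\<close>
      define \<eta> where "\<eta> = 2 * \<epsilon> * C1 / (\<kappa> * psi t b n)"
      have \<eta>: "\<eta> > 0" using \<epsilon> C1 \<kappa> pn by (simp add: \<eta>_def)
      \<comment> \<open>The grid has to be just fine enough for
        \<open>\<rho> = M * \<eta> \<ge> 1\<close>, the range of the lattice count.\<close>
      obtain M0 :: nat where M0: "1 / \<eta> \<le> real M0" using real_arch_simple by blast
      define M where "M = max 1 M0"
      have M: "M \<ge> 1" "1 / \<eta> \<le> real M" using M0 by (auto simp: M_def)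
      define \<rho> where "\<rho> = real M * \<eta>"
      have \<rho>: "1 \<le> \<rho>" using M \<eta> by (simp add: \<rho>_def field_simps)
      define P where "P = PiE {..<n} (\<lambda>_. {0..<int M})"
      define X where "X f = vec n (\<lambda>j. \<kappa> * real_of_int (f j) / real M)" for f
      have finP: "finite P" unfolding P_def by (intro finite_PiE) auto
      have cardP: "card P = M ^ n" by (simp add: P_def card_PiE)
      have "real (card P) \<le> 2 ^ (k - 1) * (A * \<rho>) ^ n"
      proof (rule covers_card_le[OF cov finP, of X])
        show "X ` P \<subseteq> lball s a n"
        proof (intro image_subsetI)
          fix f assume f: "f \<in> P"
          have "rearr (X f) i \<le> \<kappa>" if "1 \<le> i" "i \<le> n" for i
          proof (rule rearr_le_bound)
            fix j assume "j < dim_vec (X f)"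
            then have j: "j < n" by (simp add: X_def)
            have "f j \<in> {0..<int M}" using f j unfolding P_def by (intro PiE_mem[of f "{..<n}"]) auto
            then have "0 \<le> real_of_int (f j)" "real_of_int (f j) \<le> real M" by auto
            then have "real_of_int (f j) / real M \<le> 1" "0 \<le> real_of_int (f j) / real M" using M by auto
            then have "\<kappa> * (real_of_int (f j) / real M) \<le> \<kappa> * 1" "0 \<le> \<kappa> * (real_of_int (f j) / real M)"
              using \<kappa> mult_nonneg_nonneg[of \<kappa> "real_of_int (f j) / real M"] by (intro mult_left_mono, auto)
            then show "\<bar>X f $ j\<bar> \<le> \<kappa>" using j by (simp add: X_def)
          qed (use that in \<open>auto simp: X_def\<close>)
          then have "lnorm s a (X f) \<le> C2 * \<kappa> * psi s a n"
            using \<kappa> n by (intro C2(2)) (auto simp: X_def)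
          also have "\<dots> = 1" using C2 pn by (simp add: \<kappa>_def)
          finally show "X f \<in> lball s a n" by (simp add: lball_def X_def)
        qed
      next
        fix f assume f: "f \<in> P"
        let ?G = "{g \<in> P. \<exists>w\<in>lball t b n. \<exists>w'\<in>lball t b n. X f - X g = \<epsilon> \<cdot>\<^sub>v (w - w')}"
        let ?h = "\<lambda>g. restrict (\<lambda>j. f j - g j) {..<n}"
        have "inj_on ?h ?G"
        proof (rule inj_onI)
          fix g g' assume g: "g \<in> ?G" "g' \<in> ?G" and eq: "?h g = ?h g'"
          have "g j = g' j" if "j < n" for j using fun_cong[OF eq, of j] that by simp
          moreover have "g \<in> P" "g' \<in> P" using g by auto
          ultimately show "g = g'" unfolding P_def by (intro PiE_ext) auto
        qed
        moreover have "?h ` ?G \<subseteq> lattice_pts n M r (2 * B * real n * \<rho> powr r)"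
        proof (intro image_subsetI)
          fix g assume "g \<in> ?G"
          then obtain w w' where g: "g \<in> P" and w: "w \<in> lball t b n" "w' \<in> lball t b n" "X f - X g = \<epsilon> \<cdot>\<^sub>v (w - w')" by blast
          have dw: "dim_vec w = n" "dim_vec w' = n" using w by (auto simp: lball_def)
          have S: "(\<Sum>j<n. \<bar>v $ j\<bar> powr r) \<le> (C1 / psi t b n) powr r * (B * real n)" if v: "v \<in> lball t b n" for v
          proof -
            have dv: "dim_vec v = n" using v by (auto simp: lball_def)
            have "(\<Sum>j<n. \<bar>v $ j\<bar> powr r) = (\<Sum>i = 1..n. rearr v i powr r)"
              using sum_rearr[of "\<lambda>y. y powr r" v] dv by simp
            also have "\<dots> \<le> (\<Sum>i = 1..n. (C1 / psi t b n) powr r * (psi t b n / psi t b i) powr r)"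
            proof (rule sum_mono)
              fix i assume i: "i \<in> {1..n}"
              then have "rearr v i powr r \<le> (C1 / psi t b i) powr r"
                using rB dv C1(2)[OF v] by (intro powr_mono2) (auto intro: rearr_nonneg)
              also have "C1 / psi t b i = (C1 / psi t b n) * (psi t b n / psi t b i)" using pn by simp
              also have "\<dots> powr r = (C1 / psi t b n) powr r * (psi t b n / psi t b i) powr r"
                by (rule powr_mult)
              finally show "rearr v i powr r \<le> (C1 / psi t b n) powr r * (psi t b n / psi t b i) powr r" .
            qed
            also have "\<dots> \<le> (C1 / psi t b n) powr r * (B * real n)"
              unfolding sum_distrib_left[symmetric] using rB(3) n by (intro mult_left_mono) auto
            finally show ?thesis .
          qed
          have eq: "real_of_int (f j - g j) = \<epsilon> * real M / \<kappa> * (w $ j - w' $ j)" if j: "j < n" for j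
          proof -
            have "(X f - X g) $ j = (\<epsilon> \<cdot>\<^sub>v (w - w')) $ j" using w(3) by simp
            then have "\<kappa> * real_of_int (f j) / real M - \<kappa> * real_of_int (g j) / real M = \<epsilon> * (w $ j - w' $ j)"
              using j dw by (simp add: X_def)
            then have "\<kappa> * real_of_int (f j - g j) = \<epsilon> * (w $ j - w' $ j) * real M" using M by (simp add: field_simps)
            then show ?thesis using \<kappa> by (simp add: field_simps)
          qed
          have "(\<Sum>j<n. \<bar>real_of_int (?h g j)\<bar> powr r) = (\<Sum>j<n. (\<epsilon> * real M / \<kappa>) powr r * \<bar>w $ j - w' $ j\<bar> powr r)"
          proof (rule sum.cong[OF refl])
            fix j assume "j \<in> {..<n}"
            then have "\<bar>real_of_int (?h g j)\<bar> = (\<epsilon> * real M / \<kappa>) * \<bar>w $ j - w' $ j\<bar>"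
              using eq[of j] \<epsilon> M \<kappa> by (simp add: abs_mult)
            then show "\<bar>real_of_int (?h g j)\<bar> powr r = (\<epsilon> * real M / \<kappa>) powr r * \<bar>w $ j - w' $ j\<bar> powr r"
              by (simp only: powr_mult)
          qed
          also have "\<dots> \<le> (\<Sum>j<n. (\<epsilon> * real M / \<kappa>) powr r * (2 powr r * (\<bar>w $ j\<bar> powr r + \<bar>w' $ j\<bar> powr r)))"
            using rB by (intro sum_mono mult_left_mono powr_abs_diff_le) auto
          also have "\<dots> = (\<epsilon> * real M / \<kappa>) powr r * (2 powr r * ((\<Sum>j<n. \<bar>w $ j\<bar> powr r) + (\<Sum>j<n. \<bar>w' $ j\<bar> powr r)))"
            by (simp only: sum_distrib_left[symmetric] sum.distrib)
          also have "\<dots> \<le> (\<epsilon> * real M / \<kappa>) powr r * (2 powr r * ((C1 / psi t b n) powr r * (B * real n) + (C1 / psi t b n) powr r * (B * real n)))"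
            using S[OF w(1)] S[OF w(2)] by (intro mult_left_mono add_mono) auto
          also have "\<dots> = 2 * B * real n * ((\<epsilon> * real M / \<kappa>) powr r * (2 powr r * (C1 / psi t b n) powr r))" by simp
          also have "(\<epsilon> * real M / \<kappa>) powr r * (2 powr r * (C1 / psi t b n) powr r) = (\<epsilon> * real M / \<kappa> * (2 * (C1 / psi t b n))) powr r"
            by (simp only: powr_mult)
          also have "\<epsilon> * real M / \<kappa> * (2 * (C1 / psi t b n)) = \<rho>" by (simp add: \<rho>_def \<eta>_def)
          finally have "(\<Sum>j<n. \<bar>real_of_int (?h g j)\<bar> powr r) \<le> 2 * B * real n * \<rho> powr r" .
          moreover have "?h g j \<in> {- int M..int M}" if "j < n" for j
          proof -
            have "f j \<in> {0..<int M}" using f that unfolding P_def by (intro PiE_mem[of f "{..<n}"]) auto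
            moreover have "g j \<in> {0..<int M}" using g that unfolding P_def by (intro PiE_mem[of g "{..<n}"]) auto
            ultimately show ?thesis using that by auto
          qed
          ultimately show "?h g \<in> lattice_pts n M r (2 * B * real n * \<rho> powr r)"
            unfolding lattice_pts_def by (intro CollectI conjI PiE_I) auto
        qed
        ultimately have "card ?G \<le> card (lattice_pts n M r (2 * B * real n * \<rho> powr r))"
          using finite_lattice_pts by (rule card_inj_on_le)
        then show "real (card ?G) \<le> (A * \<rho>) ^ n" using A(2)[OF \<rho>, of n M] by linarith
      qed (use A \<rho> in auto)
      then have "real M ^ n \<le> 2 ^ (k - 1) * ((A * \<eta>) ^ n * real M ^ n)"
        by (simp add: cardP \<rho>_def power_mult_distrib ac_simps)
      then have "real M ^ n * 1 \<le> real M ^ n * (2 ^ (k - 1) * (A * \<eta>) ^ n)" by (simp add: ac_simps)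
      then have "1 \<le> 2 ^ (k - 1) * (A * \<eta>) ^ n" using M by (subst (asm) mult_le_cancel_left_pos) auto
      also have "\<dots> \<le> 2 ^ k * (A * \<eta>) ^ n" using A \<eta> by (intro mult_right_mono power_increasing) auto
      also have "\<dots> = (2 powr (real k / real n) * (A * \<eta>)) ^ n"
        using n by (simp add: power_mult_distrib powr_powr powr_realpow[symmetric] flip: powr_power)
      finally have pow: "1 \<le> (2 powr (real k / real n) * (A * \<eta>)) ^ n" .
      have "1 \<le> 2 powr (real k / real n) * (A * \<eta>)"
      proof (rule ccontr)
        assume "\<not> 1 \<le> 2 powr (real k / real n) * (A * \<eta>)"
        then have "(2 powr (real k / real n) * (A * \<eta>)) ^ n < 1 ^ n"
          using n A \<eta> by (intro power_strict_mono) auto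
        with pow show False by simp
      qed
      then have "2 powr (- (real k / real n)) \<le> A * \<eta>" by (simp add: powr_minus_divide field_simps)
      also have "A * \<eta> = \<epsilon> * (1 / c) * (psi s a n / psi t b n)" using C2 pn by (simp add: \<eta>_def \<kappa>_def c_def)
      finally have "2 powr (- (real k / real n)) * (psi t b n / psi s a n) \<le> \<epsilon> * (1 / c) * (psi s a n / psi t b n) * (psi t b n / psi s a n)"
        using pn by (intro mult_right_mono) auto
      also have "\<dots> = \<epsilon> / c" using pn by simp
      finally show "c * (2 powr (- (real k / real n)) * (psi t b n / psi s a n)) \<le> \<epsilon>" using c by (simp add: field_simps)
    qed
  qed
qed

lemma sum_atLeastAtMost_split:
  fixes g :: "nat \<Rightarrow> real"
  assumes "m \<le> n"
  shows "sum g {1..n} = sum g {1..m} + sum g {Suc m..n}"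
proof -
  have "{1..n} = {1..m} \<union> {Suc m..n}" using assms by auto
  then show ?thesis by (simp add: sum.union_disjoint)
qed

text \<open>Doubling: for \<open>y \<le> x\<close> monotonicity suffices, and for
  \<open>x < y \<le> K * x\<close> polynomial growth loses at most a power of \<open>K\<close>. This
  allows one support size to be replaced by a comparable one.\<close>

lemma psi_ge_const_mult:
  assumes "0 \<le> s" "0 \<le> a" "1 \<le> K"
  obtains c where "c > 0" "\<And>x y. 1 / 2 \<le> x \<Longrightarrow> 0 < y \<Longrightarrow> y \<le> K * x \<Longrightarrow> c * psi s a y \<le> psi s a x"
proof -
  obtain c where c: "0 < c" "\<And>x y. 1 / 2 \<le> x \<Longrightarrow> x \<le> y \<Longrightarrow> c * (x / y) powr (s + 1) * psi s a y \<le> psi s a x"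
    using psi_ratio[of s a "s + 1"] assms by auto
  show ?thesis
  proof (rule that[of "min 1 (c * (1 / K) powr (s + 1))"])
    fix x y :: real assume xy: "1 / 2 \<le> x" "0 < y" "y \<le> K * x"
    have py: "0 \<le> psi s a y" using psi_pos[OF xy(2), of s a] by simp
    show "min 1 (c * (1 / K) powr (s + 1)) * psi s a y \<le> psi s a x"
    proof (cases "y \<le> x")
      case True
      have "min 1 (c * (1 / K) powr (s + 1)) * psi s a y \<le> 1 * psi s a y" using py by (intro mult_right_mono) auto
      also have "\<dots> \<le> psi s a x" using True xy assms psi_mono by simp
      finally show ?thesis .
    next
      case False
      have "min 1 (c * (1 / K) powr (s + 1)) * psi s a y \<le> c * (1 / K) powr (s + 1) * psi s a y"
        using py by (intro mult_right_mono) auto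
      also have "\<dots> \<le> c * (x / y) powr (s + 1) * psi s a y"
        using py xy assms c by (intro mult_right_mono mult_left_mono powr_mono2) (auto simp: field_simps)
      also have "\<dots> \<le> psi s a x" using False xy by (intro c(2)) auto
      finally show ?thesis .
    qed
  qed (use assms c in auto)
qed

section \<open>Codes with large Hamming distance as test points\<close>

abbreviation hamming :: "nat \<Rightarrow> (nat \<Rightarrow> 'a) \<Rightarrow> (nat \<Rightarrow> 'a) \<Rightarrow> nat" where
  "hamming m f g \<equiv> card {t \<in> {..<m}. f t \<noteq> g t}"

text \<open>Each disagreement is weighted by \<open>1 / \<beta>\<close>: words in the ball weigh at
  least \<open>\<beta> powr (- m / 4)\<close>, and each coordinate sums to at most
  \<open>1 + \<beta> * (1 / \<beta>) = 2\<close>. Of the exponent \<open>m\<close> of all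
  \<open>\<beta> ^ m\<close> words, three quarters are left to beat the number of covering
  balls.\<close>

lemma card_hamming_ball_le:
  assumes "1 \<le> \<beta>"
  shows "real (card {g \<in> PiE {..<m} (\<lambda>_. {..<\<beta>}). 4 * hamming m f g \<le> m})
    \<le> 2 ^ m * real \<beta> powr (real m / 4)"
proof -
  let ?G = "{g \<in> PiE {..<m} (\<lambda>_. {..<\<beta>}). 4 * hamming m f g \<le> m}"
  let ?h = "\<lambda>t y. if f t = y then 1 else 1 / real \<beta>"
  have \<beta>: "real \<beta> \<ge> 1" using assms by simp
  have "real (card ?G) * real \<beta> powr (- (real m / 4)) \<le> (\<Prod>t<m. \<Sum>y\<in>{..<\<beta>}. ?h t y)"
  proof (rule card_weighted_le)
    fix g assume "g \<in> ?G"
    then have D: "4 * hamming m f g \<le> m" by simp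
    let ?D = "hamming m f g"
    have "4 * real ?D \<le> real m" using D by linarith
    then have "real \<beta> powr (- (real m / 4)) \<le> real \<beta> powr (- real ?D)" using \<beta> by (intro powr_mono) auto
    also have "\<dots> = (1 / real \<beta>) ^ ?D" using \<beta> by (simp add: powr_minus powr_realpow power_one_over inverse_eq_divide)
    also have "\<dots> = (\<Prod>t\<in>{t \<in> {..<m}. f t \<noteq> g t}. 1 / real \<beta>)" by simp
    also have "\<dots> = (\<Prod>t<m. if f t \<noteq> g t then 1 / real \<beta> else 1)" by (rule prod.inter_filter) simp
    also have "\<dots> = (\<Prod>t<m. ?h t (g t))" by (intro prod.cong) auto
    finally show "real \<beta> powr (- (real m / 4)) \<le> (\<Prod>t<m. ?h t (g t))" .
  qed auto
  also have "\<dots> \<le> (\<Prod>t<m. 2)"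
  proof (intro prod_mono conjI)
    fix t
    have "(\<Sum>y\<in>{..<\<beta>}. ?h t y) \<le> (\<Sum>y\<in>{..<\<beta>}. (if f t = y then 1 else 0) + 1 / real \<beta>)"
      by (intro sum_mono) auto
    also have "\<dots> \<le> 2" using \<beta> by (simp add: sum.distrib)
    finally show "(\<Sum>y\<in>{..<\<beta>}. ?h t y) \<le> 2" .
  qed (auto intro!: sum_nonneg)
  finally have "real (card ?G) * real \<beta> powr (- (real m / 4)) \<le> 2 ^ m" by simp
  then show ?thesis using \<beta> by (simp add: powr_minus field_simps)
qed

text \<open>At each \<open>j \<in> J\<close> one of the two entries has modulus at least
  \<open>\<tau>\<close>, so one of the two vectors is that large on at least half of
  \<open>J\<close>. The \<open>+ 1\<close> admits half of \<open>card J\<close> rounded up; thus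
  \<open>i = 1\<close> is available for a single coordinate.\<close>

lemma rearr_ge_of_diff:
  assumes "dim_vec w = n" "dim_vec w' = n" "J \<subseteq> {..<n}" "2 * i \<le> card J + 1" "1 \<le> i"
    "\<And>j. j \<in> J \<Longrightarrow> 2 * \<tau> \<le> \<bar>w $ j - w' $ j\<bar>"
  shows "\<tau> \<le> rearr w i \<or> \<tau> \<le> rearr w' i"
proof -
  let ?A = "\<lambda>v. {j. j < n \<and> \<tau> \<le> \<bar>v $ j\<bar>}"
  have "card J \<le> n" using card_mono[OF _ assms(3)] by simp
  then have i: "i \<le> n" using assms(4,5) by linarith
  have "J \<subseteq> ?A w \<union> ?A w'"
  proof
    fix j assume j: "j \<in> J"
    then have "j < n" using assms(3) by auto
    moreover have "\<tau> \<le> \<bar>w $ j\<bar> \<or> \<tau> \<le> \<bar>w' $ j\<bar>" using assms(6)[OF j] by linarith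
    ultimately show "j \<in> ?A w \<union> ?A w'" by blast
  qed
  then have "card J \<le> card (?A w \<union> ?A w')" by (intro card_mono) auto
  also have "\<dots> \<le> card (?A w) + card (?A w')" by (rule card_Un_le)
  finally have "i \<le> card (?A w) \<or> i \<le> card (?A w')" using assms(4) by linarith
  then show ?thesis using le_rearr_iff[of i w \<tau>] le_rearr_iff[of i w' \<tau>] assms i by auto
qed

text \<open>Test points: words of length \<open>m\<close> over an alphabet of size \<open>\<beta>\<close>, encoded by \<open>m\<close> unit vectors, one in
  each block of \<open>\<beta>\<close> coordinates. Words at Hamming distance greater than \<open>m/4\<close> are far apart.\<close>

lemma ent_ge_words:
  assumes "0 \<le> s" "0 \<le> a" "0 \<le> t" "0 \<le> b"
  obtains c where "c > 0"
    "\<And>n m \<beta> k. 1 \<le> m \<Longrightarrow> 1 \<le> \<beta> \<Longrightarrow> m * \<beta> \<le> n \<Longrightarrow>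
       2 ^ (k - 1) * (2 ^ m * real \<beta> powr (real m / 4)) < real \<beta> ^ m \<Longrightarrow>
       c * (psi t b m / psi s a m) \<le> ent s a t b n k"
proof -
  obtain C1 where C1: "C1 > 0" "\<And>n x i. x \<in> lball t b n \<Longrightarrow> 1 \<le> i \<Longrightarrow> i \<le> n \<Longrightarrow> rearr x i \<le> C1 / psi t b i"
    using rearr_le_psi[OF assms(3,4)] by blast
  obtain C2 where C2: "C2 > 0" "\<And>n m d x. x \<in> carrier_vec n \<Longrightarrow> 1 \<le> m \<Longrightarrow> m \<le> n \<Longrightarrow> 0 \<le> d \<Longrightarrow>
      (\<And>i. 1 \<le> i \<Longrightarrow> i \<le> m \<Longrightarrow> rearr x i \<le> d) \<Longrightarrow> (\<And>i. m < i \<Longrightarrow> i \<le> n \<Longrightarrow> rearr x i = 0) \<Longrightarrow>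
      lnorm s a x \<le> C2 * d * psi s a m"
    using lnorm_le_psi[OF assms(1,2)] by blast
  \<comment> \<open>Words far apart differ in more than \<open>m / 4\<close> places, half of which
    go to one of \<open>w\<close>, \<open>w'\<close>. The target ball is therefore tested at some
    \<open>i \<ge> m / 8\<close>, hence doubling with factor 8.\<close>
  obtain c1 where c1: "c1 > 0" "\<And>x y. 1 / 2 \<le> x \<Longrightarrow> 0 < y \<Longrightarrow> y \<le> 8 * x \<Longrightarrow> c1 * psi t b y \<le> psi t b x"
    using psi_ge_const_mult[OF assms(3,4), of 8] by auto
  define c where "c = c1 / (2 * C1 * C2)"
  have c: "c > 0" using C1 C2 c1 by (simp add: c_def)
  show ?thesis
  proof (rule that[OF c])
    fix n m \<beta> k :: nat
    assume m: "1 \<le> m" and \<beta>: "1 \<le> \<beta>" and n: "m * \<beta> \<le> n"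
      and small: "2 ^ (k - 1) * (2 ^ m * real \<beta> powr (real m / 4)) < real \<beta> ^ m"
    have mn: "m \<le> n" using n \<beta> by (metis le_trans mult.right_neutral mult_le_mono2)
    have n1: "1 \<le> n" using m mn by simp
    have pm: "psi s a m > 0" "psi t b m > 0" using m by (simp_all add: psi_pos)
    obtain \<epsilon>0 where \<epsilon>0: "covers s a t b n k \<epsilon>0" using ex_covers[OF assms n1] by blast
    show "c * (psi t b m / psi s a m) \<le> ent s a t b n k"
    proof (rule ent_ge[OF \<epsilon>0], rule ccontr)
      fix \<epsilon> assume cov: "covers s a t b n k \<epsilon>" and "\<not> c * (psi t b m / psi s a m) \<le> \<epsilon>"
      then have \<epsilon>: "\<epsilon> > 0" "\<epsilon> < c * (psi t b m / psi s a m)" by (simp_all add: covers_def)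
      define \<kappa> where "\<kappa> = 1 / (C2 * psi s a m)"
      have \<kappa>: "\<kappa> > 0" using C2 pm by (simp add: \<kappa>_def)
      define P where "P = PiE {..<m} (\<lambda>_. {..<\<beta>})"
      define X where "X f = vec n (\<lambda>j. if j < m * \<beta> \<and> f (j div \<beta>) = j mod \<beta> then \<kappa> else 0)" for f :: "nat \<Rightarrow> nat"
      have finP: "finite P" unfolding P_def by (intro finite_PiE) auto
      have cardP: "card P = \<beta> ^ m" by (simp add: P_def card_PiE)
      have "real (card P) \<le> 2 ^ (k - 1) * (2 ^ m * real \<beta> powr (real m / 4))"
      proof (rule covers_card_le[OF cov finP, of X])
        show "X ` P \<subseteq> lball s a n"
        proof (intro image_subsetI)
          fix f assume f: "f \<in> P"
          have "{j. j < n \<and> X f $ j \<noteq> 0} \<subseteq> (\<lambda>t. t * \<beta> + f t) ` {..<m}"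
          proof
            fix j assume "j \<in> {j. j < n \<and> X f $ j \<noteq> 0}"
            then have j: "j < m * \<beta>" "f (j div \<beta>) = j mod \<beta>" by (auto simp: X_def split: if_splits)
            then have "j div \<beta> < m" by (simp add: less_mult_imp_div_less)
            moreover have "j = (j div \<beta>) * \<beta> + f (j div \<beta>)" using j by simp
            ultimately show "j \<in> (\<lambda>t. t * \<beta> + f t) ` {..<m}" by blast
          qed
          then have "card {j. j < n \<and> X f $ j \<noteq> 0} \<le> card ((\<lambda>t. t * \<beta> + f t) ` {..<m})" by (intro card_mono) auto
          also have "\<dots> \<le> m" using card_image_le[of "{..<m}"] by simp
          finally have supp: "card {j. j < n \<and> X f $ j \<noteq> 0} \<le> m" .
          have "lnorm s a (X f) \<le> C2 * \<kappa> * psi s a m"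
          proof (rule C2(2)[OF _ m mn])
            fix i assume "1 \<le> i" "i \<le> m"
            then show "rearr (X f) i \<le> \<kappa>" using \<kappa> mn by (intro rearr_le_bound) (auto simp: X_def)
          next
            fix i assume "m < i" "i \<le> n"
            then show "rearr (X f) i = 0" using supp by (intro rearr_eq_0_beyond_support) (auto simp: X_def)
          qed (use \<kappa> in \<open>auto simp: X_def\<close>)
          also have "\<dots> = 1" using C2 pm by (simp add: \<kappa>_def)
          finally show "X f \<in> lball s a n" by (simp add: lball_def X_def)
        qed
      next
        fix f assume f: "f \<in> P"
        have "{g \<in> P. \<exists>w\<in>lball t b n. \<exists>w'\<in>lball t b n. X f - X g = \<epsilon> \<cdot>\<^sub>v (w - w')}
          \<subseteq> {g \<in> P. 4 * hamming m f g \<le> m}"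
        proof (safe, rule ccontr)
          fix g w w' assume g: "g \<in> P" and w: "w \<in> lball t b n" "w' \<in> lball t b n" "X f - X g = \<epsilon> \<cdot>\<^sub>v (w - w')"
            and far: "\<not> 4 * hamming m f g \<le> m"
          have dw: "dim_vec w = n" "dim_vec w' = n" using w by (auto simp: lball_def)
          let ?D = "{t \<in> {..<m}. f t \<noteq> g t}"
          define i where "i = (card ?D + 1) div 2"
          have i: "1 \<le> i" "2 * i \<le> card ?D + 1" "m \<le> 8 * i" using far m by (auto simp: i_def)
          \<comment> \<open>Only the positions marked by \<open>f\<close> in the blocks where the
            words differ are used; there \<open>X f\<close> is \<open>\<kappa>\<close> and
            \<open>X g\<close> vanishes.\<close>
          define J where "J = (\<lambda>t. t * \<beta> + f t) ` ?D"
          have fb: "f t < \<beta>" if "t < m" for t using f that by (auto simp: P_def dest: PiE_mem)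
          have div: "(t * \<beta> + f t) div \<beta> = t" "(t * \<beta> + f t) mod \<beta> = f t" if "t < m" for t
            using fb[OF that] \<beta> by auto
          have "inj_on (\<lambda>t. t * \<beta> + f t) ?D"
            by (rule inj_on_inverseI[where g = "\<lambda>j. j div \<beta>"]) (use div in auto)
          then have cJ: "card J = card ?D" by (simp add: J_def card_image)
          have lt: "t * \<beta> + f t < m * \<beta>" if "t < m" for t
          proof -
            have "t * \<beta> + f t < (t + 1) * \<beta>" using fb[OF that] by simp
            also have "\<dots> \<le> m * \<beta>" using that by (intro mult_right_mono) auto
            finally show ?thesis .
          qed
          have "\<kappa> / (2 * \<epsilon>) \<le> rearr w i \<or> \<kappa> / (2 * \<epsilon>) \<le> rearr w' i"
          proof (rule rearr_ge_of_diff[OF dw])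
            show "J \<subseteq> {..<n}" using lt n unfolding J_def by fastforce
            show "2 * i \<le> card J + 1" using i cJ by simp
          next
            fix j assume "j \<in> J"
            then obtain t where t: "t < m" "f t \<noteq> g t" "j = t * \<beta> + f t" by (auto simp: J_def)
            have j: "j < m * \<beta>" "j < n" "j div \<beta> = t" "j mod \<beta> = f t" using lt[OF t(1)] n div[OF t(1)] t(3) by auto
            have "(X f - X g) $ j = \<kappa>" using j t by (simp add: X_def)
            then have "\<epsilon> * (w $ j - w' $ j) = \<kappa>" using j dw w(3) by simp
            then have "w $ j - w' $ j = \<kappa> / \<epsilon>" using \<epsilon> by (simp add: field_simps)
            then show "2 * (\<kappa> / (2 * \<epsilon>)) \<le> \<bar>w $ j - w' $ j\<bar>" using \<kappa> \<epsilon> by simp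
          qed (use i in simp)
          moreover have "i \<le> n"
          proof -
            have "card ?D \<le> m" using card_mono[of "{..<m}" ?D] by auto
            then show ?thesis using i mn m by linarith
          qed
          ultimately have "\<kappa> / (2 * \<epsilon>) \<le> C1 / psi t b i"
            using C1(2)[OF w(1), of i] C1(2)[OF w(2), of i] i by linarith
          also have "\<dots> \<le> C1 / (c1 * psi t b m)"
          proof (rule divide_left_mono)
            have "real m \<le> 8 * real i" using i by linarith
            moreover have "1 / 2 \<le> real i" using i(1) by linarith
            ultimately show "c1 * psi t b m \<le> psi t b i" using m by (intro c1(2)) auto
          qed (use C1 c1 pm psi_pos[of i t b] i in auto)
          finally have "\<kappa> * (c1 * psi t b m) \<le> 2 * \<epsilon> * C1" using \<epsilon> c1 pm by (simp add: field_simps)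
          then have "c * (psi t b m / psi s a m) \<le> \<epsilon>" using C1 C2 pm by (simp add: c_def \<kappa>_def field_simps)
          then show False using \<epsilon> by simp
        qed
        then have "real (card {g \<in> P. \<exists>w\<in>lball t b n. \<exists>w'\<in>lball t b n. X f - X g = \<epsilon> \<cdot>\<^sub>v (w - w')})
          \<le> real (card {g \<in> P. 4 * hamming m f g \<le> m})"
          using finP by (intro of_nat_mono card_mono) auto
        also have "\<dots> \<le> 2 ^ m * real \<beta> powr (real m / 4)" unfolding P_def by (rule card_hamming_ball_le[OF \<beta>])
        finally show "real (card {g \<in> P. \<exists>w\<in>lball t b n. \<exists>w'\<in>lball t b n. X f - X g = \<epsilon> \<cdot>\<^sub>v (w - w')})
          \<le> 2 ^ m * real \<beta> powr (real m / 4)" .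
      qed simp
      then show False using small cardP by simp
    qed
  qed
qed

text \<open>For \<open>p = q\<close> the test points are multiples of \<open>i \<mapsto> f (i mod m) max(m, i) powr (- 1 / p)\<close>, with words \<open>f\<close> over \<open>{0, 1, 2, 3}\<close>:
  the periodic repetition makes two of them differ on every dyadic scale between \<open>m\<close> and \<open>n\<close>.\<close>

lemma ent_ge_log:
  assumes "0 < s" "0 \<le> a" "a < b"
  obtains c K where "c > 0" "K > 0"
    "\<And>n k. 1 \<le> k \<Longrightarrow> K * real k \<le> real n \<Longrightarrow> c * ln (real n / real k + 1) powr (b - a) \<le> ent s a s b n k"
proof -
  have b: "b > 0" using assms by simp
  have "\<exists>C\<ge>1. a > 0 \<longrightarrow> (\<forall>m::nat. 1 \<le> m \<longrightarrow> (\<Sum>i = 1..m. real i powr (s / a - 1)) \<le> C * real m powr (s / a))"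
  proof (cases "a > 0")
    case True
    then obtain C where "C > 0" "\<And>m::nat. (\<Sum>i = 1..m. real i powr (s / a - 1)) \<le> C * real m powr (s / a)"
      using sum_powr_le[of "s / a"] assms by auto
    moreover have "C * real m powr (s / a) \<le> max 1 C * real m powr (s / a)" for m :: nat
      by (intro mult_right_mono) auto
    ultimately show ?thesis by (intro exI[of _ "max 1 C"]) (auto intro: order_trans)
  qed auto
  then obtain C where C: "C \<ge> 1" "\<And>m::nat. a > 0 \<Longrightarrow> 1 \<le> m \<Longrightarrow> (\<Sum>i = 1..m. real i powr (s / a - 1)) \<le> C * real m powr (s / a)"
    by auto
  \<comment> \<open>With \<open>m = 2 * k\<close> this gives \<open>n / m \<ge> 81 * exp 2\<close>,
    so \<open>ln (n / m) \<ge> 2 * ln 9 + 2\<close>. Only ranks up to \<open>n / 9\<close> will be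
    used, and after this loss of \<open>ln 9\<close> at least half of \<open>\<Lambda>\<close>
    remains.\<close>
  define K where "K = 162 * exp (2::real)"
  have K: "K \<ge> 162" by (simp add: K_def)
  define c0 where "c0 = (1 / 6) * C powr (- a) * 9 powr (- s) * (1 / 4) powr b"
  have c0: "c0 > 0" using C by (simp add: c0_def)
  show ?thesis
  proof (rule that[of "c0 * (1 / 2) powr (b - a)" K])
    fix n k :: nat assume k: "1 \<le> k" and Kn: "K * real k \<le> real n"
    \<comment> \<open>Tuned to four letters: the pigeonhole bound is
      \<open>2 ^ (k - 1) * 2 ^ m * 4 powr (m / 4) = 2 ^ (4 * k - 1)\<close>, just below the number
      \<open>4 ^ m = 2 ^ (4 * k)\<close> of words.\<close>
    define m where "m = 2 * k"
    define \<Lambda> where "\<Lambda> = 1 + ln (real n / real m)"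
    have m: "1 \<le> m" using k by (simp add: m_def)
    have nm: "81 * exp 2 \<le> real n / real m" using Kn k by (simp add: K_def m_def pos_le_divide_eq)
    have "1 * real k \<le> K * real k" "162 * real k \<le> K * real k" using K by (intro mult_right_mono; simp)+
    then have mn: "9 * m \<le> n" using Kn by (simp add: m_def)
    have n1: "1 \<le> n" "m \<le> n" using mn m by simp_all
    have "ln (81 * exp 2) \<le> ln (real n / real m)" using nm by (intro ln_mono) auto
    also have "ln (81 * exp (2::real)) = 2 * ln 9 + 2"
    proof -
      have "ln (81::real) = ln (9 ^ 2)" by simp
      also have "\<dots> = 2 * ln 9" by (subst ln_realpow) auto
      finally show ?thesis by (simp add: ln_mult)
    qed
    finally have lnm: "2 * ln 9 + 2 \<le> ln (real n / real m)" .
    have l9: "ln 9 > (0::real)" by simp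
    have lnm0: "0 \<le> ln (real n / real m)" using lnm l9 by linarith
    have \<Lambda>: "1 \<le> \<Lambda>" using lnm l9 unfolding \<Lambda>_def by linarith
    have ln9m: "\<Lambda> / 2 \<le> ln (real n / (9 * real m))"
    proof -
      have "ln (real n / (9 * real m)) = ln (real n / real m) - ln 9"
        using m n1 by (simp add: ln_div ln_mult)
      then show ?thesis using lnm by (simp add: \<Lambda>_def)
    qed
    \<comment> \<open>Here 3 is the largest letter, and \<open>(C * \<Lambda>) powr a\<close> bounds
      the quasi-norm of the envelope \<open>G\<close>: for \<open>a > 0\<close> its head up to
      \<open>m\<close> contributes \<open>C\<close> and its harmonic tail \<open>ln (n / m)\<close>.
      For \<open>a = 0\<close> the second factor is 1.\<close>
    define \<delta> where "\<delta> = (1 / 3) * (C * \<Lambda>) powr (- a)"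
    have \<delta>: "\<delta> > 0" using C \<Lambda> by (simp add: \<delta>_def)
    obtain \<epsilon>0 where \<epsilon>0: "covers s a s b n k \<epsilon>0" using ex_covers[of s a s b n] assms b n1 by auto
    have main: "c0 * \<Lambda> powr (b - a) \<le> ent s a s b n k"
    proof (rule ent_ge[OF \<epsilon>0], rule ccontr)
      fix \<epsilon> assume cov: "covers s a s b n k \<epsilon>" and "\<not> c0 * \<Lambda> powr (b - a) \<le> \<epsilon>"
      then have \<epsilon>: "\<epsilon> > 0" "\<epsilon> < c0 * \<Lambda> powr (b - a)" by (simp_all add: covers_def)
      define P where "P = PiE {..<m} (\<lambda>_. {..<4::nat})"
      \<comment> \<open>The shift \<open>j + 1\<close> turns positions into ranks;
        \<open>max\<close> keeps the first period flat, as only the scales beyond \<open>m\<close>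
        are to contribute.\<close>
      define G where "G j = real (max m (j + 1)) powr (- s)" for j :: nat
      define X where "X f = vec n (\<lambda>j. \<delta> * real (f (j mod m)) * G j)" for f :: "nat \<Rightarrow> nat"
      have finP: "finite P" unfolding P_def by (intro finite_PiE) auto
      have cardP: "card P = 4 ^ m" by (simp add: P_def card_PiE)
      have Gmono: "G j \<le> G i" if "i \<le> j" for i j
        unfolding G_def using that m assms by (intro powr_mono2') auto
      have "real (card P) \<le> 2 ^ (k - 1) * (2 ^ m * real 4 powr (real m / 4))"
      proof (rule covers_card_le[OF cov finP, of X])
        show "X ` P \<subseteq> lball s a n"
        proof (intro image_subsetI)
          fix f assume f: "f \<in> P"
          have f3: "f t \<le> 3" if "t < m" for t
          proof -
            have "f t \<in> {..<4}" using f that unfolding P_def by (intro PiE_mem[of f "{..<m}"]) auto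
            then show ?thesis by simp
          qed
          have r: "rearr (X f) i \<le> 3 * \<delta> * real (max m i) powr (- s)" if i: "1 \<le> i" "i \<le> n" for i
          proof -
            have "rearr (X f) i \<le> 3 * \<delta> * G (i - 1)"
            proof (rule rearr_le_antimono_bound)
              fix j assume "j < dim_vec (X f)"
              then have j: "j < n" by (simp add: X_def)
              have "real (f (j mod m)) \<le> 3" using f3[of "j mod m"] m by simp
              then have "\<delta> * real (f (j mod m)) * G j \<le> \<delta> * 3 * G j"
                using \<delta> by (intro mult_right_mono mult_left_mono) (auto simp: G_def)
              then show "\<bar>X f $ j\<bar> \<le> 3 * \<delta> * G j" using j \<delta> by (simp add: X_def G_def abs_mult ac_simps)
            next
              fix i j :: nat assume "i \<le> j"
              then show "3 * \<delta> * G j \<le> 3 * \<delta> * G i" using Gmono \<delta> by (intro mult_left_mono) auto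
            qed (use i in \<open>auto simp: X_def\<close>)
            then show ?thesis using i by (simp add: G_def)
          qed
          have "lnorm s a (X f) \<le> 1"
          proof (cases "a = 0")
            case True
            have "real i powr s * rearr (X f) i \<le> 1" if i: "1 \<le> i" "i \<le> n" for i
            proof -
              have "real i powr s * rearr (X f) i \<le> real i powr s * (3 * \<delta> * real (max m i) powr (- s))"
                by (intro mult_left_mono r i) auto
              also have "\<dots> \<le> real i powr s * (1 * real i powr (- s))"
                using True C \<Lambda> i assms by (intro mult_left_mono mult_mono powr_mono2') (auto simp: \<delta>_def)
              also have "\<dots> = 1" using i by (simp flip: powr_add)
              finally show ?thesis .
            qed
            then show ?thesis using True n1 by (subst True, subst lnorm_0_le_iff) (auto simp: X_def)
          next
            case False
            then have a: "a > 0" using assms by simp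
            let ?d = "(3 * \<delta>) powr (1 / a)"
            have summand_le: "real i powr (s / a - 1) * rearr (X f) i powr (1 / a)
                \<le> ?d * (real i powr (s / a - 1) * real (max m i) powr (- (s / a)))" if i: "1 \<le> i" "i \<le> n" for i
            proof -
              have "rearr (X f) i powr (1 / a) \<le> (3 * \<delta> * real (max m i) powr (- s)) powr (1 / a)"
                using r[OF i] i a by (intro powr_mono2) (auto intro!: rearr_nonneg simp: X_def)
              also have "\<dots> = ?d * real (max m i) powr (- (s / a))" by (simp add: powr_mult powr_powr)
              finally have "real i powr (s / a - 1) * rearr (X f) i powr (1 / a) \<le> real i powr (s / a - 1) * (?d * real (max m i) powr (- (s / a)))"
                by (intro mult_left_mono) auto
              then show ?thesis by (simp add: ac_simps)
            qed
            have "(\<Sum>i = 1..n. real i powr (s / a - 1) * rearr (X f) i powr (1 / a))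
              \<le> (\<Sum>i = 1..n. ?d * (real i powr (s / a - 1) * real (max m i) powr (- (s / a))))"
              by (intro sum_mono summand_le) auto
            also have "\<dots> = ?d * (\<Sum>i = 1..n. real i powr (s / a - 1) * real (max m i) powr (- (s / a)))"
              by (simp only: sum_distrib_left)
            also have "(\<Sum>i = 1..n. real i powr (s / a - 1) * real (max m i) powr (- (s / a)))
              = (\<Sum>i = 1..m. real i powr (s / a - 1) * real (max m i) powr (- (s / a)))
               + (\<Sum>i = Suc m..n. real i powr (s / a - 1) * real (max m i) powr (- (s / a)))"
              by (rule sum_atLeastAtMost_split[OF n1(2)])
            also have "(\<Sum>i = 1..m. real i powr (s / a - 1) * real (max m i) powr (- (s / a)))
              = (\<Sum>i = 1..m. real i powr (s / a - 1)) * real m powr (- (s / a))"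
              unfolding sum_distrib_right by (intro sum.cong) (auto simp: max_def)
            also have "(\<Sum>i = Suc m..n. real i powr (s / a - 1) * real (max m i) powr (- (s / a))) = (\<Sum>i = Suc m..n. real i powr (- 1))"
              by (intro sum.cong) (auto simp: max_def simp flip: powr_add)
            also have "?d * ((\<Sum>i = 1..m. real i powr (s / a - 1)) * real m powr (- (s / a)) + (\<Sum>i = Suc m..n. real i powr (- 1)))
               \<le> ?d * (C * real m powr (s / a) * real m powr (- (s / a)) + ln (real n / real m))"
              using C(2)[OF a m] sum_tail_inverse_le[OF m n1(2)] by (intro mult_left_mono add_mono mult_right_mono) auto
            also have "C * real m powr (s / a) * real m powr (- (s / a)) = C" using m by (simp flip: powr_add)
            also have "?d * (C + ln (real n / real m)) \<le> ?d * (C * \<Lambda>)"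
            proof (rule mult_left_mono)
              have "1 * ln (real n / real m) \<le> C * ln (real n / real m)" using C lnm0 by (intro mult_right_mono) auto
              then show "C + ln (real n / real m) \<le> C * \<Lambda>" by (simp add: \<Lambda>_def algebra_simps)
            qed auto
            also have "?d = (C * \<Lambda>) powr (- 1)" using a by (simp add: \<delta>_def powr_powr)
            also have "(C * \<Lambda>) powr (- 1) * (C * \<Lambda>) = 1"
            proof -
              have "0 < C * \<Lambda>" using C \<Lambda> by simp
              then have "(C * \<Lambda>) powr (- 1) = inverse (C * \<Lambda>)" by (simp only: powr_minus powr_one less_imp_le)
              then show ?thesis using \<open>0 < C * \<Lambda>\<close> by (metis left_inverse less_irrefl)
            qed
            finally show ?thesis using a by (subst lnorm_le_iff) (auto simp: X_def)
          qed
          then show "X f \<in> lball s a n" by (simp add: lball_def X_def)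
        qed
      next
        fix f assume f: "f \<in> P"
        have "{g \<in> P. \<exists>w\<in>lball s b n. \<exists>w'\<in>lball s b n. X f - X g = \<epsilon> \<cdot>\<^sub>v (w - w')}
          \<subseteq> {g \<in> P. 4 * hamming m f g \<le> m}"
        proof (safe, rule ccontr)
          fix g w w' assume g: "g \<in> P" and w: "w \<in> lball s b n" "w' \<in> lball s b n" "X f - X g = \<epsilon> \<cdot>\<^sub>v (w - w')"
            and far: "\<not> 4 * hamming m f g \<le> m"
          have dw: "dim_vec w = n" "dim_vec w' = n" using w by (auto simp: lball_def)
          let ?D = "{t \<in> {..<m}. f t \<noteq> g t}"
          define \<sigma> where "\<sigma> = \<delta> * 9 powr (- s) / (2 * \<epsilon>)"
          have \<sigma>: "\<sigma> > 0" using \<delta> \<epsilon> by (simp add: \<sigma>_def)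
          have large: "\<sigma> * real i powr (- s) \<le> rearr w i \<or> \<sigma> * real i powr (- s) \<le> rearr w' i"
            if i: "m \<le> i" "9 * i \<le> n" for i
          proof -
            \<comment> \<open>These \<open>q\<close> full periods cover between \<open>8 * i\<close>
              and \<open>9 * i\<close> coordinates, by \<open>m \<le> i\<close>, and each contains
              more than \<open>m / 4\<close> disagreements: at least \<open>2 * i\<close> in all,
              where the envelope is at least \<open>(9 * i) powr (- s)\<close>. Half of them go to
              one of \<open>w\<close>, \<open>w'\<close>.\<close>
            define q where "q = 8 * i div m + 1"
            have q: "8 * i \<le> q * m" "q * m \<le> 9 * i"
            proof -
              have "(8 * i div m) * m + 8 * i mod m = 8 * i" by (rule div_mult_mod_eq)
              moreover have "8 * i mod m < m" using m by simp
              moreover have "q * m = (8 * i div m) * m + m" by (simp add: q_def)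
              ultimately show "8 * i \<le> q * m" "q * m \<le> 9 * i" using i by linarith+
            qed
            define J where "J = (\<lambda>(t, l). l * m + t) ` (?D \<times> {..<q})"
            have "inj_on (\<lambda>(t, l). l * m + t) (?D \<times> {..<q})"
              by (rule inj_on_inverseI[where g = "\<lambda>j. (j mod m, j div m)"]) auto
            then have cJ: "card J = card ?D * q" by (simp add: J_def card_image card_cartesian_product)
            have "2 * i * 4 \<le> m * q" using q by (simp add: mult.commute)
            also have "\<dots> \<le> (4 * card ?D) * q" using far by (intro mult_right_mono) auto
            finally have i2: "2 * i \<le> card J" by (simp add: cJ mult.commute)
            have ltJ: "j < q * m" if "j \<in> J" for j
            proof -
              obtain t l where "t < m" "l < q" "j = l * m + t" using \<open>j \<in> J\<close> by (auto simp: J_def)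
              then have "j < (l + 1) * m" by simp
              also have "\<dots> \<le> q * m" using \<open>l < q\<close> by (intro mult_right_mono) auto
              finally show ?thesis .
            qed
            show ?thesis
            proof (rule rearr_ge_of_diff[OF dw])
              show "J \<subseteq> {..<n}" using ltJ q i by fastforce
              show "2 * i \<le> card J + 1" using i2 by simp
              show "1 \<le> i" using i m by simp
            next
              fix j assume j: "j \<in> J"
              then obtain t l where t: "t < m" "f t \<noteq> g t" "j = l * m + t" by (auto simp: J_def)
              have jn: "j < n" "j + 1 \<le> 9 * i" using ltJ[OF j] q i by linarith+
              have jm: "j mod m = t" using t by simp
              have "(9 * real i) powr (- s) \<le> G j"
                unfolding G_def using jn i assms m by (intro powr_mono2') auto
              then have G: "9 powr (- s) * real i powr (- s) \<le> G j" by (simp add: powr_mult)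
              have "\<epsilon> * (w $ j - w' $ j) = (X f - X g) $ j" using jn dw w(3) by simp
              also have "\<dots> = \<delta> * G j * (real (f t) - real (g t))" using jn jm by (simp add: X_def algebra_simps)
              finally have "\<epsilon> * \<bar>w $ j - w' $ j\<bar> = \<delta> * G j * \<bar>real (f t) - real (g t)\<bar>"
                using \<epsilon> \<delta> by (metis G_def abs_mult abs_of_pos less_eq_real_def abs_of_nonneg mult_nonneg_nonneg powr_ge_zero)
              also have "\<dots> \<ge> \<delta> * G j * 1" using t(2) \<delta> by (intro mult_left_mono) (auto simp: G_def)
              finally have "\<delta> * G j \<le> \<epsilon> * \<bar>w $ j - w' $ j\<bar>" by simp
              moreover have "\<delta> * (9 powr (- s) * real i powr (- s)) \<le> \<delta> * G j" using G \<delta> by simp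
              ultimately have "\<delta> * (9 powr (- s) * real i powr (- s)) \<le> \<epsilon> * \<bar>w $ j - w' $ j\<bar>" by simp
              then show "2 * (\<sigma> * real i powr (- s)) \<le> \<bar>w $ j - w' $ j\<bar>" using \<epsilon> by (simp add: \<sigma>_def field_simps)
            qed
          qed
          define N where "N = n div 9"
          have N: "m \<le> N" "N \<le> n" using mn by (auto simp: N_def)
          let ?S = "\<lambda>v. \<Sum>i = 1..n. lterm s b v i"
          have S: "?S w \<le> 1" "?S w' \<le> 1"
            using w dw lnorm_le_iff[OF b, of 1 s w] lnorm_le_iff[OF b, of 1 s w'] by (auto simp: lball_def)
          \<comment> \<open>The weight \<open>i powr (s / b - 1)\<close> cancels the decay
            \<open>i powr (- s)\<close> up to \<open>1 / i\<close>, so all ranks from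
            \<open>m\<close> to \<open>n div 9\<close> add up to a harmonic sum. Which of
            \<open>w\<close>, \<open>w'\<close> is large may depend on \<open>i\<close>, hence both
            unit-ball sums are added and the bound is 2.\<close>
          have "\<sigma> powr (1 / b) * (\<Sum>i = m..N. real i powr (- 1)) = (\<Sum>i = m..N. real i powr (s / b - 1) * (\<sigma> * real i powr (- s)) powr (1 / b))"
            unfolding sum_distrib_left
          proof (rule sum.cong[OF refl])
            fix i assume "i \<in> {m..N}"
            then have i: "i \<ge> 1" using m by simp
            have "real i powr (s / b - 1) * (\<sigma> * real i powr (- s)) powr (1 / b)
              = \<sigma> powr (1 / b) * (real i powr (s / b - 1) * real i powr (- (s / b)))"
              by (simp add: powr_mult powr_powr)
            also have "real i powr (s / b - 1) * real i powr (- (s / b)) = real i powr (- 1)" by (simp flip: powr_add)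
            finally show "\<sigma> powr (1 / b) * real i powr (- 1) = real i powr (s / b - 1) * (\<sigma> * real i powr (- s)) powr (1 / b)" by simp
          qed
          also have "\<dots> \<le> (\<Sum>i = m..N. lterm s b w i + lterm s b w' i)"
          proof (rule sum_mono)
            fix i assume i: "i \<in> {m..N}"
            then have i': "m \<le> i" "9 * i \<le> n" by (auto simp: N_def)
            have "(\<sigma> * real i powr (- s)) powr (1 / b) \<le> rearr w i powr (1 / b) + rearr w' i powr (1 / b)"
            proof (cases "\<sigma> * real i powr (- s) \<le> rearr w i")
              case True
              then have "(\<sigma> * real i powr (- s)) powr (1 / b) \<le> rearr w i powr (1 / b)" using b \<sigma> by (intro powr_mono2) auto
              then show ?thesis using powr_ge_zero[of "rearr w' i" "1 / b"] by linarith
            next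
              case False
              then have "\<sigma> * real i powr (- s) \<le> rearr w' i" using large[OF i'] by simp
              then have "(\<sigma> * real i powr (- s)) powr (1 / b) \<le> rearr w' i powr (1 / b)" using b \<sigma> by (intro powr_mono2) auto
              then show ?thesis using powr_ge_zero[of "rearr w i" "1 / b"] by linarith
            qed
            then have "real i powr (s / b - 1) * (\<sigma> * real i powr (- s)) powr (1 / b) \<le> real i powr (s / b - 1) * (rearr w i powr (1 / b) + rearr w' i powr (1 / b))"
              by (intro mult_left_mono) auto
            then show "real i powr (s / b - 1) * (\<sigma> * real i powr (- s)) powr (1 / b)
              \<le> lterm s b w i + lterm s b w' i"
              by (simp add: distrib_left)
          qed
          also have "\<dots> \<le> (\<Sum>i = 1..n. lterm s b w i + lterm s b w' i)"
            using N m by (intro sum_mono2) auto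
          also have "\<dots> = ?S w + ?S w'" by (rule sum.distrib)
          also have "\<dots> \<le> 2" using S by simp
          finally have le2: "\<sigma> powr (1 / b) * (\<Sum>i = m..N. real i powr (- 1)) \<le> 2" .
          have "ln (real n / (9 * real m)) \<le> (\<Sum>i = m..N. real i powr (- 1))"
          proof -
            have tel: "ln (real (Suc N') / real m) \<le> (\<Sum>i = m..N'. real i powr (- 1))" if "m \<le> N'" for N'
              using that
            proof (induction N' rule: dec_induct)
              case base
              have "ln (real (Suc m) / real m) \<le> real (Suc m) / real m - 1" using m by (intro ln_le_minus_one) auto
              also have "\<dots> = real m powr (- 1)" using m by (simp add: powr_minus field_simps)
              finally show ?case by simp
            next
              case (step N')
              have "ln (real (Suc (Suc N')) / real (Suc N')) \<le> real (Suc (Suc N')) / real (Suc N') - 1" by (intro ln_le_minus_one) auto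
              also have "\<dots> = real (Suc N') powr (- 1)" by (simp add: powr_minus field_simps)
              finally have "ln (real (Suc (Suc N'))) - ln (real (Suc N')) \<le> real (Suc N') powr (- 1)" by (simp add: ln_div)
              then show ?case using step m by (simp add: ln_div)
            qed
            have "ln (real n / (9 * real m)) \<le> ln (real (Suc N) / real m)"
            proof (rule ln_mono)
              have "n \<le> 9 * Suc N" unfolding N_def by simp
              then have "real n \<le> 9 * real (Suc N)" by linarith
              then show "real n / (9 * real m) \<le> real (Suc N) / real m" using m by (simp add: field_simps)
            qed (use n1 m in auto)
            then show ?thesis using tel[OF N(1)] by linarith
          qed
          then have "\<sigma> powr (1 / b) * (\<Lambda> / 2) \<le> \<sigma> powr (1 / b) * (\<Sum>i = m..N. real i powr (- 1))"
            using ln9m by (intro mult_left_mono) auto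
          then have "\<sigma> powr (1 / b) * (\<Lambda> / 4) \<le> 1" using le2 by simp
          then have "(\<sigma> powr (1 / b) * (\<Lambda> / 4)) powr b \<le> 1 powr b" using b \<Lambda> by (intro powr_mono2) auto
          then have "(\<sigma> powr (1 / b)) powr b * (\<Lambda> / 4) powr b \<le> 1" by (simp only: powr_mult powr_one_eq_one)
          then have "\<sigma> * (\<Lambda> / 4) powr b \<le> 1" using b \<sigma> by (simp add: powr_powr)
          then have "\<delta> * 9 powr (- s) * (\<Lambda> / 4) powr b / 2 \<le> \<epsilon>" using \<epsilon> by (simp add: \<sigma>_def field_simps)
          moreover have "\<delta> * 9 powr (- s) * (\<Lambda> / 4) powr b / 2 = c0 * \<Lambda> powr (b - a)"
          proof -
            have "(\<Lambda> / 4) powr b = (1 / 4) powr b * \<Lambda> powr b" by (simp add: powr_mult flip: powr_mult)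
            moreover have "(C * \<Lambda>) powr (- a) = C powr (- a) * \<Lambda> powr (- a)" by (rule powr_mult)
            moreover have "\<Lambda> powr (b - a) = \<Lambda> powr (- a) * \<Lambda> powr b" by (simp flip: powr_add)
            ultimately show ?thesis unfolding \<delta>_def c0_def by (simp only:) (simp add: ac_simps)
          qed
          ultimately show False using \<epsilon> by simp
        qed
        then have "real (card {g \<in> P. \<exists>w\<in>lball s b n. \<exists>w'\<in>lball s b n. X f - X g = \<epsilon> \<cdot>\<^sub>v (w - w')})
          \<le> real (card {g \<in> P. 4 * hamming m f g \<le> m})"
          using finP by (intro of_nat_mono card_mono) auto
        also have "\<dots> \<le> 2 ^ m * real 4 powr (real m / 4)" unfolding P_def by (rule card_hamming_ball_le) simp
        finally show "real (card {g \<in> P. \<exists>w\<in>lball s b n. \<exists>w'\<in>lball s b n. X f - X g = \<epsilon> \<cdot>\<^sub>v (w - w')})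
          \<le> 2 ^ m * real 4 powr (real m / 4)" .
      qed simp
      moreover have "real 4 powr (real m / 4) = 2 ^ k"
      proof -
        have "real 4 powr (real m / 4) = (2 powr 2) powr (real m / 4)" by simp
        also have "\<dots> = 2 powr real k" by (simp only: powr_powr) (simp add: m_def)
        finally show ?thesis by (simp add: powr_realpow)
      qed
      ultimately have "(4::real) ^ m \<le> 2 ^ (k - 1) * (2 ^ m * 2 ^ k)" by (simp add: cardP)
      also have "\<dots> = 2 ^ (4 * k - 1)" using k by (simp add: m_def flip: power_add)
      also have "\<dots> < 2 ^ (4 * k)" using k by (intro power_strict_increasing) auto
      also have "\<dots> = 4 ^ m" by (simp add: m_def power_mult)
      finally show False by simp
    qed
    have "ln (real n / real k + 1) \<le> 2 * \<Lambda>"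
    proof -
      have "real k \<le> real n" using n1 m by (simp add: m_def)
      then have "real n / real k + 1 \<le> 4 * (real n / real m)" using k by (simp add: m_def field_simps)
      then have "ln (real n / real k + 1) \<le> ln (4 * (real n / real m))" using n1 by (intro ln_mono) (auto simp: add_nonneg_pos)
      also have "\<dots> = ln 4 + ln (real n / real m)" using n1 m by (subst ln_mult) auto
      finally have "ln (real n / real k + 1) \<le> ln 4 + ln (real n / real m)" .
      moreover have "ln 4 \<le> (ln 9 :: real)" by (intro ln_mono) auto
      moreover have "x \<le> 2 * (1 + z)" if "x \<le> y + z" "y \<le> v" "2 * v + 2 \<le> z" "0 < v" for x y z v :: real
        using that by simp
      ultimately show ?thesis unfolding \<Lambda>_def using lnm l9 by blast
    qed
    then have "(1 / 2) * ln (real n / real k + 1) \<le> \<Lambda>" by simp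
    then have "((1 / 2) * ln (real n / real k + 1)) powr (b - a) \<le> \<Lambda> powr (b - a)"
      using assms by (intro powr_mono2) auto
    then have "c0 * ((1 / 2) powr (b - a) * ln (real n / real k + 1) powr (b - a)) \<le> c0 * \<Lambda> powr (b - a)"
      using c0 by (simp only: powr_mult mult_le_cancel_left_pos)
    then show "c0 * (1 / 2) powr (b - a) * ln (real n / real k + 1) powr (b - a) \<le> ent s a s b n k"
      using main by simp
  qed (use c0 K in auto)
qed

section \<open>Norm estimates\<close>

text \<open>Summed over \<open>x = x\<^sub>i\<close> with weights and a suitable \<open>T\<close>, this replaces Hoelder's inequality.\<close>

lemma powr_split_at:
  fixes x T \<alpha> \<beta> :: real
  assumes "0 \<le> x" "0 < T" "0 < \<beta>" "\<beta> \<le> \<alpha>"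
  shows "x powr \<beta> \<le> T powr \<beta> + T powr (\<beta> - \<alpha>) * x powr \<alpha>"
proof (cases "x \<le> T")
  case True
  then have "x powr \<beta> \<le> T powr \<beta>" using assms by (intro powr_mono2) auto
  then show ?thesis by (simp add: add_increasing2)
next
  case False
  have "x powr \<beta> = x powr (\<beta> - \<alpha>) * x powr \<alpha>" by (simp flip: powr_add)
  also have "\<dots> \<le> T powr (\<beta> - \<alpha>) * x powr \<alpha>"
    using False assms by (intro mult_right_mono powr_mono2') auto
  finally show ?thesis by (simp add: add_increasing)
qed

lemma powr_le_psi:
  assumes "0 \<le> t" "0 \<le> b"
  obtains C where "C > 0" "\<And>m::nat. 1 \<le> m \<Longrightarrow> real m powr t \<le> C * psi t b m"
proof (cases "t = 0")
  case False
  show ?thesis by (rule that[of 1]) (use False in \<open>auto simp: psi_def\<close>)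
next
  case True
  have l2: "ln 2 > (0::real)" by simp
  show ?thesis
  proof (rule that[of "(1 / ln 2) powr b"])
    fix m :: nat assume m: "1 \<le> m"
    have "ln 2 \<le> ln (real m + 1)" using m by (intro ln_mono) auto
    then have "1 powr b \<le> ((1 / ln 2) * ln (real m + 1)) powr b"
      using assms l2 by (intro powr_mono2) (auto simp: field_simps)
    then show "real m powr t \<le> (1 / ln 2) powr b * psi t b m" using True m by (simp only: powr_mult) (simp add: psi_def)
  qed auto
qed

text \<open>\<open>id_large\<close>: the identity is largest on flat vectors with full support (roughly, \<open>p \<ge> q\<close>).
  \<open>id_decay\<close>: the identity maps vectors truncated at the level \<open>1 / psi m\<close> of a flat unit vector with support
  size \<open>m\<close> to vectors no longer than that flat vector (roughly, \<open>p \<le> q\<close>).\<close>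

definition id_large :: "real \<Rightarrow> real \<Rightarrow> real \<Rightarrow> real \<Rightarrow> bool" where
  "id_large s a t b \<longleftrightarrow> (\<exists>C>0. \<forall>n\<ge>1. \<forall>x\<in>lball s a n. lnorm t b x \<le> C * (psi t b n / psi s a n))"

definition id_decay :: "real \<Rightarrow> real \<Rightarrow> real \<Rightarrow> real \<Rightarrow> bool" where
  "id_decay s a t b \<longleftrightarrow> (\<forall>\<delta>>0. \<exists>C>0. \<forall>n m x y. 1 \<le> m \<and> m \<le> n \<and> x \<in> lball s a n \<and> y \<in> carrier_vec n \<and>
     (\<forall>i. 1 \<le> i \<and> i \<le> n \<longrightarrow> rearr y i \<le> rearr x i \<and> rearr y i \<le> \<delta> / psi s a m) \<longrightarrow>
     lnorm t b y \<le> C * (psi t b m / psi s a m))"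

section \<open>Embeddings that are extremal at full support\<close>

lemma id_large_if_less:
  assumes "0 \<le> s" "0 \<le> a" "s < t" "0 \<le> b"
  shows "id_large s a t b"
proof -
  obtain C1 where C1: "C1 > 0" "\<And>n x i. x \<in> lball s a n \<Longrightarrow> 1 \<le> i \<Longrightarrow> i \<le> n \<Longrightarrow> rearr x i \<le> C1 / psi s a i"
    using rearr_le_psi[OF assms(1,2)] by blast
  \<comment> \<open>A strictly intermediate exponent leaves room on both sides:
    \<open>s < s'\<close> bounds the \<open>i\<close>-th largest entry by a multiple of
    \<open>(n / i) powr s' / psi n\<close>, and \<open>s' < t\<close> makes the weighted sum a
    positive power of \<open>n\<close>.\<close>
  define s' where "s' = (s + t) / 2"
  have s': "s < s'" "s' < t" "0 < s'" using assms by (simp_all add: s'_def)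
  obtain c where c: "0 < c" "\<And>x y. 1 / 2 \<le> x \<Longrightarrow> x \<le> y \<Longrightarrow> c * (x / y) powr s' * psi s a y \<le> psi s a x"
    using psi_ratio[OF assms(1,2) s'(1)] by blast
  have t: "psi t b n = real n powr t" for n :: nat using assms by (simp add: psi_def)
  have r: "rearr x i \<le> C1 / c / psi s a n * real n powr s' * real i powr (- s')"
    if x: "x \<in> lball s a n" and i: "1 \<le> i" "i \<le> n" for x n i
  proof -
    have "rearr x i \<le> C1 / psi s a i" by (rule C1(2)[OF x i])
    also have "\<dots> \<le> C1 / (c * (real i / real n) powr s' * psi s a n)"
      using c C1 i psi_pos[of i s a] psi_pos[of n s a] by (intro divide_left_mono c(2) mult_pos_pos) auto
    also have "\<dots> = C1 / c / psi s a n * real n powr s' * real i powr (- s')"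
      using i by (simp add: powr_divide powr_minus_divide)
    finally show ?thesis .
  qed
  show ?thesis
  proof (cases "b = 0")
    case True
    show ?thesis unfolding id_large_def
    proof (intro exI[of _ "C1 / c"] conjI allI impI ballI)
      fix n x assume n: "1 \<le> (n::nat)" and x: "x \<in> lball s a n"
      then have dn: "dim_vec x = n" by (auto simp: lball_def)
      have pn: "psi s a n > 0" using n by (simp add: psi_pos)
      have "real i powr t * rearr x i \<le> C1 / c * (real n powr t / psi s a n)" if i: "1 \<le> i" "i \<le> n" for i
      proof -
        have "real i powr t * rearr x i \<le> real i powr t * (C1 / c / psi s a n * real n powr s' * real i powr (- s'))"
          by (intro mult_left_mono r x i) auto
        also have "\<dots> = C1 / c / psi s a n * real n powr s' * real i powr (t - s')"
          by (simp add: powr_diff powr_minus_divide)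
        also have "\<dots> \<le> C1 / c / psi s a n * real n powr s' * real n powr (t - s')"
          using i s' C1 c pn by (intro mult_left_mono powr_mono2) auto
        also have "\<dots> = C1 / c / psi s a n * (real n powr s' * real n powr (t - s'))" by simp
        also have "real n powr s' * real n powr (t - s') = real n powr t" by (simp flip: powr_add)
        finally show ?thesis by simp
      qed
      then show "lnorm t b x \<le> C1 / c * (psi t b n / psi s a n)"
        unfolding t unfolding True using n dn by (subst lnorm_0_le_iff) auto
    qed (use C1 c in auto)
  next
    case False
    then have b: "b > 0" using assms by simp
    then obtain C where C: "C > 0" "\<And>m::nat. (\<Sum>i = 1..m. real i powr ((t - s') / b - 1)) \<le> C * real m powr ((t - s') / b)"
      using sum_powr_le[of "(t - s') / b"] s' by auto
    show ?thesis unfolding id_large_def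
    proof (intro exI[of _ "C powr b * (C1 / c)"] conjI allI impI ballI)
      fix n x assume n: "1 \<le> (n::nat)" and x: "x \<in> lball s a n"
      then have dn: "dim_vec x = n" by (auto simp: lball_def)
      have pn: "psi s a n > 0" using n by (simp add: psi_pos)
      define \<kappa> where "\<kappa> = C1 / c / psi s a n * real n powr s'"
      have \<kappa>: "\<kappa> > 0" using C1 c pn n by (simp add: \<kappa>_def)
      have "(\<Sum>i = 1..n. lterm t b x i) \<le> (\<Sum>i = 1..n. \<kappa> powr (1 / b) * real i powr ((t - s') / b - 1))"
      proof (rule sum_mono)
        fix i assume i: "i \<in> {1..n}"
        have "rearr x i powr (1 / b) \<le> (\<kappa> * real i powr (- s')) powr (1 / b)"
          using r[OF x] i dn b by (intro powr_mono2) (auto simp: \<kappa>_def intro: rearr_nonneg)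
        also have "\<dots> = \<kappa> powr (1 / b) * real i powr (- (s' / b))" by (simp add: powr_mult powr_powr)
        finally have "lterm t b x i \<le> real i powr (t / b - 1) * (\<kappa> powr (1 / b) * real i powr (- (s' / b)))"
          by (intro mult_left_mono) auto
        also have "\<dots> = \<kappa> powr (1 / b) * (real i powr (t / b - 1) * real i powr (- (s' / b)))" by simp
        also have "real i powr (t / b - 1) * real i powr (- (s' / b)) = real i powr ((t - s') / b - 1)"
          unfolding powr_add[symmetric] by (rule arg_cong[of _ _ "\<lambda>z. real i powr z"]) (simp add: diff_divide_distrib)
        finally show "lterm t b x i \<le> \<kappa> powr (1 / b) * real i powr ((t - s') / b - 1)" .
      qed
      also have "\<dots> \<le> \<kappa> powr (1 / b) * (C * real n powr ((t - s') / b))"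
        unfolding sum_distrib_left[symmetric] by (intro mult_left_mono C(2)) auto
      also have "\<dots> = (C powr b * (C1 / c) * (real n powr t / psi s a n)) powr (1 / b)"
      proof -
        have "C powr b * (C1 / c) * (real n powr t / psi s a n) = C powr b * (\<kappa> * real n powr (t - s'))"
          using n by (simp add: \<kappa>_def powr_diff)
        moreover have "(C powr b * (\<kappa> * real n powr (t - s'))) powr (1 / b) = C * (\<kappa> powr (1 / b) * real n powr ((t - s') / b))"
          using b C by (simp only: powr_mult powr_powr) simp
        ultimately show ?thesis by simp
      qed
      finally show "lnorm t b x \<le> C powr b * (C1 / c) * (psi t b n / psi s a n)"
        unfolding t using b n dn C C1 c pn by (subst lnorm_le_iff) auto
    qed (use C C1 c in auto)
  qed
qed

lemma sum_ball_le_1: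
  assumes "0 < a" "x \<in> lball s a n"
  shows "(\<Sum>i = 1..n. lterm s a x i) \<le> 1"
  using assms lnorm_le_iff[of a 1 s x] by (auto simp: lball_def)

text \<open>Nesting of Lorentz spaces in the second index: \<open>lterm s b x i\<close> is
  \<open>lterm s a x i\<close> times a nonnegative power of \<open>i powr s * rearr x i\<close>,
  which the weak-type bound controls.\<close>

lemma id_large_same_s:
  assumes "0 < s" "0 \<le> b" "b \<le> a"
  shows "id_large s a s b"
proof -
  have a0: "0 \<le> a" using assms by simp
  obtain C1 where C1: "C1 > 0" "\<And>n x i. x \<in> lball s a n \<Longrightarrow> 1 \<le> i \<Longrightarrow> i \<le> n \<Longrightarrow> rearr x i \<le> C1 / psi s a i"
    using rearr_le_psi[of s a] assms by auto
  have eq: "psi s b n / psi s a n = 1" if "1 \<le> n" for n :: nat using assms that by (simp add: psi_def)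
  have z: "real i powr s * rearr x i \<le> C1" if "x \<in> lball s a n" "1 \<le> i" "i \<le> n" for x n i
    using C1(2)[OF that] that assms by (simp add: psi_def field_simps)
  show ?thesis
  proof (cases "b = 0")
    case True
    show ?thesis unfolding id_large_def
    proof (intro exI[of _ C1] conjI allI impI ballI)
      fix n x assume n: "1 \<le> (n::nat)" and x: "x \<in> lball s a n"
      then have dn: "dim_vec x = n" by (auto simp: lball_def)
      show "lnorm s b x \<le> C1 * (psi s b n / psi s a n)"
        unfolding eq[OF n] unfolding True using z[OF x] n dn by (subst lnorm_0_le_iff) auto
    qed (rule C1)
  next
    case False
    then have b: "b > 0" and a: "a > 0" using assms by simp_all
    show ?thesis unfolding id_large_def
    proof (intro exI[of _ "(C1 powr (1 / b - 1 / a)) powr b"] conjI allI impI ballI)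
      fix n x assume n: "1 \<le> (n::nat)" and x: "x \<in> lball s a n"
      then have dn: "dim_vec x = n" by (auto simp: lball_def)
      have "(\<Sum>i = 1..n. lterm s b x i) \<le> (\<Sum>i = 1..n. C1 powr (1 / b - 1 / a) * (lterm s a x i))"
      proof (rule sum_mono)
        fix i assume i: "i \<in> {1..n}"
        then have xi: "0 \<le> rearr x i" using dn by (auto intro: rearr_nonneg)
        have "lterm s b x i
          = (real i powr s * rearr x i) powr (1 / b - 1 / a) * (lterm s a x i)"
        proof -
          have "(real i powr s * rearr x i) powr (1 / b - 1 / a) * (lterm s a x i)
            = (real i powr (s * (1 / b - 1 / a)) * real i powr (s / a - 1)) * (rearr x i powr (1 / b - 1 / a) * rearr x i powr (1 / a))"
            by (simp add: powr_mult powr_powr)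
          also have "\<dots> = real i powr (s * (1 / b - 1 / a) + (s / a - 1)) * rearr x i powr (1 / b - 1 / a + 1 / a)"
            by (simp only: powr_add)
          also have "s * (1 / b - 1 / a) + (s / a - 1) = s / b - 1" by (simp add: algebra_simps)
          finally show ?thesis by simp
        qed
        also have "\<dots> \<le> C1 powr (1 / b - 1 / a) * (lterm s a x i)"
          using i xi z[OF x] assms a b by (intro mult_right_mono powr_mono2) (auto simp: field_simps)
        finally show "lterm s b x i \<le> C1 powr (1 / b - 1 / a) * (lterm s a x i)" .
      qed
      also have "\<dots> \<le> C1 powr (1 / b - 1 / a) * 1"
        unfolding sum_distrib_left[symmetric] by (intro mult_left_mono sum_ball_le_1 a x) auto
      finally show "lnorm s b x \<le> (C1 powr (1 / b - 1 / a)) powr b * (psi s b n / psi s a n)"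
        unfolding eq[OF n] using b dn by (subst lnorm_le_iff) (auto simp: powr_powr)
    qed (use C1 in auto)
  qed
qed

text \<open>The weights \<open>1 / i\<close> have total mass of order \<open>l = ln (n + 1)\<close>.
  For \<open>a > 0\<close> the split at \<open>T = l powr (- a)\<close>, the level of a flat unit
  vector with full support, balances the two terms at \<open>l powr (1 - a / b)\<close>; for
  \<open>a = 0\<close> the entries are bounded and the mass alone decides.\<close>

lemma id_large_0:
  assumes "0 \<le> a" "a \<le> b"
  shows "id_large 0 a 0 b"
proof -
  obtain C1 where C1: "C1 > 0" "\<And>n x i. x \<in> lball 0 a n \<Longrightarrow> 1 \<le> i \<Longrightarrow> i \<le> n \<Longrightarrow> rearr x i \<le> C1 / psi 0 a i"
    using rearr_le_psi[of 0 a] assms by auto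
  have eq: "psi 0 b n / psi 0 a n = ln (real n + 1) powr (b - a)" if "1 \<le> n" for n :: nat
    by (simp add: psi_def powr_diff)
  show ?thesis
  proof (cases "b = 0")
    case True
    then have a: "a = 0" using assms by simp
    show ?thesis unfolding id_large_def
      by (intro exI[of _ 1]) (auto simp: a True psi_def lball_def)
  next
    case False
    then have b: "b > 0" using assms by simp
    define D where "D = max 1 (C1 powr (1 / b))"
    show ?thesis unfolding id_large_def
    proof (intro exI[of _ "(3 * D) powr b"] conjI allI impI ballI)
      fix n x assume n: "1 \<le> (n::nat)" and x: "x \<in> lball 0 a n"
      then have dn: "dim_vec x = n" by (auto simp: lball_def)
      define l where "l = ln (real n + 1)"
      have l: "l > 0" using n by (simp add: l_def)
      have H: "(\<Sum>i = 1..n. real i powr (- 1)) \<le> 2 * l" using sum_inverse_le[of n] by (simp add: l_def)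
      have "(\<Sum>i = 1..n. lterm 0 b x i) \<le> 3 * D * l powr (1 - a / b)"
      proof (cases "a = 0")
        case True
        have "(\<Sum>i = 1..n. lterm 0 b x i) \<le> (\<Sum>i = 1..n. real i powr (- 1) * D)"
        proof (rule sum_mono)
          fix i assume i: "i \<in> {1..n}"
          have "psi 0 a i = 1" using True i by (simp add: psi_def)
          then have "rearr x i \<le> C1" using C1(2)[OF x, of i] i by auto
          then have "rearr x i powr (1 / b) \<le> C1 powr (1 / b)" using i b dn by (intro powr_mono2) (auto intro: rearr_nonneg)
          then have "rearr x i powr (1 / b) \<le> D" by (simp add: D_def)
          then have "real i powr (- 1) * rearr x i powr (1 / b) \<le> real i powr (- 1) * D"
            by (intro mult_left_mono) auto
          then show "lterm 0 b x i \<le> real i powr (- 1) * D" by simp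
        qed
        also have "\<dots> \<le> 2 * l * D" unfolding sum_distrib_right[symmetric] by (intro mult_right_mono H) (simp add: D_def)
        also have "\<dots> \<le> 3 * D * l" using l by (simp add: D_def)
        also have "l = l powr (1 - a / b)" using True l by simp
        finally show ?thesis .
      next
        case False
        then have a: "a > 0" using assms by simp
        define T where "T = l powr (- a)"
        have T: "T > 0" using l by (simp add: T_def)
        have ab: "1 / b \<le> 1 / a" using assms a b by (simp add: frac_le)
        have "(\<Sum>i = 1..n. lterm 0 b x i)
          \<le> (\<Sum>i = 1..n. real i powr (- 1) * T powr (1 / b) + T powr (1 / b - 1 / a) * (lterm 0 a x i))"
        proof (rule sum_mono)
          fix i assume i: "i \<in> {1..n}"
          have "rearr x i powr (1 / b) \<le> T powr (1 / b) + T powr (1 / b - 1 / a) * rearr x i powr (1 / a)"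
            using i dn b ab T by (intro powr_split_at) (auto intro: rearr_nonneg)
          then have "real i powr (- 1) * rearr x i powr (1 / b) \<le> real i powr (- 1) * (T powr (1 / b) + T powr (1 / b - 1 / a) * rearr x i powr (1 / a))"
            by (intro mult_left_mono) auto
          then show "lterm 0 b x i
            \<le> real i powr (- 1) * T powr (1 / b) + T powr (1 / b - 1 / a) * (lterm 0 a x i)"
            by (simp add: algebra_simps)
        qed
        also have "\<dots> = (\<Sum>i = 1..n. real i powr (- 1)) * T powr (1 / b) + T powr (1 / b - 1 / a) * (\<Sum>i = 1..n. lterm 0 a x i)"
          by (simp only: sum.distrib sum_distrib_left sum_distrib_right)
        also have "\<dots> \<le> 2 * l * T powr (1 / b) + T powr (1 / b - 1 / a) * 1"
          by (intro add_mono mult_right_mono mult_left_mono H sum_ball_le_1 a x) auto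
        also have "T powr (1 / b - 1 / a) = l powr (1 - a / b)"
          unfolding T_def powr_powr by (rule arg_cong[of _ _ "\<lambda>z. l powr z"]) (use a in \<open>simp add: right_diff_distrib\<close>)
        also have "2 * l * T powr (1 / b) = 2 * l powr (1 - a / b)"
        proof -
          have "T powr (1 / b) = l powr (- (a / b))" unfolding T_def powr_powr by simp
          then show ?thesis using l by (simp add: powr_diff powr_minus_divide)
        qed
        also have "2 * l powr (1 - a / b) + l powr (1 - a / b) * 1 = 3 * 1 * l powr (1 - a / b)" by simp
        also have "\<dots> \<le> 3 * D * l powr (1 - a / b)" by (intro mult_right_mono) (auto simp: D_def)
        finally show ?thesis .
      qed
      also have "\<dots> = ((3 * D) powr b * l powr (b - a)) powr (1 / b)"
      proof -
        have "(b - a) * (1 / b) = 1 - a / b" using b by (simp add: field_simps)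
        moreover have "D > 0" by (simp add: D_def less_max_iff_disj)
        ultimately show ?thesis using b by (simp only: powr_mult powr_powr) simp
      qed
      finally show "lnorm 0 b x \<le> (3 * D) powr b * (psi 0 b n / psi 0 a n)"
        unfolding eq[OF n] l_def[symmetric] using b dn by (subst lnorm_le_iff) auto
    qed (simp add: D_def less_max_iff_disj)
  qed
qed

text \<open>Up to \<open>m\<close> the truncation makes the vector no larger than a flat one; beyond
  \<open>m\<close> the weak-type decay \<open>i powr (- s)\<close> beats the weight because
  \<open>t < s\<close>. The tail is of order \<open>m powr t / psi s a m\<close>, and for
  \<open>t = 0\<close> \<open>powr_le_psi\<close> converts \<open>m powr t\<close> into the
  logarithmic \<open>psi\<close>.\<close>

lemma id_decay_if_less:
  assumes "0 \<le> t" "t < s" "0 \<le> a" "0 \<le> b"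
  shows "id_decay s a t b"
proof -
  obtain C1 where C1: "C1 > 0" "\<And>n x i. x \<in> lball s a n \<Longrightarrow> 1 \<le> i \<Longrightarrow> i \<le> n \<Longrightarrow> rearr x i \<le> C1 / psi s a i"
    using rearr_le_psi[of s a] assms by auto
  have psis: "psi s a m = real m powr s" for m :: nat using assms by (simp add: psi_def)
  obtain C2 where C2: "C2 > 0" "\<And>m::nat. 1 \<le> m \<Longrightarrow> real m powr t \<le> C2 * psi t b m"
    using powr_le_psi[OF assms(1,4)] by blast
  show ?thesis
  proof (cases "b = 0")
    case True
    show ?thesis unfolding id_decay_def
    proof (intro allI impI)
      fix \<delta> :: real assume \<delta>: "\<delta> > 0"
      show "\<exists>C>0. \<forall>n m x y. 1 \<le> m \<and> m \<le> n \<and> x \<in> lball s a n \<and> y \<in> carrier_vec n \<and>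
         (\<forall>i. 1 \<le> i \<and> i \<le> n \<longrightarrow> rearr y i \<le> rearr x i \<and> rearr y i \<le> \<delta> / psi s a m) \<longrightarrow>
         lnorm t b y \<le> C * (psi t b m / psi s a m)"
      proof (intro exI[of _ "max \<delta> C1"] conjI allI impI; (elim conjE)?)
        fix n m x y assume m: "1 \<le> (m::nat)" "m \<le> n" and x: "x \<in> lball s a n" and y: "y \<in> carrier_vec n"
          and yx: "\<forall>i. 1 \<le> i \<and> i \<le> n \<longrightarrow> rearr y i \<le> rearr x i \<and> rearr y i \<le> \<delta> / psi s a m"
        have "real i powr t * rearr y i \<le> max \<delta> C1 * (real m powr t / real m powr s)" if i: "1 \<le> i" "i \<le> n" for i
        proof (cases "i \<le> m")
          case True
          have "real i powr t * rearr y i \<le> real m powr t * (\<delta> / real m powr s)"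
            using yx i True assms y psis by (intro mult_mono powr_mono2) (auto intro: rearr_nonneg)
          also have "\<dots> = \<delta> * (real m powr t / real m powr s)" by simp
          also have "\<dots> \<le> max \<delta> C1 * (real m powr t / real m powr s)" by (intro mult_right_mono) auto
          finally show ?thesis .
        next
          case False
          have "rearr y i \<le> C1 / real i powr s" using yx i C1(2)[OF x i] psis[of i] by fastforce
          then have "real i powr t * rearr y i \<le> real i powr t * (C1 / real i powr s)" by (intro mult_left_mono) auto
          also have "\<dots> = C1 * real i powr (t - s)" by (simp add: powr_diff)
          also have "\<dots> \<le> C1 * real m powr (t - s)" using False m C1 assms by (intro mult_left_mono powr_mono2') auto
          also have "\<dots> = C1 * (real m powr t / real m powr s)" by (simp add: powr_diff)
          also have "\<dots> \<le> max \<delta> C1 * (real m powr t / real m powr s)" by (intro mult_right_mono) auto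
          finally show ?thesis .
        qed
        moreover have "psi t 0 m = real m powr t" using m by (auto simp: psi_def)
        ultimately show "lnorm t b y \<le> max \<delta> C1 * (psi t b m / psi s a m)"
          unfolding True using y m psis by (subst lnorm_0_le_iff) auto
      qed (use C1 in auto)
    qed
  next
    case False
    then have b: "b > 0" using assms by simp
    obtain Cw where Cw: "Cw > 0" "\<And>m::nat. 1 \<le> m \<Longrightarrow> (\<Sum>i = 1..m. real i powr (t / b - 1)) \<le> Cw * psi t b m powr (1 / b)"
      using sum_weight_le[OF assms(1) b] by blast
    define \<gamma> where "\<gamma> = (s - t) / b"
    have \<gamma>: "\<gamma> > 0" using assms b by (simp add: \<gamma>_def)
    show ?thesis unfolding id_decay_def
    proof (intro allI impI)
      fix \<delta> :: real assume \<delta>: "\<delta> > 0"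
      define K where "K = \<delta> powr (1 / b) * Cw + C1 powr (1 / b) * C2 powr (1 / b) / \<gamma>"
      have K: "K > 0" using \<delta> Cw C1 C2 \<gamma> by (simp add: K_def add_pos_pos)
      show "\<exists>C>0. \<forall>n m x y. 1 \<le> m \<and> m \<le> n \<and> x \<in> lball s a n \<and> y \<in> carrier_vec n \<and>
         (\<forall>i. 1 \<le> i \<and> i \<le> n \<longrightarrow> rearr y i \<le> rearr x i \<and> rearr y i \<le> \<delta> / psi s a m) \<longrightarrow>
         lnorm t b y \<le> C * (psi t b m / psi s a m)"
      proof (intro exI[of _ "K powr b"] conjI allI impI; (elim conjE)?)
        fix n m x y assume m: "1 \<le> (m::nat)" "m \<le> n" and x: "x \<in> lball s a n" and y: "y \<in> carrier_vec n"
          and yx: "\<forall>i. 1 \<le> i \<and> i \<le> n \<longrightarrow> rearr y i \<le> rearr x i \<and> rearr y i \<le> \<delta> / psi s a m"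
        have dn: "dim_vec y = n" using y by simp
        have pm: "psi t b m > 0" using m by (simp add: psi_pos)
        have "(\<Sum>i = 1..m. lterm t b y i) \<le> (\<Sum>i = 1..m. real i powr (t / b - 1) * (\<delta> / real m powr s) powr (1 / b))"
          using yx m dn b psis by (intro sum_mono mult_left_mono powr_mono2) (auto intro: rearr_nonneg)
        also have "\<dots> \<le> Cw * psi t b m powr (1 / b) * (\<delta> / real m powr s) powr (1 / b)"
          unfolding sum_distrib_right[symmetric] by (intro mult_right_mono Cw(2) m) auto
        also have "\<dots> = \<delta> powr (1 / b) * Cw * (psi t b m / real m powr s) powr (1 / b)"
          using pm \<delta> by (simp add: powr_divide)
        finally have head: "(\<Sum>i = 1..m. lterm t b y i) \<le> \<delta> powr (1 / b) * Cw * (psi t b m / real m powr s) powr (1 / b)" .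
        have "(\<Sum>i = Suc m..n. lterm t b y i) \<le> (\<Sum>i = Suc m..n. C1 powr (1 / b) * real i powr (- \<gamma> - 1))"
        proof (rule sum_mono)
          fix i assume i: "i \<in> {Suc m..n}"
          have "rearr y i \<le> rearr x i" using yx i by auto
          also have "\<dots> \<le> C1 / psi s a i" using i by (intro C1(2)[OF x]) auto
          also have "\<dots> = C1 * real i powr (- s)" by (simp add: psis powr_minus_divide)
          finally have "rearr y i \<le> C1 * real i powr (- s)" .
          then have "rearr y i powr (1 / b) \<le> (C1 * real i powr (- s)) powr (1 / b)"
            using i dn b by (intro powr_mono2) (auto intro: rearr_nonneg)
          then have "lterm t b y i \<le> real i powr (t / b - 1) * (C1 * real i powr (- s)) powr (1 / b)"
            by (intro mult_left_mono) auto
          also have "\<dots> = C1 powr (1 / b) * (real i powr (t / b - 1) * real i powr (- (s / b)))" by (simp add: powr_mult powr_powr)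
          also have "real i powr (t / b - 1) * real i powr (- (s / b)) = real i powr (- \<gamma> - 1)"
            unfolding powr_add[symmetric] by (rule arg_cong[of _ _ "\<lambda>z. real i powr z"]) (simp add: \<gamma>_def diff_divide_distrib)
          finally show "lterm t b y i \<le> C1 powr (1 / b) * real i powr (- \<gamma> - 1)" .
        qed
        also have "\<dots> \<le> C1 powr (1 / b) * (real m powr (- \<gamma>) / \<gamma>)"
          unfolding sum_distrib_left[symmetric] by (intro mult_left_mono sum_tail_powr_le \<gamma> m) auto
        also have "real m powr (- \<gamma>) = (real m powr t / real m powr s) powr (1 / b)"
          unfolding powr_diff[symmetric] powr_powr by (simp add: \<gamma>_def diff_divide_distrib)
        also have "C1 powr (1 / b) * ((real m powr t / real m powr s) powr (1 / b) / \<gamma>) \<le> C1 powr (1 / b) * ((C2 * psi t b m / real m powr s) powr (1 / b) / \<gamma>)"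
          using b \<gamma> m C2(2)[OF m(1)] by (intro mult_left_mono divide_right_mono powr_mono2) auto
        also have "\<dots> = C1 powr (1 / b) * C2 powr (1 / b) / \<gamma> * (psi t b m / real m powr s) powr (1 / b)"
          using powr_mult[of C2 "psi t b m / real m powr s" "1 / b"] by simp
        finally have tail: "(\<Sum>i = Suc m..n. lterm t b y i) \<le> C1 powr (1 / b) * C2 powr (1 / b) / \<gamma> * (psi t b m / real m powr s) powr (1 / b)" .
        have "(\<Sum>i = 1..n. lterm t b y i) \<le> K * (psi t b m / real m powr s) powr (1 / b)"
          unfolding sum_atLeastAtMost_split[OF m(2)] K_def distrib_right using head tail by (rule add_mono)
        also have "\<dots> = (K powr b * (psi t b m / real m powr s)) powr (1 / b)"
          using b K by (simp only: powr_mult powr_powr) simp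
        finally show "lnorm t b y \<le> K powr b * (psi t b m / psi s a m)"
          unfolding psis using b dn K pm m by (subst lnorm_le_iff) auto
      qed (use K in auto)
    qed
  qed
qed

text \<open>In the tail \<open>1 / b = \<nu> + 1 / a\<close> with \<open>\<nu> > 0\<close>: the
  factor with exponent \<open>\<nu>\<close> is bounded by the truncation level, the other one sums
  to at most 1 by the source norm. Head and tail are both of order
  \<open>l powr (1 - a / b)\<close>.\<close>

lemma id_decay_0:
  assumes "0 \<le> b" "b < a"
  shows "id_decay 0 a 0 b"
  unfolding id_decay_def
proof (intro allI impI)
  fix \<delta> :: real assume \<delta>: "\<delta> > 0"
  have a: "a > 0" using assms by simp
  have psi0: "psi 0 c m = ln (real m + 1) powr c" for c and m :: nat by (simp add: psi_def)
  show "\<exists>C>0. \<forall>n m x y. 1 \<le> m \<and> m \<le> n \<and> x \<in> lball 0 a n \<and> y \<in> carrier_vec n \<and>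
     (\<forall>i. 1 \<le> i \<and> i \<le> n \<longrightarrow> rearr y i \<le> rearr x i \<and> rearr y i \<le> \<delta> / psi 0 a m) \<longrightarrow>
     lnorm 0 b y \<le> C * (psi 0 b m / psi 0 a m)"
  proof (cases "b = 0")
    case True
    show ?thesis
    proof (intro exI[of _ \<delta>] conjI allI impI; (elim conjE)?)
      fix n m x y assume m: "1 \<le> (m::nat)" "m \<le> n" and y: "y \<in> carrier_vec n"
        and yx: "\<forall>i. 1 \<le> i \<and> i \<le> n \<longrightarrow> rearr y i \<le> rearr x i \<and> rearr y i \<le> \<delta> / psi 0 a m"
      have "psi 0 0 m = 1" using m by (simp add: psi_def)
      then show "lnorm 0 b y \<le> \<delta> * (psi 0 b m / psi 0 a m)"
        unfolding True using y m yx by (subst lnorm_0_le_iff) auto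
    qed (rule \<delta>)
  next
    case False
    then have b: "b > 0" using assms by simp
    define \<nu> where "\<nu> = 1 / b - 1 / a"
    have \<nu>: "\<nu> > 0" using assms b by (simp add: \<nu>_def frac_less2)
    define K where "K = 2 * \<delta> powr (1 / b) + \<delta> powr \<nu>"
    have K: "K > 0" using \<delta> by (simp add: K_def add_pos_pos)
    show ?thesis
    proof (intro exI[of _ "K powr b"] conjI allI impI; (elim conjE)?)
      fix n m x y assume m: "1 \<le> (m::nat)" "m \<le> n" and x: "x \<in> lball 0 a n" and y: "y \<in> carrier_vec n"
        and yx: "\<forall>i. 1 \<le> i \<and> i \<le> n \<longrightarrow> rearr y i \<le> rearr x i \<and> rearr y i \<le> \<delta> / psi 0 a m"
      have dn: "dim_vec y = n" using y by simp
      define l where "l = ln (real m + 1)"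
      have l: "l > 0" using m by (simp add: l_def)
      have yl: "rearr y i \<le> \<delta> * l powr (- a)" "rearr y i \<le> rearr x i" "0 \<le> rearr y i" if "1 \<le> i" "i \<le> n" for i
        using yx that dn by (auto simp: psi0 l_def powr_minus_divide intro: rearr_nonneg)
      have e: "(\<delta> * l powr (- a)) powr c = \<delta> powr c * l powr (- (a * c))" for c by (simp add: powr_mult powr_powr)
      have "(\<Sum>i = 1..m. real i powr (- 1) * rearr y i powr (1 / b)) \<le> (\<Sum>i = 1..m. real i powr (- 1) * (\<delta> * l powr (- a)) powr (1 / b))"
        using yl m b by (intro sum_mono mult_left_mono powr_mono2) auto
      also have "\<dots> \<le> 2 * l * (\<delta> * l powr (- a)) powr (1 / b)"
        unfolding sum_distrib_right[symmetric] l_def by (intro mult_right_mono sum_inverse_le) auto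
      also have "\<dots> = 2 * \<delta> powr (1 / b) * l powr (1 - a / b)"
        unfolding e using l by (simp add: powr_diff powr_minus_divide)
      finally have head: "(\<Sum>i = 1..m. real i powr (- 1) * rearr y i powr (1 / b)) \<le> 2 * \<delta> powr (1 / b) * l powr (1 - a / b)" .
      have "(\<Sum>i = Suc m..n. real i powr (- 1) * rearr y i powr (1 / b)) \<le> (\<Sum>i = Suc m..n. (\<delta> * l powr (- a)) powr \<nu> * (lterm 0 a x i))"
      proof (rule sum_mono)
        fix i assume "i \<in> {Suc m..n}"
        then have i: "1 \<le> i" "i \<le> n" by auto
        have "rearr y i powr (1 / b) = rearr y i powr \<nu> * rearr y i powr (1 / a)" by (simp add: \<nu>_def flip: powr_add)
        also have "\<dots> \<le> (\<delta> * l powr (- a)) powr \<nu> * rearr x i powr (1 / a)"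
          using yl[OF i] \<nu> a by (intro mult_mono powr_mono2) auto
        finally have "real i powr (- 1) * rearr y i powr (1 / b) \<le> real i powr (- 1) * ((\<delta> * l powr (- a)) powr \<nu> * rearr x i powr (1 / a))"
          by (intro mult_left_mono) auto
        then show "real i powr (- 1) * rearr y i powr (1 / b) \<le> (\<delta> * l powr (- a)) powr \<nu> * (lterm 0 a x i)"
          by (simp add: ac_simps)
      qed
      also have "\<dots> \<le> (\<delta> * l powr (- a)) powr \<nu> * (\<Sum>i = 1..n. lterm 0 a x i)"
        unfolding sum_distrib_left[symmetric] by (intro mult_left_mono sum_mono2) auto
      also have "\<dots> \<le> (\<delta> * l powr (- a)) powr \<nu> * 1"
        by (intro mult_left_mono sum_ball_le_1 a x) auto
      also have "\<dots> = \<delta> powr \<nu> * l powr (1 - a / b)"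
      proof -
        have "- (a * \<nu>) = 1 - a / b" using a by (simp add: \<nu>_def field_simps)
        then show ?thesis unfolding e by simp
      qed
      finally have tail: "(\<Sum>i = Suc m..n. real i powr (- 1) * rearr y i powr (1 / b)) \<le> \<delta> powr \<nu> * l powr (1 - a / b)" .
      have "(\<Sum>i = 1..n. lterm 0 b y i) \<le> K * l powr (1 - a / b)"
        unfolding sum_atLeastAtMost_split[OF m(2)] K_def distrib_right using head tail by (simp add: add_mono)
      also have "\<dots> = (K powr b * (psi 0 b m / psi 0 a m)) powr (1 / b)"
      proof -
        have "(b - a) * (1 / b) = 1 - a / b" using b by (simp add: field_simps)
        moreover have "psi 0 b m / psi 0 a m = l powr (b - a)" by (simp add: psi0 l_def powr_diff)
        ultimately show ?thesis using b K by (simp only: powr_mult powr_powr) simp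
      qed
      finally show "lnorm 0 b y \<le> K powr b * (psi 0 b m / psi 0 a m)"
        using b dn by (subst lnorm_le_iff) (auto simp: psi0)
    qed (use K in auto)
  qed
qed

text \<open>The head is bounded, the logarithm comes from the tail. There
  \<open>i powr s * rearr x i\<close> is integrated against the measure \<open>1 / i\<close>, whose
  mass is at most \<open>\<Lambda>\<close>: its power \<open>1 / a\<close> has integral at most 1,
  and the split at \<open>T = \<Lambda> powr (- a)\<close> gives
  \<open>\<Lambda> powr (1 - a / b)\<close> for the power \<open>1 / b\<close>. For
  \<open>a = 0\<close> this quantity is bounded.\<close>

lemma lnorm_truncated_same_s:
  assumes "0 < s" "0 \<le> a" "a < b" "0 < \<delta>"
  obtains C where "C > 0" "\<And>n m x y. 1 \<le> m \<Longrightarrow> m \<le> n \<Longrightarrow> x \<in> lball s a n \<Longrightarrow> y \<in> carrier_vec n \<Longrightarrow>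
     (\<And>i. 1 \<le> i \<Longrightarrow> i \<le> n \<Longrightarrow> rearr y i \<le> rearr x i \<and> rearr y i \<le> \<delta> / psi s a m) \<Longrightarrow>
     lnorm s b y \<le> C * (1 + ln (real n / real m)) powr (b - a)"
proof -
  have b: "b > 0" using assms by simp
  obtain C1 where C1: "C1 > 0" "\<And>n x i. x \<in> lball s a n \<Longrightarrow> 1 \<le> i \<Longrightarrow> i \<le> n \<Longrightarrow> rearr x i \<le> C1 / psi s a i"
    using rearr_le_psi[of s a] assms by auto
  obtain Cw where Cw: "Cw > 0" "\<And>m::nat. (\<Sum>i = 1..m. real i powr (s / b - 1)) \<le> Cw * real m powr (s / b)"
    using sum_powr_le[of "s / b"] assms b by auto
  have psis: "psi s a m = real m powr s" for m :: nat using assms by (simp add: psi_def)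
  define K where "K = \<delta> powr (1 / b) * Cw + (C1 powr (1 / b) + 2)"
  have K: "K > 0" using assms Cw C1 by (simp add: K_def add_pos_pos)
  show ?thesis
  proof (rule that[of "K powr b"])
    fix n m x y assume m: "1 \<le> (m::nat)" "m \<le> n" and x: "x \<in> lball s a n" and y: "y \<in> carrier_vec n"
      and yx: "\<And>i. 1 \<le> i \<Longrightarrow> i \<le> n \<Longrightarrow> rearr y i \<le> rearr x i \<and> rearr y i \<le> \<delta> / psi s a m"
    have dn: "dim_vec y = n" "dim_vec x = n" using x y by (auto simp: lball_def)
    define \<Lambda> where "\<Lambda> = 1 + ln (real n / real m)"
    have \<Lambda>: "1 \<le> \<Lambda>" using m by (simp add: \<Lambda>_def)
    define e where "e = 1 - a / b"
    have e: "0 < e" using assms b by (simp add: e_def)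
    have L1: "1 \<le> \<Lambda> powr e" using \<Lambda> e by (intro ge_one_powr_ge_zero) auto
    have "(\<Sum>i = 1..m. lterm s b y i) \<le> (\<Sum>i = 1..m. real i powr (s / b - 1) * (\<delta> / real m powr s) powr (1 / b))"
      using yx m dn b psis by (intro sum_mono mult_left_mono powr_mono2) (auto intro: rearr_nonneg)
    also have "\<dots> \<le> Cw * real m powr (s / b) * (\<delta> / real m powr s) powr (1 / b)"
      unfolding sum_distrib_right[symmetric] by (intro mult_right_mono Cw(2)) auto
    also have "\<dots> = \<delta> powr (1 / b) * Cw * 1"
      using m assms by (simp add: powr_divide powr_powr)
    also have "\<dots> \<le> \<delta> powr (1 / b) * Cw * \<Lambda> powr e" using L1 Cw by (intro mult_left_mono) auto
    finally have head: "(\<Sum>i = 1..m. lterm s b y i) \<le> \<delta> powr (1 / b) * Cw * \<Lambda> powr e" .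
    define z where "z i = real i powr s * rearr x i" for i
    have z0: "0 \<le> z i" if "1 \<le> i" "i \<le> n" for i using that dn unfolding z_def by (intro mult_nonneg_nonneg rearr_nonneg) auto
    have zC: "z i \<le> C1" if "1 \<le> i" "i \<le> n" for i
      using C1(2)[OF x that] that by (simp add: z_def psis field_simps)
    have inv: "(\<Sum>i = Suc m..n. real i powr (- 1)) \<le> \<Lambda>" using sum_tail_inverse_le[OF m] by (simp add: \<Lambda>_def)
    have term_eq: "lterm s c x i = real i powr (- 1) * z i powr (1 / c)" for i c
    proof -
      have "real i powr (- 1) * z i powr (1 / c) = (real i powr (- 1) * real i powr (s / c)) * rearr x i powr (1 / c)"
        by (simp add: z_def powr_mult powr_powr)
      also have "real i powr (- 1) * real i powr (s / c) = real i powr (s / c - 1)"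
        unfolding powr_add[symmetric] by simp
      finally show ?thesis by simp
    qed
    have "(\<Sum>i = Suc m..n. lterm s b y i) \<le> (\<Sum>i = Suc m..n. real i powr (- 1) * z i powr (1 / b))"
      unfolding term_eq[symmetric] using yx m dn b by (intro sum_mono mult_left_mono powr_mono2) (auto intro: rearr_nonneg)
    also have "\<dots> \<le> (C1 powr (1 / b) + 2) * \<Lambda> powr e"
    proof (cases "a = 0")
      case True
      have "(\<Sum>i = Suc m..n. real i powr (- 1) * z i powr (1 / b)) \<le> (\<Sum>i = Suc m..n. real i powr (- 1) * C1 powr (1 / b))"
        using z0 zC b m by (intro sum_mono mult_left_mono powr_mono2) auto
      also have "\<dots> \<le> \<Lambda> * C1 powr (1 / b)"
        unfolding sum_distrib_right[symmetric] by (intro mult_right_mono inv) auto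
      also have "\<dots> \<le> (C1 powr (1 / b) + 2) * \<Lambda>" using \<Lambda> by (simp add: algebra_simps)
      also have "\<Lambda> = \<Lambda> powr e" using True \<Lambda> by (simp add: e_def)
      finally show ?thesis .
    next
      case False
      then have a: "a > 0" using assms by simp
      define T where "T = \<Lambda> powr (- a)"
      have T: "T > 0" using \<Lambda> by (simp add: T_def)
      have ab: "1 / b \<le> 1 / a" using assms a b by (simp add: frac_le)
      have "(\<Sum>i = Suc m..n. real i powr (- 1) * z i powr (1 / b))
        \<le> (\<Sum>i = Suc m..n. real i powr (- 1) * T powr (1 / b) + T powr (1 / b - 1 / a) * (lterm s a x i))"
      proof (rule sum_mono)
        fix i assume "i \<in> {Suc m..n}"
        then have i: "1 \<le> i" "i \<le> n" by auto
        have "z i powr (1 / b) \<le> T powr (1 / b) + T powr (1 / b - 1 / a) * z i powr (1 / a)"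
          using z0[OF i] b ab T by (intro powr_split_at) auto
        then have "real i powr (- 1) * z i powr (1 / b) \<le> real i powr (- 1) * (T powr (1 / b) + T powr (1 / b - 1 / a) * z i powr (1 / a))"
          by (intro mult_left_mono) auto
        then show "real i powr (- 1) * z i powr (1 / b) \<le> real i powr (- 1) * T powr (1 / b) + T powr (1 / b - 1 / a) * (lterm s a x i)"
          unfolding term_eq by (simp add: algebra_simps)
      qed
      also have "\<dots> = (\<Sum>i = Suc m..n. real i powr (- 1)) * T powr (1 / b) + T powr (1 / b - 1 / a) * (\<Sum>i = Suc m..n. lterm s a x i)"
        by (simp only: sum.distrib sum_distrib_left sum_distrib_right)
      also have "\<dots> \<le> \<Lambda> * T powr (1 / b) + T powr (1 / b - 1 / a) * 1"
      proof (intro add_mono mult_right_mono mult_left_mono inv)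
        have "(\<Sum>i = Suc m..n. lterm s a x i) \<le> (\<Sum>i = 1..n. lterm s a x i)"
          by (intro sum_mono2) auto
        also have "\<dots> \<le> 1" by (rule sum_ball_le_1[OF a x])
        finally show "(\<Sum>i = Suc m..n. lterm s a x i) \<le> 1" .
      qed auto
      also have "T powr (1 / b - 1 / a) = \<Lambda> powr e"
        unfolding T_def powr_powr e_def by (rule arg_cong[of _ _ "\<lambda>z. \<Lambda> powr z"]) (use a in \<open>simp add: right_diff_distrib\<close>)
      also have "\<Lambda> * T powr (1 / b) = \<Lambda> powr e"
      proof -
        have "T powr (1 / b) = \<Lambda> powr (- (a / b))" unfolding T_def powr_powr by simp
        then show ?thesis using \<Lambda> by (simp add: e_def powr_diff powr_minus_divide)
      qed
      also have "\<Lambda> powr e + \<Lambda> powr e * 1 \<le> (C1 powr (1 / b) + 2) * \<Lambda> powr e" by (simp add: algebra_simps)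
      finally show ?thesis .
    qed
    finally have tail: "(\<Sum>i = Suc m..n. lterm s b y i) \<le> (C1 powr (1 / b) + 2) * \<Lambda> powr e" .
    have "(\<Sum>i = 1..n. lterm s b y i) \<le> K * \<Lambda> powr e"
      unfolding sum_atLeastAtMost_split[OF m(2)] K_def distrib_right[of "\<delta> powr (1 / b) * Cw"] using head tail by (rule add_mono)
    also have "\<dots> = (K powr b * \<Lambda> powr (b - a)) powr (1 / b)"
    proof -
      have "(b - a) * (1 / b) = e" using b by (simp add: e_def field_simps)
      then show ?thesis using b K by (simp only: powr_mult powr_powr) simp
    qed
    finally show "lnorm s b y \<le> K powr b * (1 + ln (real n / real m)) powr (b - a)"
      unfolding \<Lambda>_def[symmetric] using b dn by (subst lnorm_le_iff) auto
  qed (use K in auto)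
qed

section \<open>The asymptotic regimes\<close>

lemma ln_2_ge_half: "1 / 2 \<le> ln (2::real)"
  using ln_le_minus_one[of "1 / 2 :: real"] by (simp add: ln_div)

text \<open>Needed for words of length one: \<open>k \<le> ln n\<close> must imply
  \<open>2 ^ k * n powr (1 / 4) < n\<close>, so \<open>ln 2\<close> has to stay below the exponent
  \<open>3 / 4\<close> that the Hamming ball leaves over.\<close>

lemma ln_2_less_three_quarters: "ln (2::real) < 3 / 4"
proof -
  have "(2::real) < (1 + (3 / 4) / real 8) ^ 8" by (simp add: eval_nat_numeral)
  also have "\<dots> \<le> exp (3 / 4)" by (rule exp_ge_one_plus_x_over_n_power_n) auto
  finally have "ln 2 < ln (exp (3 / 4 :: real))" by (subst ln_less_cancel_iff) auto
  then show ?thesis by simp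
qed

lemma ln_ratio_ge:
  assumes "1 \<le> k" "k \<le> n"
  shows "ln 2 \<le> ln (real n / real k + 1)" "1 / 2 \<le> ln (real n / real k + 1)"
proof -
  have "1 \<le> real n / real k" using assms by simp
  then show "ln 2 \<le> ln (real n / real k + 1)" by (intro ln_mono) auto
  then show "1 / 2 \<le> ln (real n / real k + 1)" using ln_2_ge_half by linarith
qed

lemma ell_bounds:
  assumes "1 \<le> k" "k \<le> n"
  shows "0 < ell k n" "ell k n \<le> 2 * real k"
proof -
  note L = ln_ratio_ge(2)[OF assms]
  show "0 < ell k n" using L assms by (simp add: ell_def)
  have "real k * (1 / 2) \<le> real k * ln (real n / real k + 1)" using L by (intro mult_left_mono) auto
  then have "real k \<le> 2 * real k * ln (real n / real k + 1)" by simp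
  then show "ell k n \<le> 2 * real k" using L by (simp add: ell_def pos_divide_le_eq)
qed

lemma ell_ge_half:
  assumes "1 \<le> k" "k \<le> n" "ln (real n) \<le> real k"
  shows "1 / 2 \<le> ell k n"
proof -
  note L = ln_ratio_ge(2)[OF assms(1,2)]
  have "real n / real k \<le> real n" using assms by (simp add: divide_le_eq mult_le_cancel_left1)
  then have "real n / real k + 1 \<le> 2 * real n" using assms by simp
  then have "ln (real n / real k + 1) \<le> ln (2 * real n)" using assms by (intro ln_mono) (auto simp: add_nonneg_pos)
  also have "\<dots> = ln 2 + ln (real n)" using assms by (subst ln_mult) auto
  also have "\<dots> \<le> 1 + real k" using assms(3) ln_2_less_1 by linarith
  also have "\<dots> \<le> 2 * real k" using assms(1) by simp
  finally show ?thesis using L assms by (simp add: ell_def pos_le_divide_eq)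
qed

text \<open>Up to constants \<open>ell k n\<close> solves \<open>m * (1 + ln (n / m)) = k\<close>,
  and \<open>m\<close> is a small multiple of it. The difficulty is that shrinking \<open>m\<close>
  raises the logarithm. With \<open>\<theta> = 2 / w\<^sup>2\<close> the logarithm grows by at most
  \<open>2 * ln w \<le> 2 * w\<close>, so the product still gains a factor of order
  \<open>1 / w\<close>, and \<open>w \<ge> 12 * A\<close> suffices.\<close>

lemma choose_support_size:
  fixes A :: real
  assumes "A > 0"
  obtains \<theta> D where "0 < \<theta>" "D > 0"
    "\<And>n k. 1 \<le> k \<Longrightarrow> k \<le> n \<Longrightarrow> 1 \<le> \<theta> * ell k n \<Longrightarrow>
      \<exists>m\<ge>1. m \<le> n \<and> ell k n \<le> 2 / \<theta> * real m \<and> real m \<le> ell k n \<and>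
        A * (real m * (1 + ln (real n / real m))) \<le> real k \<and> 1 + ln (real n / real m) \<le> D * ln (real n / real k + 1)"
proof -
  define w where "w = max 2 (12 * A)"
  have w: "2 \<le> w" "12 * A \<le> w" by (auto simp: w_def)
  define \<theta> where "\<theta> = 2 / w\<^sup>2"
  have \<theta>: "0 < \<theta>" "\<theta> \<le> 1 / 2"
  proof -
    show "0 < \<theta>" using w by (simp add: \<theta>_def)
    have "2\<^sup>2 \<le> w\<^sup>2" using w by (intro power_mono) auto
    then show "\<theta> \<le> 1 / 2" using w by (simp add: \<theta>_def field_simps)
  qed
  show ?thesis
  proof (rule that[of \<theta> "6 * w"])
    fix n k :: nat assume k: "1 \<le> k" "k \<le> n" and large: "1 \<le> \<theta> * ell k n"
    define L where "L = ln (real n / real k + 1)"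
    have L: "1 / 2 \<le> L" using ln_ratio_ge[OF k] by (simp add: L_def)
    have ell: "ell k n = real k / L" by (simp add: ell_def L_def)
    have e0: "0 < ell k n" "ell k n \<le> 2 * real k" using ell_bounds[OF k] by auto
    define m where "m = nat \<lfloor>\<theta> * ell k n\<rfloor>"
    have rm: "real m = real_of_int \<lfloor>\<theta> * ell k n\<rfloor>" using large by (simp add: m_def)
    have m1: "1 \<le> m" using large by (simp add: m_def le_nat_iff)
    have mle: "real m \<le> \<theta> * ell k n" unfolding rm by simp
    have "\<theta> * ell k n < real m + 1" unfolding rm by simp
    then have half: "\<theta> * ell k n \<le> 2 * real m" using m1 by simp
    have tk: "\<theta> * ell k n \<le> real k"
    proof -
      have "\<theta> * ell k n \<le> (1 / 2) * (2 * real k)" using \<theta> e0 by (intro mult_mono) auto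
      then show ?thesis by simp
    qed
    have mn: "m \<le> n" using mle tk k by linarith
    have "\<theta> * ell k n \<le> 1 * ell k n" using \<theta> e0 by (intro mult_right_mono) auto
    then have mell: "real m \<le> ell k n" using mle by simp
    have ellm: "ell k n \<le> 2 / \<theta> * real m" using half \<theta> by (simp add: field_simps)
    have "ln (real n / real m) \<le> ln (w\<^sup>2 * (real n / real k) * L)"
    proof (rule ln_mono)
      have "real k / L \<le> w\<^sup>2 * real m" using ellm by (simp add: \<theta>_def ell)
      then have "real k \<le> w\<^sup>2 * real m * L" using L by (simp add: pos_divide_le_eq)
      then have "real n * real k \<le> real n * (w\<^sup>2 * real m * L)" by (intro mult_left_mono) auto
      then show "real n / real m \<le> w\<^sup>2 * (real n / real k) * L" using m1 k by (simp add: field_simps)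
    qed (use m1 mn in auto)
    also have "\<dots> = 2 * ln w + ln (real n / real k) + ln L"
    proof -
      have "ln (w\<^sup>2 * (real n / real k) * L) = ln (w\<^sup>2 * (real n / real k)) + ln L"
        using w k L by (intro ln_mult_pos) auto
      also have "ln (w\<^sup>2 * (real n / real k)) = ln (w\<^sup>2) + ln (real n / real k)"
        using w k by (intro ln_mult_pos) auto
      finally show ?thesis using w by (simp add: ln_realpow)
    qed
    also have "\<dots> \<le> 2 * w + L + L"
    proof (intro add_mono)
      show "2 * ln w \<le> 2 * w" using ln_le_minus_one[of w] w by simp
      show "ln (real n / real k) \<le> L" unfolding L_def using k by (intro ln_mono) auto
      show "ln L \<le> L" using ln_le_minus_one[of L] L by simp
    qed
    finally have "1 + ln (real n / real m) \<le> 1 + 2 * w + 2 * L" by simp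
    also have "\<dots> \<le> 2 * L + 4 * (w * L) + 2 * L"
    proof -
      have "w * (1 / 2) \<le> w * L" using L w by (intro mult_left_mono) auto
      then show ?thesis using L by simp
    qed
    also have "\<dots> \<le> 6 * (w * L)"
    proof -
      have "2 * L \<le> w * L" using L w by (intro mult_right_mono) auto
      then show ?thesis by (simp add: mult.commute)
    qed
    finally have \<Lambda>: "1 + ln (real n / real m) \<le> 6 * w * L" by simp
    have "A * (real m * (1 + ln (real n / real m))) \<le> A * ((\<theta> * ell k n) * (6 * w * L))"
      using assms \<Lambda> mle w L e0 \<theta> m1 mn by (intro mult_left_mono mult_mono) (auto intro: add_nonneg_nonneg)
    also have "\<dots> = 12 * A / w * real k" using L w by (simp add: ell \<theta>_def power2_eq_square)
    also have "\<dots> \<le> 1 * real k" using w by (intro mult_right_mono) auto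
    finally have "A * (real m * (1 + ln (real n / real m))) \<le> real k" by simp
    then show "\<exists>m\<ge>1. m \<le> n \<and> ell k n \<le> 2 / \<theta> * real m \<and> real m \<le> ell k n \<and>
        A * (real m * (1 + ln (real n / real m))) \<le> real k \<and> 1 + ln (real n / real m) \<le> 6 * w * ln (real n / real k + 1)"
      using m1 mn ellm mell \<Lambda> unfolding L_def by blast
  qed (use \<theta> w in auto)
qed

definition psi_quot :: "real \<Rightarrow> real \<Rightarrow> real \<Rightarrow> real \<Rightarrow> real \<Rightarrow> real" where
  "psi_quot s a t b x = psi t b x / psi s a x"

lemma psi_quot_pos: "0 < x \<Longrightarrow> 0 < psi_quot s a t b x"
  by (simp add: psi_quot_def psi_pos)

text \<open>The quotient need not be monotone: numerator and denominator are compared in opposite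
  directions, so \<open>x\<close> and \<open>y\<close> must be comparable both ways.\<close>

lemma psi_quot_ge_const_mult:
  assumes "0 \<le> s" "0 \<le> a" "0 \<le> t" "0 \<le> b" "1 \<le> K"
  obtains c where "c > 0" "\<And>x y. 1 / 2 \<le> x \<Longrightarrow> 1 / 2 \<le> y \<Longrightarrow> y \<le> K * x \<Longrightarrow> x \<le> K * y \<Longrightarrow>
    c * psi_quot s a t b y \<le> psi_quot s a t b x"
proof -
  obtain c1 where c1: "c1 > 0" "\<And>x y. 1 / 2 \<le> x \<Longrightarrow> 0 < y \<Longrightarrow> y \<le> K * x \<Longrightarrow> c1 * psi t b y \<le> psi t b x"
    using psi_ge_const_mult[OF assms(3,4,5)] by blast
  obtain c2 where c2: "c2 > 0" "\<And>x y. 1 / 2 \<le> x \<Longrightarrow> 0 < y \<Longrightarrow> y \<le> K * x \<Longrightarrow> c2 * psi s a y \<le> psi s a x"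
    using psi_ge_const_mult[OF assms(1,2,5)] by blast
  show ?thesis
  proof (rule that[of "c1 * c2"])
    fix x y :: real assume xy: "1 / 2 \<le> x" "1 / 2 \<le> y" "y \<le> K * x" "x \<le> K * y"
    have p: "0 < psi s a x" "0 < psi s a y" "0 < psi t b x" "0 < psi t b y" using xy by (simp_all add: psi_pos)
    have "c1 * psi t b y * (c2 * psi s a x) \<le> psi t b x * psi s a y"
      using c1(2)[of x y] c2(2)[of y x] xy p c1(1) c2(1) by (intro mult_mono) auto
    then show "c1 * c2 * psi_quot s a t b y \<le> psi_quot s a t b x" using p by (simp add: psi_quot_def field_simps)
  qed (use c1 c2 in simp)
qed

lemma ent_le_if_lnorm_le:
  assumes "0 < \<epsilon>" "1 \<le> n" "0 \<le> b" "\<And>x. x \<in> lball s a n \<Longrightarrow> lnorm t b x \<le> \<epsilon>"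
  shows "ent s a t b n k \<le> \<epsilon>"
  using covers_if_lnorm_le[OF assms] by (rule ent_le)

lemma ent_nonneg:
  assumes "0 \<le> s" "0 \<le> a" "0 \<le> t" "0 \<le> b" "1 \<le> n"
  shows "0 \<le> ent s a t b n k"
proof -
  obtain \<epsilon> where "covers s a t b n k \<epsilon>" using ex_covers[OF assms] by blast
  then show ?thesis by (rule ent_ge) (simp add: covers_def)
qed

text \<open>Up to constants, \<open>2 powr (- k / n)\<close> times the \<open>n\<close>-th root of
  the volume ratio of source and target unit balls.\<close>

definition vol_rate :: "real \<Rightarrow> real \<Rightarrow> real \<Rightarrow> real \<Rightarrow> nat \<Rightarrow> nat \<Rightarrow> real" where
  "vol_rate s a t b n k = 2 powr (- (real k / real n)) * psi_quot s a t b n"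

text \<open>From \<open>k \<ge> A * n\<close> on, fine quantisation gives the rate; below,
  \<open>2 powr (- k / n)\<close> exceeds \<open>2 powr (- A)\<close>, so a bound by
  \<open>psi_quot\<close> at \<open>n\<close> already has the right form. With \<open>R\<close> the
  argument serves both all \<open>k\<close> and the range \<open>k \<ge> n\<close>.\<close>

lemma ent_le_vol_rate:
  assumes "0 \<le> s" "0 \<le> a" "0 \<le> t" "0 \<le> b"
    and "C0 > 0" "\<And>n k. 1 \<le> n \<Longrightarrow> 1 \<le> k \<Longrightarrow> R n k \<Longrightarrow> ent s a t b n k \<le> C0 * psi_quot s a t b n"
  obtains C where "C > 0" "\<And>n k. 1 \<le> n \<Longrightarrow> 1 \<le> k \<Longrightarrow> R n k \<Longrightarrow> ent s a t b n k \<le> C * vol_rate s a t b n k"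
proof -
  obtain A C where AC: "A > 0" "C > 0" "\<And>n k. 1 \<le> n \<Longrightarrow> A * real n \<le> real k \<Longrightarrow>
       ent s a t b n k \<le> C * (2 powr (- (real k / real n)) * (psi t b n / psi s a n))"
    using ent_le_fine[OF assms(1-4)] by blast
  show ?thesis
  proof (rule that[of "max C (C0 * 2 powr A)"])
    fix n k :: nat assume n: "1 \<le> n" and k: "1 \<le> k" and R: "R n k"
    have q: "0 < psi_quot s a t b n" using n by (simp add: psi_quot_pos)
    then have v: "0 \<le> vol_rate s a t b n k" by (simp add: vol_rate_def)
    show "ent s a t b n k \<le> max C (C0 * 2 powr A) * vol_rate s a t b n k"
    proof (cases "A * real n \<le> real k")
      case True
      have "ent s a t b n k \<le> C * vol_rate s a t b n k" using AC(3)[OF n True] by (simp add: vol_rate_def psi_quot_def)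
      also have "\<dots> \<le> max C (C0 * 2 powr A) * vol_rate s a t b n k" using v by (intro mult_right_mono) auto
      finally show ?thesis .
    next
      case False
      then have kA: "real k / real n \<le> A" using n by (simp add: field_simps)
      have "ent s a t b n k \<le> C0 * psi_quot s a t b n * 1" using assms(6)[OF n k R] by simp
      also have "\<dots> \<le> C0 * psi_quot s a t b n * 2 powr (A + - (real k / real n))"
        using kA q assms(5) by (intro mult_left_mono ge_one_powr_ge_zero) auto
      also have "\<dots> = C0 * 2 powr A * vol_rate s a t b n k" unfolding powr_add by (simp add: vol_rate_def)
      also have "\<dots> \<le> max C (C0 * 2 powr A) * vol_rate s a t b n k" using v by (intro mult_right_mono) auto
      finally show ?thesis .
    qed
  qed (use AC in simp)
qed

lemma ent_ge_vol_rate: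
  assumes "0 \<le> s" "0 \<le> a" "0 \<le> t" "0 \<le> b"
  obtains c where "c > 0" "\<And>n k. 1 \<le> n \<Longrightarrow> c * vol_rate s a t b n k \<le> ent s a t b n k"
  using ent_ge_volume[OF assms] unfolding vol_rate_def psi_quot_def by blast

lemma asymp_id_large:
  assumes "0 \<le> s" "0 \<le> a" "0 \<le> t" "0 \<le> b" "id_large s a t b"
  shows "asymp_equal_on (\<lambda>n k. True) (ent s a t b) (vol_rate s a t b)"
proof -
  obtain C0 where C0: "C0 > 0" "\<And>n x. 1 \<le> n \<Longrightarrow> x \<in> lball s a n \<Longrightarrow> lnorm t b x \<le> C0 * psi_quot s a t b n"
    using assms(5) unfolding id_large_def psi_quot_def by blast
  obtain C where C: "C > 0" "\<And>n k. 1 \<le> n \<Longrightarrow> 1 \<le> k \<Longrightarrow> True \<Longrightarrow> ent s a t b n k \<le> C * vol_rate s a t b n k"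
  proof (rule ent_le_vol_rate[OF assms(1-4) C0(1), of "\<lambda>_ _. True"])
    fix n k :: nat assume n: "1 \<le> n"
    show "ent s a t b n k \<le> C0 * psi_quot s a t b n"
      by (rule ent_le_if_lnorm_le) (use n assms C0 psi_quot_pos[of n s a t b] in auto)
  qed auto
  obtain c where c: "c > 0" "\<And>n k. 1 \<le> n \<Longrightarrow> c * vol_rate s a t b n k \<le> ent s a t b n k"
    using ent_ge_vol_rate[OF assms(1-4)] by blast
  show ?thesis unfolding asymp_equal_on_def using c C by blast
qed

text \<open>\<open>id_decay\<close> at \<open>m = 1\<close> and \<open>y = x\<close>: the level
  \<open>C1 / psi 1\<close> bounds the largest entry of every vector in the ball, so nothing is
  truncated.\<close>

lemma id_decay_lnorm_le:
  assumes "0 \<le> s" "0 \<le> a" "id_decay s a t b"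
  obtains C where "C > 0" "\<And>n x. 1 \<le> n \<Longrightarrow> x \<in> lball s a n \<Longrightarrow> lnorm t b x \<le> C"
proof -
  obtain C1 where C1: "C1 > 0" "\<And>n x i. x \<in> lball s a n \<Longrightarrow> 1 \<le> i \<Longrightarrow> i \<le> n \<Longrightarrow> rearr x i \<le> C1 / psi s a i"
    using rearr_le_psi[OF assms(1,2)] by blast
  obtain C where C: "C > 0" "\<And>n m x y. 1 \<le> m \<and> m \<le> n \<and> x \<in> lball s a n \<and> y \<in> carrier_vec n \<and>
     (\<forall>i. 1 \<le> i \<and> i \<le> n \<longrightarrow> rearr y i \<le> rearr x i \<and> rearr y i \<le> C1 / psi s a (real m)) \<Longrightarrow>
     lnorm t b y \<le> C * psi_quot s a t b (real m)"
    using assms(3) C1(1) unfolding id_decay_def psi_quot_def by blast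
  show ?thesis
  proof (rule that[of "C * psi_quot s a t b (real 1)"])
    show "0 < C * psi_quot s a t b (real 1)" using C(1) by (simp add: psi_quot_pos)
    fix n x assume n: "1 \<le> n" and x: "x \<in> lball s a n"
    have dn: "dim_vec x = n" using x by (auto simp: lball_def)
    show "lnorm t b x \<le> C * psi_quot s a t b (real 1)"
    proof (rule C(2)[of 1 n x], intro conjI allI impI)
      fix i assume i: "1 \<le> i \<and> i \<le> n"
      have "rearr x i \<le> rearr x 1" using i dn by (intro rearr_antimono) auto
      also have "\<dots> \<le> C1 / psi s a (real 1)" using n by (intro C1(2)[OF x]) auto
      finally show "rearr x i \<le> C1 / psi s a (real 1)" .
    qed (use n x in \<open>auto simp: lball_def\<close>)
  qed
qed

text \<open>The number \<open>j \<le> k\<close> is the budget actually spent: \<open>j = k\<close>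
  covers the middle range, \<open>j = n\<close> gives the bound on which the range
  \<open>k \<ge> n\<close> is built.\<close>

lemma ent_le_id_decay:
  assumes "0 \<le> s" "0 \<le> a" "0 \<le> t" "0 \<le> b" "id_decay s a t b"
  obtains C where "C > 0" "\<And>n k j. 1 \<le> j \<Longrightarrow> j \<le> n \<Longrightarrow> j \<le> k \<Longrightarrow> ln (real n) \<le> real j \<Longrightarrow>
    ent s a t b n k \<le> C * psi_quot s a t b (ell j n)"
proof -
  obtain A \<delta> where A: "A > 0" "\<delta> > 0"
    "\<And>t b n m k \<epsilon>. 0 \<le> b \<Longrightarrow> 1 \<le> m \<Longrightarrow> m \<le> n \<Longrightarrow> A * (real m * (1 + ln (real n / real m))) \<le> real k \<Longrightarrow> 0 < \<epsilon> \<Longrightarrow>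
      (\<And>x y. x \<in> lball s a n \<Longrightarrow> y \<in> carrier_vec n \<Longrightarrow> (\<And>j. j < n \<Longrightarrow> \<bar>y $ j\<bar> \<le> \<bar>x $ j\<bar>) \<Longrightarrow>
         (\<And>j. j < n \<Longrightarrow> \<bar>y $ j\<bar> \<le> \<delta> / psi s a m) \<Longrightarrow> lnorm t b y \<le> \<epsilon>) \<Longrightarrow>
      covers s a t b n k \<epsilon>"
    using covers_coarse[OF assms(1,2)] by blast
  obtain C where C: "C > 0" "\<And>n m x y. 1 \<le> m \<and> m \<le> n \<and> x \<in> lball s a n \<and> y \<in> carrier_vec n \<and>
     (\<forall>i. 1 \<le> i \<and> i \<le> n \<longrightarrow> rearr y i \<le> rearr x i \<and> rearr y i \<le> \<delta> / psi s a (real m)) \<Longrightarrow>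
     lnorm t b y \<le> C * psi_quot s a t b (real m)"
    using assms(5) A(2) unfolding id_decay_def psi_quot_def by blast
  obtain \<theta> D where \<theta>: "0 < \<theta>" "D > 0"
    "\<And>n k. 1 \<le> k \<Longrightarrow> k \<le> n \<Longrightarrow> 1 \<le> \<theta> * ell k n \<Longrightarrow>
      \<exists>m\<ge>1. m \<le> n \<and> ell k n \<le> 2 / \<theta> * real m \<and> real m \<le> ell k n \<and>
        A * (real m * (1 + ln (real n / real m))) \<le> real k \<and> 1 + ln (real n / real m) \<le> D * ln (real n / real k + 1)"
    using choose_support_size[OF A(1)] by blast
  obtain C0 where C0: "C0 > 0" "\<And>n x. 1 \<le> n \<Longrightarrow> x \<in> lball s a n \<Longrightarrow> lnorm t b x \<le> C0"
    using id_decay_lnorm_le[OF assms(1,2,5)] by blast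
  obtain c where c: "c > 0" "\<And>x y. 1 / 2 \<le> x \<Longrightarrow> 1 / 2 \<le> y \<Longrightarrow> y \<le> max 1 (2 / \<theta>) * x \<Longrightarrow> x \<le> max 1 (2 / \<theta>) * y \<Longrightarrow>
    c * psi_quot s a t b y \<le> psi_quot s a t b x"
    using psi_quot_ge_const_mult[OF assms(1-4), of "max 1 (2 / \<theta>)"] by auto
  \<comment> \<open>If \<open>\<theta> * ell j n < 1\<close>, no support size is available. Then
    \<open>ell j n\<close> lies between \<open>1 / 2\<close> and \<open>1 / \<theta>\<close>, where
    \<open>psi_quot\<close> is at least \<open>\<phi>\<close>, and the norm of the identity is good
    enough.\<close>
  define \<phi> where "\<phi> = psi t b (1 / 2) / psi s a (1 / \<theta>)"
  have \<phi>: "\<phi> > 0" using \<theta> by (simp add: \<phi>_def psi_pos)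
  show ?thesis
  proof (rule that[of "max (C / c) (C0 / \<phi>)"])
    fix n k j :: nat assume j: "1 \<le> j" "j \<le> n" "j \<le> k" "ln (real n) \<le> real j"
    have eh: "1 / 2 \<le> ell j n" by (rule ell_ge_half[OF j(1,2,4)])
    then have q: "0 < psi_quot s a t b (ell j n)" by (intro psi_quot_pos) auto
    show "ent s a t b n k \<le> max (C / c) (C0 / \<phi>) * psi_quot s a t b (ell j n)"
    proof (cases "1 \<le> \<theta> * ell j n")
      case True
      then obtain m where m: "m \<ge> 1" "m \<le> n" "ell j n \<le> 2 / \<theta> * real m" "real m \<le> ell j n"
        "A * (real m * (1 + ln (real n / real m))) \<le> real j"
        using \<theta>(3)[OF j(1,2)] by blast
      have "covers s a t b n k (C * psi_quot s a t b m)"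
      proof (rule A(3)[OF assms(4) m(1,2)])
        show "A * (real m * (1 + ln (real n / real m))) \<le> real k" using m(5) j(3) by linarith
        show "0 < C * psi_quot s a t b m" using C m psi_quot_pos[of m s a t b] by simp
        fix x y assume x: "x \<in> lball s a n" and y: "y \<in> carrier_vec n"
          and le: "\<And>j. j < n \<Longrightarrow> \<bar>y $ j\<bar> \<le> \<bar>x $ j\<bar>" "\<And>j. j < n \<Longrightarrow> \<bar>y $ j\<bar> \<le> \<delta> / psi s a m"
        have dx: "dim_vec x = n" using x by (auto simp: lball_def)
        show "lnorm t b y \<le> C * psi_quot s a t b m"
        proof (rule C(2), intro conjI allI impI)
          fix i assume i: "1 \<le> i \<and> i \<le> n"
          show "rearr y i \<le> rearr x i" using i x y le(1) dx by (intro rearr_le_rearr) auto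
          show "rearr y i \<le> \<delta> / psi s a m" using i y le(2) by (intro rearr_le_bound) auto
        qed (use m x y in auto)
      qed
      then have "ent s a t b n k \<le> C * psi_quot s a t b m" by (rule ent_le)
      also have "\<dots> \<le> C * (psi_quot s a t b (ell j n) / c)"
      proof (rule mult_left_mono)
        have "2 / \<theta> * real m \<le> max 1 (2 / \<theta>) * real m" by (intro mult_right_mono) auto
        then have "ell j n \<le> max 1 (2 / \<theta>) * real m" using m(3) by linarith
        moreover have "1 * ell j n \<le> max 1 (2 / \<theta>) * ell j n" using eh by (intro mult_right_mono) auto
        then have "real m \<le> max 1 (2 / \<theta>) * ell j n" using m(4) by linarith
        ultimately have "c * psi_quot s a t b m \<le> psi_quot s a t b (ell j n)"
          using m(1) eh by (intro c(2)) auto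
        then show "psi_quot s a t b m \<le> psi_quot s a t b (ell j n) / c" using c by (simp add: field_simps)
      qed (use C in simp)
      also have "\<dots> = C / c * psi_quot s a t b (ell j n)" by simp
      also have "\<dots> \<le> max (C / c) (C0 / \<phi>) * psi_quot s a t b (ell j n)" using q by (intro mult_right_mono) auto
      finally show ?thesis .
    next
      case False
      then have "ell j n \<le> 1 / \<theta>" using \<theta> by (simp add: field_simps)
      then have "\<phi> \<le> psi_quot s a t b (ell j n)"
        unfolding \<phi>_def psi_quot_def using eh assms \<theta>(1) psi_pos[of "ell j n"] psi_pos[of "1/2" t b] less_imp_le[OF psi_pos[of "ell j n" t b]]
        by (intro frac_le psi_mono) auto
      then have le: "C0 / \<phi> * \<phi> \<le> C0 / \<phi> * psi_quot s a t b (ell j n)" using C0 \<phi> by (intro mult_left_mono) auto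
      have n1: "1 \<le> n" using j by linarith
      have "ent s a t b n k \<le> C0" using C0(1) n1 assms(4) C0(2)[OF n1] by (rule ent_le_if_lnorm_le)
      also have "\<dots> \<le> C0 / \<phi> * psi_quot s a t b (ell j n)" using le \<phi> by simp
      also have "\<dots> \<le> max (C / c) (C0 / \<phi>) * psi_quot s a t b (ell j n)" using q by (intro mult_right_mono) auto
      finally show ?thesis .
    qed
  qed (use C c in \<open>simp add: less_max_iff_disj\<close>)
qed

text \<open>Words of length one over \<open>n\<close> letters are the \<open>n\<close> unit vectors
  up to scaling; for \<open>k \<le> ln n\<close> there are too few balls to separate them.\<close>

lemma ent_ge_const:
  assumes "0 \<le> s" "0 \<le> a" "0 \<le> t" "0 \<le> b"
  obtains c where "c > 0" "\<And>n k. 1 \<le> k \<Longrightarrow> real k \<le> ln (real n) \<Longrightarrow> c \<le> ent s a t b n k"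
proof -
  obtain c where c: "c > 0" "\<And>n m \<beta> k. 1 \<le> m \<Longrightarrow> 1 \<le> \<beta> \<Longrightarrow> m * \<beta> \<le> n \<Longrightarrow>
       2 ^ (k - 1) * (2 ^ m * real \<beta> powr (real m / 4)) < real \<beta> ^ m \<Longrightarrow>
       c * psi_quot s a t b m \<le> ent s a t b n k"
    using ent_ge_words[OF assms] unfolding psi_quot_def by blast
  show ?thesis
  proof (rule that[of "c * psi_quot s a t b (real 1)"])
    show "0 < c * psi_quot s a t b (real 1)" using c(1) by (simp add: psi_quot_pos)
    fix n k :: nat assume k: "1 \<le> k" "real k \<le> ln (real n)"
    then have n: "0 < n" "0 < ln (real n)" by (auto intro: gr0I)
    show "c * psi_quot s a t b (real 1) \<le> ent s a t b n k"
    proof (rule c(2)[of 1 n])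
      have "2 ^ (k - 1) * (2 ^ 1 * real n powr (real 1 / 4)) = 2 ^ k * real n powr (1 / 4)"
        using k by (cases k) auto
      also have "(2::real) ^ k = exp (real k * ln 2)" by (simp add: exp_of_nat_mult)
      also have "exp (real k * ln 2) * real n powr (1 / 4) = exp (real k * ln 2 + ln (real n) / 4)"
        using n by (simp add: powr_def exp_add)
      also have "\<dots> < exp (ln (real n))"
      proof -
        have "real k * ln 2 \<le> ln (real n) * ln 2" using k by (intro mult_right_mono) auto
        also have "\<dots> < ln (real n) * (3 / 4)" using n ln_2_less_three_quarters by (intro mult_strict_left_mono) auto
        finally show ?thesis by simp
      qed
      also have "\<dots> = real n ^ 1" using n by simp
      finally show "2 ^ (k - 1) * (2 ^ 1 * real n powr (real 1 / 4)) < real n ^ 1" .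
    qed (use n in auto)
  qed
qed

lemma ent_ge_mid:
  assumes "0 \<le> s" "0 \<le> a" "0 \<le> t" "0 \<le> b"
  obtains c where "c > 0" "\<And>n k. 1 \<le> k \<Longrightarrow> k \<le> n \<Longrightarrow> ln (real n) \<le> real k \<Longrightarrow>
    c * psi_quot s a t b (ell k n) \<le> ent s a t b n k"
proof -
  obtain c1 where c1: "c1 > 0" "\<And>n m \<beta> k. 1 \<le> m \<Longrightarrow> 1 \<le> \<beta> \<Longrightarrow> m * \<beta> \<le> n \<Longrightarrow>
       2 ^ (k - 1) * (2 ^ m * real \<beta> powr (real m / 4)) < real \<beta> ^ m \<Longrightarrow>
       c1 * psi_quot s a t b m \<le> ent s a t b n k"
    using ent_ge_words[OF assms] unfolding psi_quot_def by blast
  obtain c2 where c2: "c2 > 0" "\<And>n k. 1 \<le> n \<Longrightarrow> c2 * vol_rate s a t b n k \<le> ent s a t b n k"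
    using ent_ge_vol_rate[OF assms] by blast
  \<comment> \<open>If \<open>n < 1200 * k\<close>, then \<open>ln (n / k + 1) \<le> 1200\<close>
    and \<open>n < 1200 * k \<le> 1200 * 1200 * ell k n\<close>: \<open>n\<close> and
    \<open>ell k n\<close> are comparable and the volume bound suffices. Words are used for larger
    \<open>n\<close>.\<close>
  define K where "K = (1200 * 1200 :: real)"
  obtain c3 where c3: "c3 > 0" "\<And>x y. 1 / 2 \<le> x \<Longrightarrow> 1 / 2 \<le> y \<Longrightarrow> y \<le> K * x \<Longrightarrow> x \<le> K * y \<Longrightarrow>
    c3 * psi_quot s a t b y \<le> psi_quot s a t b x"
    using psi_quot_ge_const_mult[OF assms, of K] by (auto simp: K_def)
  show ?thesis
  proof (rule that[of "min (c1 * c3) (c2 / 2 * c3)"])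
    fix n k :: nat assume k: "1 \<le> k" "k \<le> n" "ln (real n) \<le> real k"
    have eh: "1 / 2 \<le> ell k n" by (rule ell_ge_half[OF k])
    then have q: "0 < psi_quot s a t b (ell k n)" by (intro psi_quot_pos) auto
    have e2: "ell k n \<le> 2 * real k" using ell_bounds[OF k(1,2)] by simp
    define L where "L = ln (real n / real k + 1)"
    have L: "1 / 2 \<le> L" using ln_ratio_ge[OF k(1,2)] by (simp add: L_def)
    have ell: "ell k n = real k / L" by (simp add: ell_def L_def)
    show "min (c1 * c3) (c2 / 2 * c3) * psi_quot s a t b (ell k n) \<le> ent s a t b n k"
    proof (cases "1200 * real k \<le> real n")
      case False
      have "L \<le> real n / real k" using ln_add_one_self_le_self[of "real n / real k"] by (simp add: L_def add.commute)
      also have "\<dots> \<le> 1200" using False k by (simp add: field_simps)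
      finally have "real k \<le> 1200 * ell k n" using k L by (simp add: ell field_simps)
      then have nK: "real n \<le> K * ell k n" using False by (simp add: K_def)
      have "2 * real n \<le> K * real n" by (simp add: K_def)
      then have "ell k n \<le> K * real n" using e2 k by linarith
      then have "c3 * psi_quot s a t b (ell k n) \<le> psi_quot s a t b n"
        using eh nK k by (intro c3(2)) auto
      then have "c2 / 2 * (c3 * psi_quot s a t b (ell k n)) \<le> c2 / 2 * psi_quot s a t b n"
        using c2 by (intro mult_left_mono) auto
      also have "\<dots> \<le> c2 * vol_rate s a t b n k"
      proof -
        have "real k / real n \<le> 1" using k by simp
        then have "2 powr (- 1) \<le> 2 powr (- (real k / real n))" by (intro powr_mono) auto
        then have "(1 / 2) * psi_quot s a t b n \<le> vol_rate s a t b n k"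
          unfolding vol_rate_def using k psi_quot_pos[of n s a t b] by (intro mult_right_mono) (auto simp: powr_minus)
        then show ?thesis using c2 by simp
      qed
      also have "\<dots> \<le> ent s a t b n k" using k by (intro c2(2)) auto
      finally have "c2 / 2 * c3 * psi_quot s a t b (ell k n) \<le> ent s a t b n k" by simp
      moreover have "min (c1 * c3) (c2 / 2 * c3) * psi_quot s a t b (ell k n) \<le> c2 / 2 * c3 * psi_quot s a t b (ell k n)"
        using q by (intro mult_right_mono) auto
      ultimately show ?thesis by linarith
    next
      case True
      define x where "x = real n / real k"
      have x: "1200 \<le> x" using True k by (simp add: x_def field_simps)
      have Lx: "L = ln (x + 1)" by (simp add: L_def x_def)
      have L4: "4 * ln 2 \<le> L"
      proof -
        have "4 * ln 2 = ln (2 ^ 4 :: real)" by (subst ln_realpow) auto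
        also have "\<dots> \<le> L" unfolding Lx using x by (intro ln_mono) auto
        finally show ?thesis .
      qed
      have L1: "1 \<le> L" using L4 ln_2_ge_half by linarith
      have ek: "ell k n \<le> real k" using L1 by (simp add: ell divide_le_eq mult_le_cancel_left1)
      \<comment> \<open>The factor 16 yields \<open>k \<le> m * L / 16\<close>. Since
        \<open>4 * ln 2 \<le> L \<le> 2 * ln \<beta>\<close>, the costs \<open>k * ln 2\<close>,
        \<open>m * ln 2\<close> and \<open>m / 4 * ln \<beta>\<close> are at most
        \<open>1/8\<close>, \<open>1/2\<close> and \<open>1/4\<close> of
        \<open>m * ln \<beta>\<close>, which leaves a strict inequality.\<close>
      define m where "m = nat \<lceil>16 * ell k n\<rceil>"
      have rm: "real m = real_of_int \<lceil>16 * ell k n\<rceil>" using eh by (simp add: m_def)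
      have mge: "16 * ell k n \<le> real m" unfolding rm by simp
      have mle: "real m \<le> 16 * ell k n + 1" unfolding rm by linarith
      have "0 < real m" using mge eh by linarith
      then have m1: "1 \<le> m" by simp
      have m17: "real m \<le> 17 * real k" using mle ek k(1) by linarith
      define \<beta> where "\<beta> = n div m"
      have mb: "m * \<beta> \<le> n" by (simp add: \<beta>_def)
      have "real n < real m * (real \<beta> + 1)"
      proof -
        have "n < m * (\<beta> + 1)" using m1 dividend_less_times_div[of m n] by (simp add: \<beta>_def)
        then have "real n < real (m * (\<beta> + 1))" by (simp only: of_nat_less_iff)
        then show ?thesis by (simp add: algebra_simps)
      qed
      also have "\<dots> \<le> 17 * real k * (real \<beta> + 1)" using m17 by (intro mult_right_mono) auto
      finally have "x < 17 * (real \<beta> + 1)" using k by (simp add: x_def field_simps)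
      then have \<beta>x: "x / 34 \<le> real \<beta>" using x by simp
      \<comment> \<open>After both roundings \<open>\<beta> \<ge> x / 34\<close>; as
        \<open>34\<^sup>2 = 1156\<close>, the assumption \<open>x \<ge> 1200\<close> gives
        \<open>\<beta>\<^sup>2 \<ge> x + 1\<close>, so \<open>ln \<beta>\<close> keeps half of
        \<open>L\<close>.\<close>
      have bsq: "x + 1 \<le> (real \<beta>)\<^sup>2"
      proof -
        have "1200 * x \<le> x * x" using x by (intro mult_right_mono) auto
        then have "1156 * x + 1156 \<le> x * x" using x by linarith
        then have "x + 1 \<le> x * x / 1156" by simp
        also have "\<dots> = (x / 34)\<^sup>2" by (simp add: power2_eq_square)
        also have "\<dots> \<le> (real \<beta>)\<^sup>2" using \<beta>x x by (intro power_mono) auto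
        finally show ?thesis .
      qed
      have b1: "1 \<le> \<beta>" using \<beta>x x by (cases \<beta>) auto
      have Lb: "L \<le> 2 * ln (real \<beta>)"
      proof -
        have "L \<le> ln ((real \<beta>)\<^sup>2)" unfolding Lx using bsq x by (intro ln_mono) auto
        also have "\<dots> = 2 * ln (real \<beta>)" using b1 by (simp add: ln_realpow)
        finally show ?thesis .
      qed
      have "c1 * psi_quot s a t b m \<le> ent s a t b n k"
      proof (rule c1(2)[OF m1 b1 mb])
        have "2 ^ (k - 1) * (2 ^ m * real \<beta> powr (real m / 4)) \<le> 2 ^ k * (2 ^ m * real \<beta> powr (real m / 4))"
          by (intro mult_right_mono power_increasing) auto
        also have "\<dots> = exp (real k * ln 2 + (real m * ln 2 + real m / 4 * ln (real \<beta>)))"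
          using b1 by (simp add: exp_add exp_of_nat_mult powr_def)
        also have "\<dots> < exp (real m * ln (real \<beta>))"
        proof -
          have mL: "16 * real k \<le> real m * L" using mge L1 by (simp add: ell field_simps)
          have "real k * ln 2 \<le> real k * 1" using ln_2_less_1 by (intro mult_left_mono) auto
          moreover have "real m * (4 * ln 2) \<le> real m * L" using L4 by (intro mult_left_mono) auto
          moreover have "real m * L \<le> real m * (2 * ln (real \<beta>))" using Lb by (intro mult_left_mono) auto
          moreover have "0 < real m * L" using m1 L1 by simp
          ultimately show ?thesis using mL by simp
        qed
        also have "\<dots> = real \<beta> ^ m" using b1 by (simp add: exp_of_nat_mult)
        finally show "2 ^ (k - 1) * (2 ^ m * real \<beta> powr (real m / 4)) < real \<beta> ^ m" .
      qed
      moreover have "c1 * (c3 * psi_quot s a t b (ell k n)) \<le> c1 * psi_quot s a t b m"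
      proof (rule mult_left_mono)
        have "real m \<le> K * ell k n" using mle eh by (simp add: K_def)
        moreover have "ell k n \<le> K * real m" using mge eh by (simp add: K_def)
        ultimately show "c3 * psi_quot s a t b (ell k n) \<le> psi_quot s a t b m"
          using eh m1 by (intro c3(2)) auto
      qed (use c1 in simp)
      moreover have "min (c1 * c3) (c2 / 2 * c3) * psi_quot s a t b (ell k n) \<le> c1 * c3 * psi_quot s a t b (ell k n)"
        using q by (intro mult_right_mono) auto
      ultimately show ?thesis by simp
    qed
  qed (use c1 c2 c3 in simp)
qed

lemma asymp_id_decay:
  assumes "0 \<le> s" "0 \<le> a" "0 \<le> t" "0 \<le> b" "id_decay s a t b"
  shows "asymp_equal_on (\<lambda>n k. real k \<le> ln (real n)) (ent s a t b) (\<lambda>n k. 1)"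
    and "asymp_equal_on (\<lambda>n k. ln (real n) \<le> real k \<and> k \<le> n) (ent s a t b) (\<lambda>n k. psi_quot s a t b (ell k n))"
    and "asymp_equal_on (\<lambda>n k. n \<le> k) (ent s a t b) (vol_rate s a t b)"
proof -
  obtain C0 where C0: "C0 > 0" "\<And>n x. 1 \<le> n \<Longrightarrow> x \<in> lball s a n \<Longrightarrow> lnorm t b x \<le> C0"
    using id_decay_lnorm_le[OF assms(1,2,5)] by blast
  obtain c1 where c1: "c1 > 0" "\<And>n k. 1 \<le> k \<Longrightarrow> real k \<le> ln (real n) \<Longrightarrow> c1 \<le> ent s a t b n k"
    using ent_ge_const[OF assms(1-4)] by blast
  have "ent s a t b n k \<le> C0" if "1 \<le> n" for n k
    by (rule ent_le_if_lnorm_le) (use C0 that assms in auto)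
  then show "asymp_equal_on (\<lambda>n k. real k \<le> ln (real n)) (ent s a t b) (\<lambda>n k. 1)"
    unfolding asymp_equal_on_def using c1 C0(1) by (rule_tac exI[of _ c1], rule_tac exI[of _ C0]) auto
  obtain C where C: "C > 0" "\<And>n k j. 1 \<le> j \<Longrightarrow> j \<le> n \<Longrightarrow> j \<le> k \<Longrightarrow> ln (real n) \<le> real j \<Longrightarrow>
    ent s a t b n k \<le> C * psi_quot s a t b (ell j n)"
    using ent_le_id_decay[OF assms] by blast
  obtain c where c: "c > 0" "\<And>n k. 1 \<le> k \<Longrightarrow> k \<le> n \<Longrightarrow> ln (real n) \<le> real k \<Longrightarrow>
    c * psi_quot s a t b (ell k n) \<le> ent s a t b n k"
    using ent_ge_mid[OF assms(1-4)] by blast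
  show "asymp_equal_on (\<lambda>n k. ln (real n) \<le> real k \<and> k \<le> n) (ent s a t b) (\<lambda>n k. psi_quot s a t b (ell k n))"
    unfolding asymp_equal_on_def
  proof (intro exI conjI allI impI)
    fix n k :: nat assume "1 \<le> n" "1 \<le> k" "ln (real n) \<le> real k \<and> k \<le> n"
    then show "c * psi_quot s a t b (ell k n) \<le> ent s a t b n k" "ent s a t b n k \<le> C * psi_quot s a t b (ell k n)"
      using c(2)[of k n] C(2)[of k n k] by auto
  qed (use c C in auto)
  obtain c3 where c3: "c3 > 0" "\<And>x y. 1 / 2 \<le> x \<Longrightarrow> 1 / 2 \<le> y \<Longrightarrow> y \<le> 2 * x \<Longrightarrow> x \<le> 2 * y \<Longrightarrow>
    c3 * psi_quot s a t b y \<le> psi_quot s a t b x"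
    using psi_quot_ge_const_mult[OF assms(1-4), of 2] by auto
  obtain C' where C': "C' > 0" "\<And>n k. 1 \<le> n \<Longrightarrow> 1 \<le> k \<Longrightarrow> n \<le> k \<Longrightarrow> ent s a t b n k \<le> C' * vol_rate s a t b n k"
  proof (rule ent_le_vol_rate[OF assms(1-4), of "C / c3" "\<lambda>n k. n \<le> k"])
    fix n k :: nat assume n: "1 \<le> n" "n \<le> k"
    \<comment> \<open>At budget \<open>n\<close>, \<open>ell n n = n / ln 2\<close> is comparable
      with \<open>n\<close>, so the middle range hands over the bound by \<open>psi_quot\<close> at
      \<open>n\<close>.\<close>
    have en: "ell n n = real n / ln 2" using n by (simp add: ell_def)
    have ln_le: "ln (real n) \<le> real n" using ln_le_minus_one[of "real n"] n by simp
    have "ent s a t b n k \<le> C * psi_quot s a t b (ell n n)" using n ln_le by (intro C(2)) auto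
    also have "\<dots> \<le> C * (psi_quot s a t b n / c3)"
    proof (rule mult_left_mono)
      have "real n * ln 2 \<le> real n * 1" using ln_2_less_1 by (intro mult_left_mono) auto
      then have "real n \<le> ell n n" unfolding en by (simp add: field_simps)
      moreover have "ell n n \<le> 2 * real n" using ell_bounds[of n n] n by simp
      ultimately have "c3 * psi_quot s a t b (ell n n) \<le> psi_quot s a t b n" using n by (intro c3(2)) auto
      then show "psi_quot s a t b (ell n n) \<le> psi_quot s a t b n / c3" using c3 by (simp add: field_simps)
    qed (use C in simp)
    finally show "ent s a t b n k \<le> C / c3 * psi_quot s a t b n" by simp
  qed (use C c3 in auto)
  obtain c' where c': "c' > 0" "\<And>n k. 1 \<le> n \<Longrightarrow> c' * vol_rate s a t b n k \<le> ent s a t b n k"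
    using ent_ge_vol_rate[OF assms(1-4)] by blast
  show "asymp_equal_on (\<lambda>n k. n \<le> k) (ent s a t b) (vol_rate s a t b)"
    unfolding asymp_equal_on_def using c' C' by blast
qed

text \<open>The restriction \<open>ln n \<le> j\<close> is absent here. If
  \<open>\<theta> * ell j n < 1\<close>, then \<open>j\<close> is below \<open>L / \<theta>\<close>,
  so \<open>ln n = ln (n / j) + ln j\<close> is itself of order \<open>L\<close> and the norm of the
  identity, estimated with \<open>m = 1\<close>, is good enough.\<close>

lemma ent_le_log:
  assumes "0 < s" "0 \<le> a" "a < b"
  obtains C where "C > 0" "\<And>n k j. 1 \<le> j \<Longrightarrow> j \<le> n \<Longrightarrow> j \<le> k \<Longrightarrow>
    ent s a s b n k \<le> C * ln (real n / real j + 1) powr (b - a)"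
proof -
  have s0: "0 \<le> s" and b0: "0 \<le> b" using assms by simp_all
  obtain A \<delta> where A: "A > 0" "\<delta> > 0"
    "\<And>t b n m k \<epsilon>. 0 \<le> b \<Longrightarrow> 1 \<le> m \<Longrightarrow> m \<le> n \<Longrightarrow> A * (real m * (1 + ln (real n / real m))) \<le> real k \<Longrightarrow> 0 < \<epsilon> \<Longrightarrow>
      (\<And>x y. x \<in> lball s a n \<Longrightarrow> y \<in> carrier_vec n \<Longrightarrow> (\<And>j. j < n \<Longrightarrow> \<bar>y $ j\<bar> \<le> \<bar>x $ j\<bar>) \<Longrightarrow>
         (\<And>j. j < n \<Longrightarrow> \<bar>y $ j\<bar> \<le> \<delta> / psi s a m) \<Longrightarrow> lnorm t b y \<le> \<epsilon>) \<Longrightarrow>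
      covers s a t b n k \<epsilon>"
    using covers_coarse[OF s0 assms(2)] by blast
  obtain C1 where C1: "C1 > 0" "\<And>n x i. x \<in> lball s a n \<Longrightarrow> 1 \<le> i \<Longrightarrow> i \<le> n \<Longrightarrow> rearr x i \<le> C1 / psi s a i"
    using rearr_le_psi[OF s0 assms(2)] by blast
  \<comment> \<open>One level for both uses: rounding errors are at most
    \<open>\<delta> / psi m\<close>, untruncated vectors of the ball at most
    \<open>C1 / psi 1\<close>.\<close>
  define \<delta>' where "\<delta>' = max \<delta> C1"
  have \<delta>': "\<delta>' > 0" "\<delta> \<le> \<delta>'" "C1 \<le> \<delta>'" using A by (auto simp: \<delta>'_def)
  obtain C where C: "C > 0" "\<And>n m x y. 1 \<le> m \<Longrightarrow> m \<le> n \<Longrightarrow> x \<in> lball s a n \<Longrightarrow> y \<in> carrier_vec n \<Longrightarrow>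
     (\<And>i. 1 \<le> i \<Longrightarrow> i \<le> n \<Longrightarrow> rearr y i \<le> rearr x i \<and> rearr y i \<le> \<delta>' / psi s a m) \<Longrightarrow>
     lnorm s b y \<le> C * (1 + ln (real n / real m)) powr (b - a)"
    using lnorm_truncated_same_s[OF assms \<delta>'(1)] by blast
  obtain \<theta> D where \<theta>: "0 < \<theta>" "D > 0"
    "\<And>n k. 1 \<le> k \<Longrightarrow> k \<le> n \<Longrightarrow> 1 \<le> \<theta> * ell k n \<Longrightarrow>
      \<exists>m\<ge>1. m \<le> n \<and> ell k n \<le> 2 / \<theta> * real m \<and> real m \<le> ell k n \<and>
        A * (real m * (1 + ln (real n / real m))) \<le> real k \<and> 1 + ln (real n / real m) \<le> D * ln (real n / real k + 1)"
    using choose_support_size[OF A(1)] by blast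
  define E where "E = max D (3 + 1 / \<theta>)"
  have E: "E > 0" using \<theta> by (simp add: E_def less_max_iff_disj)
  show ?thesis
  proof (rule that[of "C * E powr (b - a)"])
    fix n k j :: nat assume j: "1 \<le> j" "j \<le> n" "j \<le> k"
    define L where "L = ln (real n / real j + 1)"
    have L: "1 / 2 \<le> L" using ln_ratio_ge[OF j(1,2)] by (simp add: L_def)
    have ell: "ell j n = real j / L" by (simp add: ell_def L_def)
    have "\<exists>m\<ge>1. m \<le> n \<and> 1 + ln (real n / real m) \<le> E * L \<and> covers s a s b n k (C * (1 + ln (real n / real m)) powr (b - a))"
    proof (cases "1 \<le> \<theta> * ell j n")
      case True
      then obtain m where m: "m \<ge> 1" "m \<le> n"
        "A * (real m * (1 + ln (real n / real m))) \<le> real j" "1 + ln (real n / real m) \<le> D * L"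
        using \<theta>(3)[OF j(1,2)] unfolding L_def by blast
      have "D * L \<le> E * L" using L by (intro mult_right_mono) (auto simp: E_def)
      moreover have "covers s a s b n k (C * (1 + ln (real n / real m)) powr (b - a))"
      proof (rule A(3)[OF b0 m(1,2)])
        show "A * (real m * (1 + ln (real n / real m))) \<le> real k" using m(3) j(3) by linarith
        have "0 < 1 + ln (real n / real m)" using m by (intro add_pos_nonneg) auto
        then show "0 < C * (1 + ln (real n / real m)) powr (b - a)" using C by simp
        fix x y assume x: "x \<in> lball s a n" and y: "y \<in> carrier_vec n"
          and le: "\<And>j. j < n \<Longrightarrow> \<bar>y $ j\<bar> \<le> \<bar>x $ j\<bar>" "\<And>j. j < n \<Longrightarrow> \<bar>y $ j\<bar> \<le> \<delta> / psi s a m"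
        have dx: "dim_vec x = n" using x by (auto simp: lball_def)
        show "lnorm s b y \<le> C * (1 + ln (real n / real m)) powr (b - a)"
        proof (rule C(2)[OF m(1,2) x y], rule conjI)
          fix i assume i: "1 \<le> i" "i \<le> n"
          show "rearr y i \<le> rearr x i" using i x y le(1) dx by (intro rearr_le_rearr) auto
          have "rearr y i \<le> \<delta> / psi s a m" using i y le(2) by (intro rearr_le_bound) auto
          also have "\<dots> \<le> \<delta>' / psi s a m" using \<delta>' m psi_pos[of m s a] by (intro divide_right_mono) auto
          finally show "rearr y i \<le> \<delta>' / psi s a m" .
        qed
      qed
      ultimately show ?thesis using m by (intro exI[of _ m]) auto
    next
      case False
      have "covers s a s b n k (C * (1 + ln (real n / real 1)) powr (b - a))"
      proof (rule covers_if_lnorm_le)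
        have "0 < 1 + ln (real n / real 1)" using j by (intro add_pos_nonneg) auto
        then show "0 < C * (1 + ln (real n / real 1)) powr (b - a)" using C by simp
        fix x assume x: "x \<in> lball s a n"
        then have xc: "x \<in> carrier_vec n" by (simp add: lball_def)
        show "lnorm s b x \<le> C * (1 + ln (real n / real 1)) powr (b - a)"
        proof (rule C(2)[of 1 n x x], rule_tac [5] conjI)
          fix i assume i: "1 \<le> i" "i \<le> n"
          have "rearr x i \<le> rearr x 1" using i xc by (intro rearr_antimono) auto
          also have "\<dots> \<le> C1 / psi s a (real 1)" using j by (intro C1(2)[OF x]) auto
          also have "\<dots> \<le> \<delta>' / psi s a (real 1)" using \<delta>' psi_pos[of 1 s a] by (intro divide_right_mono) auto
          finally show "rearr x i \<le> \<delta>' / psi s a (real 1)" .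
        qed (use x xc j in auto)
      qed (use j b0 in auto)
      moreover have "1 + ln (real n / real 1) \<le> E * L"
      proof -
        have "real j \<le> 1 / \<theta> * L" using False \<theta> L by (simp add: ell field_simps)
        moreover have "ln (real j) \<le> real j" using ln_le_minus_one[of "real j"] j by simp
        moreover have "ln (real n) = ln (real n / real j) + ln (real j)" using j by (simp add: ln_div)
        moreover have "ln (real n / real j) \<le> L" unfolding L_def using j by (intro ln_mono) auto
        ultimately have "1 + ln (real n) \<le> 2 * L + L + 1 / \<theta> * L" using L by linarith
        also have "\<dots> = (3 + 1 / \<theta>) * L" by (simp add: algebra_simps)
        also have "\<dots> \<le> E * L" using L by (intro mult_right_mono) (auto simp: E_def)
        finally show ?thesis by simp
      qed
      ultimately show ?thesis using j by (intro exI[of _ 1]) auto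
    qed
    then obtain m where m: "m \<ge> 1" "m \<le> n" "1 + ln (real n / real m) \<le> E * L"
      "covers s a s b n k (C * (1 + ln (real n / real m)) powr (b - a))" by blast
    have "ent s a s b n k \<le> C * (1 + ln (real n / real m)) powr (b - a)" by (rule ent_le[OF m(4)])
    also have "\<dots> \<le> C * (E * L) powr (b - a)"
    proof -
      have "0 \<le> 1 + ln (real n / real m)" using m by (intro add_nonneg_nonneg) auto
      then show ?thesis using C m(3) assms by (intro mult_left_mono powr_mono2) auto
    qed
    also have "\<dots> = C * E powr (b - a) * L powr (b - a)" by (simp add: powr_mult)
    finally show "ent s a s b n k \<le> C * E powr (b - a) * ln (real n / real j + 1) powr (b - a)" by (simp add: L_def)
  qed (use C E in simp)
qed

lemma asymp_log:
  assumes "0 < s" "0 \<le> a" "a < b"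
  shows "asymp_equal_on (\<lambda>n k. k \<le> n) (ent s a s b) (\<lambda>n k. ln (real n / real k + 1) powr (b - a))"
    and "asymp_equal_on (\<lambda>n k. n \<le> k) (ent s a s b) (vol_rate s a s b)"
proof -
  have nn: "0 \<le> s" "0 \<le> a" "0 \<le> s" "0 \<le> b" using assms by simp_all
  have q1: "psi_quot s a s b (real n) = 1" if "1 \<le> n" for n using that assms by (simp add: psi_quot_def psi_def)
  obtain C where C: "C > 0" "\<And>n k j. 1 \<le> j \<Longrightarrow> j \<le> n \<Longrightarrow> j \<le> k \<Longrightarrow>
    ent s a s b n k \<le> C * ln (real n / real j + 1) powr (b - a)"
    using ent_le_log[OF assms] by blast
  obtain c1 K where c1: "c1 > 0" "K > 0"
    "\<And>n k. 1 \<le> k \<Longrightarrow> K * real k \<le> real n \<Longrightarrow> c1 * ln (real n / real k + 1) powr (b - a) \<le> ent s a s b n k"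
    using ent_ge_log[OF assms] by blast
  obtain c2 where c2: "c2 > 0" "\<And>n k. 1 \<le> n \<Longrightarrow> c2 * vol_rate s a s b n k \<le> ent s a s b n k"
    using ent_ge_vol_rate[OF nn] by blast
  \<comment> \<open>Serves \<open>k\<close> between \<open>n / K\<close> and \<open>n\<close>: there
    the logarithm is at most \<open>K\<close>, while \<open>vol_rate\<close> is at least
    \<open>1 / 2\<close>.\<close>
  define c3 where "c3 = c2 / 2 * (1 / K powr (b - a))"
  have c3: "c3 > 0" using c2 c1 by (simp add: c3_def)
  have lower: "min c1 c3 * ln (real n / real k + 1) powr (b - a) \<le> ent s a s b n k" if k: "1 \<le> k" "k \<le> n" for n k
  proof (cases "K * real k \<le> real n")
    case True
    have "min c1 c3 * ln (real n / real k + 1) powr (b - a) \<le> c1 * ln (real n / real k + 1) powr (b - a)"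
      by (intro mult_right_mono) auto
    also have "\<dots> \<le> ent s a s b n k" by (rule c1(3)[OF k(1) True])
    finally show ?thesis .
  next
    case False
    have "ln (real n / real k + 1) \<le> real n / real k"
      using ln_add_one_self_le_self[of "real n / real k"] by (simp add: add.commute)
    also have "\<dots> \<le> K" using False k by (simp add: field_simps)
    finally have "ln (real n / real k + 1) powr (b - a) \<le> K powr (b - a)"
      using ln_ratio_ge(2)[OF k] assms by (intro powr_mono2) auto
    then have "c3 * ln (real n / real k + 1) powr (b - a) \<le> c3 * K powr (b - a)" using c3 by (intro mult_left_mono) auto
    also have "\<dots> = c2 * (1 / 2)" using c1 by (simp add: c3_def)
    also have "\<dots> \<le> c2 * vol_rate s a s b n k"
    proof (rule mult_left_mono)
      have "real k / real n \<le> 1" using k by simp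
      then have "2 powr (- 1) \<le> 2 powr (- (real k / real n))" by (intro powr_mono) auto
      then show "1 / 2 \<le> vol_rate s a s b n k" using q1[of n] k by (simp add: vol_rate_def powr_minus)
    qed (use c2 in simp)
    also have "\<dots> \<le> ent s a s b n k" using k by (intro c2(2)) auto
    finally have "c3 * ln (real n / real k + 1) powr (b - a) \<le> ent s a s b n k" .
    moreover have "min c1 c3 * ln (real n / real k + 1) powr (b - a) \<le> c3 * ln (real n / real k + 1) powr (b - a)"
      by (intro mult_right_mono) auto
    ultimately show ?thesis by linarith
  qed
  show "asymp_equal_on (\<lambda>n k. k \<le> n) (ent s a s b) (\<lambda>n k. ln (real n / real k + 1) powr (b - a))"
    unfolding asymp_equal_on_def
  proof (intro exI conjI allI impI)
    fix n k :: nat assume "1 \<le> n" "1 \<le> k" "k \<le> n"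
    then show "min c1 c3 * ln (real n / real k + 1) powr (b - a) \<le> ent s a s b n k"
      "ent s a s b n k \<le> C * ln (real n / real k + 1) powr (b - a)"
      using lower C(2)[of k n k] by auto
  qed (use c1 c3 C in auto)
  obtain C' where C': "C' > 0" "\<And>n k. 1 \<le> n \<Longrightarrow> 1 \<le> k \<Longrightarrow> n \<le> k \<Longrightarrow> ent s a s b n k \<le> C' * vol_rate s a s b n k"
  proof (rule ent_le_vol_rate[OF nn, of "C * ln 2 powr (b - a)" "\<lambda>n k. n \<le> k"])
    fix n k :: nat assume n: "1 \<le> n" "n \<le> k"
    then show "ent s a s b n k \<le> C * ln 2 powr (b - a) * psi_quot s a s b n"
      using C(2)[of n n k] q1[of n] by simp
  qed (use C in auto)
  show "asymp_equal_on (\<lambda>n k. n \<le> k) (ent s a s b) (vol_rate s a s b)"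
    unfolding asymp_equal_on_def using c2 C' by blast
qed

section \<open>Combination of ranges and cases\<close>

lemma asymp_equal_on_trans_sym:
  assumes "asymp_equal_on R f h" "asymp_equal_on R g h"
  shows "asymp_equal_on R f g"
proof -
  obtain c1 C1 where 1: "0 < c1" "0 < C1" "\<And>n k. 1 \<le> n \<Longrightarrow> 1 \<le> k \<Longrightarrow> R n k \<Longrightarrow> c1 * h n k \<le> f n k \<and> f n k \<le> C1 * h n k"
    using assms(1) unfolding asymp_equal_on_def by blast
  obtain c2 C2 where 2: "0 < c2" "0 < C2" "\<And>n k. 1 \<le> n \<Longrightarrow> 1 \<le> k \<Longrightarrow> R n k \<Longrightarrow> c2 * h n k \<le> g n k \<and> g n k \<le> C2 * h n k"
    using assms(2) unfolding asymp_equal_on_def by blast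
  show ?thesis unfolding asymp_equal_on_def
  proof (rule exI[of _ "c1 / C2"], rule exI[of _ "C1 / c2"], intro conjI allI impI)
    fix n k :: nat assume nk: "1 \<le> n" "1 \<le> k" "R n k"
    have "c1 / C2 * g n k \<le> c1 / C2 * (C2 * h n k)" using 1 2 nk by (intro mult_left_mono) auto
    also have "\<dots> = c1 * h n k" using 2 by simp
    also have "\<dots> \<le> f n k" using 1 nk by blast
    finally show "c1 / C2 * g n k \<le> f n k" .
    have "f n k \<le> C1 * h n k" using 1 nk by blast
    also have "\<dots> = C1 / c2 * (c2 * h n k)" using 2 by simp
    also have "\<dots> \<le> C1 / c2 * g n k" using 1 2 nk by (intro mult_left_mono) auto
    finally show "f n k \<le> C1 / c2 * g n k" .
  qed (use 1 2 in auto)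
qed

lemma asymp_equal_on_disj:
  assumes "asymp_equal_on R f g" "asymp_equal_on R' f g" "\<And>n k. 1 \<le> n \<Longrightarrow> 0 \<le> g n k"
  shows "asymp_equal_on (\<lambda>n k. R n k \<or> R' n k) f g"
proof -
  obtain c1 C1 where 1: "0 < c1" "0 < C1" "\<And>n k. 1 \<le> n \<Longrightarrow> 1 \<le> k \<Longrightarrow> R n k \<Longrightarrow> c1 * g n k \<le> f n k \<and> f n k \<le> C1 * g n k"
    using assms(1) unfolding asymp_equal_on_def by blast
  obtain c2 C2 where 2: "0 < c2" "0 < C2" "\<And>n k. 1 \<le> n \<Longrightarrow> 1 \<le> k \<Longrightarrow> R' n k \<Longrightarrow> c2 * g n k \<le> f n k \<and> f n k \<le> C2 * g n k"
    using assms(2) unfolding asymp_equal_on_def by blast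
  show ?thesis unfolding asymp_equal_on_def
  proof (rule exI[of _ "min c1 c2"], rule exI[of _ "max C1 C2"], intro conjI allI impI)
    fix n k :: nat assume nk: "1 \<le> n" "1 \<le> k" "R n k \<or> R' n k"
    have g: "0 \<le> g n k" by (rule assms(3)[OF nk(1)])
    have le: "min c1 c2 * g n k \<le> c1 * g n k" "min c1 c2 * g n k \<le> c2 * g n k"
      "C1 * g n k \<le> max C1 C2 * g n k" "C2 * g n k \<le> max C1 C2 * g n k"
      using g by (intro mult_right_mono; simp)+
    show "min c1 c2 * g n k \<le> f n k" using le 1(3)[OF nk(1,2)] 2(3)[OF nk(1,2)] nk(3) by linarith
    show "f n k \<le> max C1 C2 * g n k" using le 1(3)[OF nk(1,2)] 2(3)[OF nk(1,2)] nk(3) by linarith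
  qed (use 1 2 in auto)
qed

text \<open>For \<open>s, t > 0\<close> the function \<open>psi\<close> ignores the second index,
  hence so do all rates. Both sides are compared with the same rate, on one range if
  \<open>s < t\<close> and on three ranges that exhaust all \<open>k\<close> otherwise.\<close>

lemma asymp_second_index:
  assumes "0 < s" "0 < t" "s \<noteq> t" "0 \<le> a" "0 \<le> b" "0 \<le> a'" "0 \<le> b'"
  shows "asymp_equal_on (\<lambda>n k. True) (ent s a t b) (ent s a' t b')"
proof -
  have s0: "0 \<le> s" "0 \<le> t" using assms by simp_all
  have ps: "psi s c = psi s c'" "psi t c = psi t c'" for c c' using assms by (simp_all add: psi_def fun_eq_iff)
  have vol: "vol_rate s a t b = vol_rate s a' t b'"
    using ps(1)[of a a'] ps(2)[of b b'] by (simp add: vol_rate_def psi_quot_def fun_eq_iff)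
  have quo: "(\<lambda>n k. psi_quot s a t b (ell k n)) = (\<lambda>n k. psi_quot s a' t b' (ell k n))"
    using ps(1)[of a a'] ps(2)[of b b'] by (simp add: psi_quot_def)
  show ?thesis
  proof (cases "s < t")
    case True
    then have "asymp_equal_on (\<lambda>n k. True) (ent s c t d) (vol_rate s c t d)" if "0 \<le> c" "0 \<le> d" for c d
      using that s0 by (intro asymp_id_large id_large_if_less) auto
    from this[OF assms(4,5)] this[OF assms(6,7)] show ?thesis
      unfolding vol by (rule asymp_equal_on_trans_sym)
  next
    case False
    then have dec: "id_decay s c t d" if "0 \<le> c" "0 \<le> d" for c d
      using that s0 assms by (intro id_decay_if_less) auto
    note A = asymp_id_decay[OF s0(1) assms(4) s0(2) assms(5) dec[OF assms(4,5)]]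
    note A' = asymp_id_decay[OF s0(1) assms(6) s0(2) assms(7) dec[OF assms(6,7)]]
    have nn: "0 \<le> ent s a' t b' n k" if "1 \<le> n" for n k
      using that s0 assms by (intro ent_nonneg) auto
    have "asymp_equal_on (\<lambda>n k. (real k \<le> ln (real n) \<or> (ln (real n) \<le> real k \<and> k \<le> n)) \<or> n \<le> k) (ent s a t b) (ent s a' t b')"
      using asymp_equal_on_trans_sym[OF A(1) A'(1)] asymp_equal_on_trans_sym[OF A(2)[unfolded quo] A'(2)]
        asymp_equal_on_trans_sym[OF A(3)[unfolded vol] A'(3)]
      by (intro asymp_equal_on_disj nn)
    moreover have "(real k \<le> ln (real n) \<or> (ln (real n) \<le> real k \<and> k \<le> n)) \<or> n \<le> k" for n k :: nat
      by linarith
    ultimately show ?thesis by simp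
  qed
qed

text \<open>Property \<open>id_large\<close> gives (I), (III.1) and (IV.1), \<open>id_decay\<close>
  gives (II) and (IV.2), the logarithmic bounds give (III.2). The order of \<open>u\<close> and
  \<open>v\<close> is reversed between (III) and (IV) because at \<open>p = \<infinity>\<close> the
  second index enters \<open>psi\<close>: the flat vectors themselves then change.\<close>

theorem theorem1:
  fixes p q u v :: ennreal
  assumes "0 < p" and "0 < q" and "0 < u" and "0 < v"
  shows
    \<comment> \<open>(0)\<close>
    "(p \<noteq> q \<and> p < \<infinity> \<and> q < \<infinity> \<longrightarrow>
        asymp_equal_on (\<lambda>n k. True) (e_id p u q v) (e_id p p q q)) \<and>
    \<comment> \<open>(I)\<close>
    (q < p \<and> p = \<infinity> \<longrightarrow>
        asymp_equal_on (\<lambda>n k. True) (e_id \<infinity> u q v)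
          (\<lambda>n k. 2 powr (- (real k / real n)) * real n powr recip q
                   * ln (real n + 1) powr (- recip u))) \<and>
    \<comment> \<open>(II)\<close>
    (p < q \<and> q = \<infinity> \<longrightarrow>
        asymp_equal_on (\<lambda>n k. real k \<le> ln (real n)) (e_id p u \<infinity> v) (\<lambda>n k. 1) \<and>
        asymp_equal_on (\<lambda>n k. ln (real n) \<le> real k \<and> k \<le> n) (e_id p u \<infinity> v)
          (\<lambda>n k. ell k n powr (- recip p) * ln (ell k n + 1) powr recip v) \<and>
        asymp_equal_on (\<lambda>n k. n \<le> k) (e_id p u \<infinity> v)
          (\<lambda>n k. 2 powr (- (real k / real n)) * real n powr (- recip p)
                   * ln (real n + 1) powr recip v)) \<and>
    \<comment> \<open>(III)\<close>
    (p = q \<and> p < \<infinity> \<longrightarrow>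
        (u \<le> v \<longrightarrow>
          asymp_equal_on (\<lambda>n k. True) (e_id p u p v)
            (\<lambda>n k. 2 powr (- (real k / real n)))) \<and>
        (v < u \<longrightarrow>
          asymp_equal_on (\<lambda>n k. k \<le> n) (e_id p u p v)
            (\<lambda>n k. ln (real n / real k + 1) powr (recip v - recip u)) \<and>
          asymp_equal_on (\<lambda>n k. n \<le> k) (e_id p u p v)
            (\<lambda>n k. 2 powr (- (real k / real n))))) \<and>
    \<comment> \<open>(IV)\<close>
    (p = \<infinity> \<and> q = \<infinity> \<longrightarrow>
        (v \<le> u \<longrightarrow>
          asymp_equal_on (\<lambda>n k. True) (e_id \<infinity> u \<infinity> v)
            (\<lambda>n k. 2 powr (- (real k / real n))
                     * ln (real n + 1) powr (recip v - recip u))) \<and>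
        (u < v \<longrightarrow>
          asymp_equal_on (\<lambda>n k. real k \<le> ln (real n)) (e_id \<infinity> u \<infinity> v) (\<lambda>n k. 1) \<and>
          asymp_equal_on (\<lambda>n k. ln (real n) \<le> real k \<and> k \<le> n) (e_id \<infinity> u \<infinity> v)
            (\<lambda>n k. ln (ell k n + 1) powr (recip v - recip u)) \<and>
          asymp_equal_on (\<lambda>n k. n \<le> k) (e_id \<infinity> u \<infinity> v)
            (\<lambda>n k. 2 powr (- (real k / real n))
                     * ln (real n + 1) powr (recip v - recip u))))"
proof -
  have e: "e_id p' u' q' v' = ent (recip p') (recip u') (recip q') (recip v')" if "0 < u'" "0 < v'" for p' u' q' v'
    using e_id_eq_ent[OF that] by (intro ext)
  \<comment> \<open>Agreement with \<open>vol_rate\<close> is required for \<open>n \<ge> 1\<close>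
    only: in (III) the quotient of equal powers of \<open>n\<close> is 1 there, but not at
    \<open>n = 0\<close>.\<close>
  have vol_eq: "asymp_equal_on R f g" if "asymp_equal_on R f (vol_rate s a t b)"
    "\<And>n k. 1 \<le> n \<Longrightarrow> g n k = vol_rate s a t b n k" for R f g s a t b
    using that unfolding asymp_equal_on_def by simp
  have quot_eq: "asymp_equal_on (\<lambda>n k. ln (real n) \<le> real k \<and> k \<le> n) f g"
    if "asymp_equal_on (\<lambda>n k. ln (real n) \<le> real k \<and> k \<le> n) f (\<lambda>n k. psi_quot s a t b (ell k n))"
    "\<And>n k. g n k = psi_quot s a t b (ell k n)" for f g s a t b
  proof -
    have "g = (\<lambda>n k. psi_quot s a t b (ell k n))" using that(2) by (intro ext)
    then show ?thesis using that(1) by simp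
  qed
  let ?s = "recip p" and ?t = "recip q" and ?a = "recip u" and ?b = "recip v"
  have nn: "0 \<le> ?s" "0 \<le> ?t" "0 \<le> ?a" "0 \<le> ?b" by simp_all
  have "asymp_equal_on (\<lambda>n k. True) (e_id p u q v) (e_id p p q q)" if "p \<noteq> q" "p < \<infinity>" "q < \<infinity>"
    unfolding e[OF assms(3,4)] e[OF assms(1,2)]
    using that assms recip_eq_iff[OF assms(1,2)] recip_pos_iff[of p] recip_pos_iff[of q]
    by (intro asymp_second_index) auto
  moreover have "asymp_equal_on (\<lambda>n k. True) (e_id \<infinity> u q v)
          (\<lambda>n k. 2 powr (- (real k / real n)) * real n powr recip q * ln (real n + 1) powr (- recip u))"
    if "q < p" "p = \<infinity>"
  proof -
    have t: "0 < ?t" using that recip_pos_iff[OF assms(2)] by simp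
    then show ?thesis unfolding e[OF assms(3,4)] recip_top
      by (intro vol_eq[OF asymp_id_large[of 0 ?a ?t ?b]] id_large_if_less)
        (auto simp: vol_rate_def psi_quot_def psi_def powr_minus_divide)
  qed
  moreover have "asymp_equal_on (\<lambda>n k. real k \<le> ln (real n)) (e_id p u \<infinity> v) (\<lambda>n k. 1) \<and>
        asymp_equal_on (\<lambda>n k. ln (real n) \<le> real k \<and> k \<le> n) (e_id p u \<infinity> v)
          (\<lambda>n k. ell k n powr (- recip p) * ln (ell k n + 1) powr recip v) \<and>
        asymp_equal_on (\<lambda>n k. n \<le> k) (e_id p u \<infinity> v)
          (\<lambda>n k. 2 powr (- (real k / real n)) * real n powr (- recip p) * ln (real n + 1) powr recip v)"
    if "p < q" "q = \<infinity>"
  proof -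
    have s: "0 < ?s" using that recip_pos_iff[OF assms(1)] by simp
    have dec: "id_decay ?s ?a 0 ?b" using s by (intro id_decay_if_less) auto
    note A = asymp_id_decay[OF nn(1,3) order_refl nn(4) dec]
    show ?thesis unfolding e[OF assms(3,4)] recip_top
      using s by (intro conjI A(1) quot_eq[OF A(2)] vol_eq[OF A(3)])
        (auto simp: vol_rate_def psi_quot_def psi_def powr_minus_divide)
  qed
  moreover have "asymp_equal_on (\<lambda>n k. True) (e_id p u p v) (\<lambda>n k. 2 powr (- (real k / real n)))"
    if "p < \<infinity>" "u \<le> v"
  proof -
    have s: "0 < ?s" using that recip_pos_iff[OF assms(1)] by simp
    have "?b \<le> ?a" using that recip_less_iff[OF assms(4,3)] by (simp add: not_less[symmetric])
    then show ?thesis unfolding e[OF assms(3,4)]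
      using s by (intro vol_eq[OF asymp_id_large[of ?s ?a ?s ?b]] id_large_same_s) (auto simp: vol_rate_def psi_quot_def psi_def)
  qed
  moreover have "asymp_equal_on (\<lambda>n k. k \<le> n) (e_id p u p v)
            (\<lambda>n k. ln (real n / real k + 1) powr (recip v - recip u)) \<and>
          asymp_equal_on (\<lambda>n k. n \<le> k) (e_id p u p v) (\<lambda>n k. 2 powr (- (real k / real n)))"
    if "p < \<infinity>" "v < u"
  proof -
    have s: "0 < ?s" using that recip_pos_iff[OF assms(1)] by simp
    have ab: "?a < ?b" using that recip_less_iff[OF assms(4,3)] by simp
    note A = asymp_log[OF s nn(3) ab]
    show ?thesis unfolding e[OF assms(3,4)]
      using s by (intro conjI A(1) vol_eq[OF A(2)]) (auto simp: vol_rate_def psi_quot_def psi_def)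
  qed
  moreover have "asymp_equal_on (\<lambda>n k. True) (e_id \<infinity> u \<infinity> v)
            (\<lambda>n k. 2 powr (- (real k / real n)) * ln (real n + 1) powr (recip v - recip u))"
    if "v \<le> u"
  proof -
    have "?a \<le> ?b" using that recip_less_iff[OF assms(3,4)] by (simp add: not_less[symmetric])
    then show ?thesis unfolding e[OF assms(3,4)] recip_top
      by (intro vol_eq[OF asymp_id_large[of 0 ?a 0 ?b]] id_large_0) (auto simp: vol_rate_def psi_quot_def psi_def powr_diff)
  qed
  moreover have "asymp_equal_on (\<lambda>n k. real k \<le> ln (real n)) (e_id \<infinity> u \<infinity> v) (\<lambda>n k. 1) \<and>
          asymp_equal_on (\<lambda>n k. ln (real n) \<le> real k \<and> k \<le> n) (e_id \<infinity> u \<infinity> v)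
            (\<lambda>n k. ln (ell k n + 1) powr (recip v - recip u)) \<and>
          asymp_equal_on (\<lambda>n k. n \<le> k) (e_id \<infinity> u \<infinity> v)
            (\<lambda>n k. 2 powr (- (real k / real n)) * ln (real n + 1) powr (recip v - recip u))"
    if "u < v"
  proof -
    have ab: "?b < ?a" using that recip_less_iff[OF assms(3,4)] by simp
    have dec: "id_decay 0 ?a 0 ?b" using ab by (intro id_decay_0) auto
    note A = asymp_id_decay[OF order_refl nn(3) order_refl nn(4) dec]
    show ?thesis unfolding e[OF assms(3,4)] recip_top
      by (intro conjI A(1) quot_eq[OF A(2)] vol_eq[OF A(3)]) (auto simp: vol_rate_def psi_quot_def psi_def powr_diff)
  qed
  ultimately show ?thesis by blast
qed

end
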